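(* For a power series $\mathcal V(x)=\frac{x^2}{2}-\sum_{n\ge1}\frac{a_nx^n}{n}$ put $\alpha(\mathcal V)=\sup_{n\ge1}|a_n|^{1/n}$, and let $\mathcal F_0(t)$ (written $\mathcal F_0^{\mathrm{ev}}(t)$ when $\mathcal V$ is even) be the planar limit obtained by replacing each $a_n$ by $t^{n/2}a_n$. If $\mathcal V$ is even, then $\mathcal F_0^{\mathrm{ev}}(t)$ has radius of convergence at least $\frac{1}{8\sqrt{\alpha(\mathcal V)}}$. For arbitrary potentials $\mathcal V$, $\mathcal F_0(t)$ has radius of convergence at least $\frac{1}{12\sqrt{\alpha(\mathcal V)}}$. Both of these bounds are sharp.
   Context: $\mathcal V$ is analytic near $0$ if and only if $\alpha(\mathcal V)<\infty$. Formal planar limit: let $\mathcal A=\mathbb Q[[a_1,a_2,\dots]]$ (with the $a_n$ regarded as indeterminates) and let $\mathcal H_N$ be the space of $N\times N$ Hermitian matrices. Put $$\mathcal Z=\frac{\int_{\mathcal H_N}\exp\big(-N\,\mathrm{Tr}(M^2/2)+N\sum_{n\ge1}\frac{a_n}{n}\mathrm{Tr}(M^n)\big)dM}{\int_{\mathcal H_N}\exp(-N\,\mathrm{Tr}(M^2/2))\,dM},$$ expanded in powers of the $a_n$ and integrated coefficientwise against the Gaussian. Then $\log\mathcal Z=\sum_{g\ge0}N^{2-2g}\mathcal F_g$ with $\mathcal F_g\in\mathcal A$; $\mathcal F_0\in\mathcal A$ is the formal planar limit. Replacing $a_n$ by $t^{n/2}a_n$, with $a_n$ now the given coefficients of $\mathcal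 V$, turns $\mathcal F_0$ into a formal power series $\mathcal F_0(t)$ in $t$.
   Formalization: The bounds proved are 1/(8α²) and 1/(12α²) instead of 1/(8√α) and 1/(12√α); the printed ones fail, e.g. only a_2=a>16 gives radius 1/a < 1/(8a^{1/4}). Sharp means equality is attained for every value α>0. *)

theory Defs
  imports
    "HOL-Analysis.Analysis"
    "HOL-Library.Multiset"
    "Jordan_Normal_Form.Matrix"
begin

subsection \<open>Gaussian integrals over Hermitian matrices\<close>

text \<open>
  The space of Hermitian matrices is identified with the space of real families indexed by
  \<open>{..<N} \<times> {..<N}\<close>: the entry on the diagonal at \<open>(i, i)\<close> is \<open>x (i, i)\<close>, and for \<open>i < j\<close> the
  entry at \<open>(i, j)\<close> is \<open>x (i, j) + \<i> x (j, i)\<close>.  Under this identification \<open>dM\<close> is the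
  product of the Lebesgue measures.
\<close>

definition herm_mat :: "nat \<Rightarrow> (nat \<times> nat \<Rightarrow> real) \<Rightarrow> complex mat" where
  "herm_mat N x = mat N N (\<lambda>(i, j).
     if i = j then Complex (x (i, i)) 0
     else if i < j then Complex (x (i, j)) (x (j, i))
     else Complex (x (j, i)) (- x (i, j)))"

definition mat_trace :: "'a :: comm_monoid_add mat \<Rightarrow> 'a" where
  "mat_trace A = (\<Sum>i<dim_row A. A $$ (i, i))"

definition gauss_integral :: "nat \<Rightarrow> (complex mat \<Rightarrow> complex) \<Rightarrow> complex" where
  "gauss_integral N f =
     (\<integral>x. f (herm_mat N x) * exp (- of_nat N * mat_trace (herm_mat N x ^\<^sub>m 2) / 2)
        \<partial>(\<Pi>\<^sub>M _\<in>{..<N} \<times> {..<N}. lborel))"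

subsection \<open>Formal power series in the indeterminates \<open>a\<^sub>1, a\<^sub>2, \<dots>\<close>\<close>

text \<open>
  A monomial is a multiset of positive indices (\<open>{#1, 1, 4#}\<close> stands for \<open>a\<^sub>1\<^sup>2 a\<^sub>4\<close>), and a formal
  power series is the function that assigns to each monomial its coefficient.
\<close>

type_synonym 'a mseries = "nat multiset \<Rightarrow> 'a"

definition ms_one :: "'a :: comm_ring_1 mseries" where
  "ms_one m = (if m = {#} then 1 else 0)"

definition ms_mult :: "'a :: comm_ring_1 mseries \<Rightarrow> 'a mseries \<Rightarrow> 'a mseries" where
  "ms_mult f g m = (\<Sum>p | p \<subseteq># m. f p * g (m - p))"

primrec ms_power :: "'a :: comm_ring_1 mseries \<Rightarrow> nat \<Rightarrow> 'a mseries" where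
  "ms_power f 0 = ms_one"
| "ms_power f (Suc k) = ms_mult f (ms_power f k)"

text \<open>
  For a series with constant coefficient 1, \<open>log f = \<Sum>k\<ge>1. (-1)\<^sup>k\<^sup>+\<^sup>1 (f - 1)\<^sup>k / k\<close>; the terms with
  \<open>k > size m\<close> do not contribute to the coefficient of the monomial \<open>m\<close>.
\<close>

definition ms_log :: "'a :: field_char_0 mseries \<Rightarrow> 'a mseries" where
  "ms_log f m =
     (\<Sum>k = 1..size m. (- 1) ^ Suc k / of_nat k * ms_power (\<lambda>p. f p - ms_one p) k m)"

subsection \<open>The formal planar limit\<close>

text \<open>
  The coefficient of \<open>\<Prod>n. a\<^sub>n\<^bsup>m(n)\<^esup>\<close> in \<open>exp (N \<Sum>n. a\<^sub>n Tr (M\<^sup>n) / n)\<close> is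
  \<open>\<Prod>n. (N Tr (M\<^sup>n) / n)\<^bsup>m(n)\<^esup> / m(n)!\<close>; it is integrated against the normalised Gaussian.
\<close>

definition partition_series :: "nat \<Rightarrow> complex mseries" where
  "partition_series N m =
     (if 0 \<in># m then 0
      else gauss_integral N (\<lambda>M. \<Prod>n\<in>set_mset m.
             (of_nat N * mat_trace (M ^\<^sub>m n) / of_nat n) ^ count m n / fact (count m n))
           / gauss_integral N (\<lambda>_. 1))"

text \<open>
  \<open>log Z = \<Sum>g. N\<^bsup>2-2g\<^esup> F\<^sub>g\<close>, with each \<open>F\<^sub>g\<close> independent of \<open>N\<close>.  Each monomial occurs in only
  finitely many of the \<open>F\<^sub>g\<close>, so this is an identity of Laurent polynomials in \<open>N\<close> for every
  coefficient.
\<close>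

definition genus_expansion :: "(nat \<Rightarrow> rat mseries) \<Rightarrow> bool" where
  "genus_expansion F \<longleftrightarrow>
     (\<forall>m. finite {g. F g m \<noteq> 0} \<and>
       (\<forall>N\<ge>1. ms_log (partition_series N) m =
          (\<Sum>g | F g m \<noteq> 0. of_nat N powi (2 - 2 * int g) * of_rat (F g m))))"

definition formal_planar_limit :: "rat mseries" where
  "formal_planar_limit = (THE F. genus_expansion F) 0"

subsection \<open>Potentials and their planar limits\<close>

text \<open>
  \<open>V(x) = x\<^sup>2/2 - \<Sum>n\<ge>1. a\<^sub>n x\<^sup>n / n\<close>.  The value \<open>a 0\<close> is ignored throughout.  The scalars are
  real or complex.
\<close>

definition potential :: "(nat \<Rightarrow> 'a :: real_normed_field) \<Rightarrow> 'a fps" where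
  "potential a = fps_const (1 / 2) * fps_X ^ 2 -
     Abs_fps (\<lambda>n. if n = 0 then 0 else a n / of_nat n)"

definition fps_even :: "'a :: comm_ring_1 fps \<Rightarrow> bool" where
  "fps_even V \<longleftrightarrow> fps_compose V (- fps_X) = V"

definition alpha :: "(nat \<Rightarrow> 'a :: real_normed_field) \<Rightarrow> ereal" where
  "alpha a = (SUP n\<in>{1..}. ereal (root n (norm (a n))))"

text \<open>
  Replacing \<open>a\<^sub>n\<close> by \<open>t\<^bsup>n/2\<^esup> a\<^sub>n\<close> multiplies a monomial \<open>m\<close> by \<open>t\<close> to the power \<open>\<Sum>\<^sub># m / 2\<close>.
  Monomials with \<open>\<Sum>\<^sub># m\<close> odd do not occur in the planar limit, because the Gaussian is invariant
  under \<open>M \<mapsto> - M\<close>; hence only integral powers of \<open>t\<close> remain.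
\<close>

definition planar_series :: "(nat \<Rightarrow> 'a :: real_normed_field) \<Rightarrow> 'a fps" where
  "planar_series a = Abs_fps (\<lambda>e.
     \<Sum>m | 0 \<notin># m \<and> \<Sum>\<^sub># m = 2 * e. of_rat (formal_planar_limit m) * (\<Prod>n\<in>#m. a n))"

text \<open>
  The bounds on the radius of convergence are \<open>1 / (8 \<alpha>\<^sup>2)\<close> and \<open>1 / (12 \<alpha>\<^sup>2)\<close>.  In the source they
  are printed with the square root of \<open>\<alpha>\<close> in place of \<open>\<alpha>\<^sup>2\<close>, which agrees with this for \<open>\<alpha> = 1\<close>
  but cannot be meant for other values: the next two lemmas show that \<open>a\<^sub>n \<mapsto> c\<^sup>n a\<^sub>n\<close> multiplies
  \<open>\<alpha>\<close> by \<open>c\<close> and substitutes \<open>c\<^sup>2 t\<close> for \<open>t\<close>, so that the radius is divided by \<open>c\<^sup>2\<close>.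
\<close>

lemma planar_series_scale:
  "fps_nth (planar_series (\<lambda>n. c ^ n * a n)) e = (c\<^sup>2) ^ e * fps_nth (planar_series a) e"
proof -
  have *: "(\<Prod>n\<in>#m. c ^ n * a n) = c ^ (\<Sum>\<^sub># m) * (\<Prod>n\<in>#m. a n)" for m
    by (induction m) (auto simp: power_add)
  show ?thesis
    by (auto simp: planar_series_def * power_mult sum_distrib_left intro!: sum.cong)
qed

lemma alpha_scale:
  assumes "c > 0"
  shows "alpha (\<lambda>n. of_real c ^ n * a n) = ereal c * alpha a"
proof -
  have "alpha (\<lambda>n. of_real c ^ n * a n) =
      (SUP n\<in>{1..}. ereal c * ereal (root n (norm (a n))))"
    unfolding alpha_def using assms
    by (intro SUP_cong) (auto simp: norm_mult norm_power real_root_mult real_root_power_cancel)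
  also have "\<dots> = ereal c * alpha a"
    unfolding alpha_def using assms
    by (intro SUP_ereal_mult_left) auto
  finally show ?thesis .
qed

end

theory Submission
  imports
    Defs
    "HOL-Probability.Distributions"
    "HOL-Complex_Analysis.Cauchy_Integral_Formula"
begin

text \<open>
  Gaussian integration by parts yields the loop equations for the moments of traces.  Dividing them
  by the partition function turns them into a recursion for the connected correlators, which shows
  that these are polynomials in \<open>1 / N\<^sup>2\<close> with nonnegative coefficients; this gives the genus
  expansion, and its uniqueness makes the planar part symmetric in the choice of the root.  Since
  the coefficients of the planar limit are nonnegative, the extreme case is \<open>a\<^sub>n = c\<^sup>n\<close> (for even
  potentials, for even \<open>n\<close> only), where the planar recursion collapses to Tutte's quadratic functional
  equation in one catalytic variable.  The quadratic method yields the algebraic equations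
  \<open>(54 t\<^sup>2 M + 1 - 18 t)\<^sup>2 = (1 - 12 t)\<^sup>3\<close> and \<open>(32 t\<^sup>2 M + 1 - 12 t - 8 t\<^sup>2)\<^sup>2 = (1 - 8 t)\<^sup>3\<close> for the generating
  function \<open>M\<close> of rooted planar maps, so \<open>M\<close> has radius of convergence exactly \<open>1/12\<close> and \<open>1/8\<close>.
\<close>

section \<open>Multivariate formal power series\<close>

text \<open>The recursion for the correlators distinguishes one trace, the root, and yields
  \<open>n * count m n\<close> times the coefficient of log Z at \<open>m\<close>. That the quotient
  is the same for every root is invisible in the recursion; it follows because two roots give two
  Laurent polynomials in \<open>N\<close> with the same values. This freedom is what removes
  symmetry factors: added over all roots, the numbers \<open>n * count m n\<close> give the total
  degree, which is the same for all monomials contributing to one power of \<open>t\<close>. The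
  quadratic method is carried out with real numbers instead of formal series. A crude majorant gives
  convergence for \<open>t\<close> up to 1/24 and \<open>x\<close> up to 2, a sign change to the
  right of x = 1 produces the double root, and elimination gives the algebraic equation for small
  positive \<open>t\<close>. Isolation of zeros turns it into an identity of power series, so the
  auxiliary bound 1/24 leaves no trace: the radius is that of a binomial series with exponent 3/2,
  whose branch point is 1/12 or 1/8.\<close>

lemma finite_submultisets [simp]: "finite {p. p \<subseteq># (m :: 'a multiset)}"
proof (induction m)
  case (add x m)
  have "{p. p \<subseteq># add_mset x m} \<subseteq> {p. p \<subseteq># m} \<union> add_mset x ` {p. p \<subseteq># m}"
  proof
    fix p assume "p \<in> {p. p \<subseteq># add_mset x m}"
    then have p: "p \<subseteq># add_mset x m" by simp
    show "p \<in> {p. p \<subseteq># m} \<union> add_mset x ` {p. p \<subseteq># m}"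
    proof (cases "x \<in># p")
      case True
      then have "p = add_mset x (p - {#x#})" "p - {#x#} \<subseteq># m"
        using p by (auto simp: subset_eq_diff_conv)
      then show ?thesis by blast
    next
      case False
      then show ?thesis using p by (metis UnI1 diff_single_trivial mem_Collect_eq subset_eq_diff_conv add_mset_add_single)
    qed
  qed
  with add show ?case by (meson finite_UnI finite_imageI finite_subset)
qed simp

lemma ms_mult_commute: "ms_mult f g = ms_mult g f"
proof
  fix m
  show "ms_mult f g m = ms_mult g f m"
    unfolding ms_mult_def
    by (rule sum.reindex_bij_witness[where i = "\<lambda>p. m - p" and j = "\<lambda>p. m - p"])
       (auto simp: subset_mset.diff_diff_right mult.commute subset_mset.add_diff_inverse)
qed

text \<open>Both sides sum over the ways to split \<open>m\<close> into three parts; a chain of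
  submultisets \<open>q\<close>, \<open>p\<close> of \<open>m\<close> is recoded by \<open>q\<close>
  and \<open>p - q\<close>.\<close>

lemma ms_mult_assoc: "ms_mult (ms_mult f g) h = ms_mult f (ms_mult g h)"
proof
  fix m
  have "ms_mult (ms_mult f g) h m =
      (\<Sum>(p, q)\<in>(SIGMA p:{p. p \<subseteq># m}. {q. q \<subseteq># p}). f q * g (p - q) * h (m - p))"
    by (simp add: ms_mult_def sum_distrib_right sum.Sigma)
  also have "\<dots> = (\<Sum>(q, r)\<in>(SIGMA q:{q. q \<subseteq># m}. {r. r \<subseteq># m - q}). f q * (g r * h (m - q - r)))"
    by (rule sum.reindex_bij_witness[where j = "\<lambda>(p, q). (q, p - q)" and i = "\<lambda>(q, r). (q + r, q)"])
       (auto simp: mult.assoc subset_eq_diff_conv intro: subset_mset.order_trans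
         simp flip: diff_diff_add_mset,
        auto simp: subseteq_mset_def le_diff_conv2 add.commute intro: le_trans)
  also have "\<dots> = ms_mult f (ms_mult g h) m"
    by (simp add: ms_mult_def sum_distrib_left sum.Sigma)
  finally show "ms_mult (ms_mult f g) h m = ms_mult f (ms_mult g h) m" .
qed

lemma ms_mult_one_left [simp]: "ms_mult ms_one f = f"
proof
  fix m
  have "ms_mult ms_one f m = (\<Sum>p | p \<subseteq># m. if p = {#} then f m else 0)"
    unfolding ms_mult_def ms_one_def by (intro sum.cong) auto
  also have "\<dots> = f m" by (subst sum.delta) auto
  finally show "ms_mult ms_one f m = f m" .
qed

lemma ms_mult_add_right: "ms_mult f (\<lambda>m. g m + h m) m = ms_mult f g m + ms_mult f h m"
  by (simp add: ms_mult_def distrib_left sum.distrib)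

lemma ms_mult_add_left: "ms_mult (\<lambda>m. g m + h m) f m = ms_mult g f m + ms_mult h f m"
  by (simp add: ms_mult_def distrib_right sum.distrib)

lemma ms_mult_sum_right: "ms_mult f (\<lambda>m. \<Sum>i\<in>A. g i m) m = (\<Sum>i\<in>A. ms_mult f (g i) m)"
  unfolding ms_mult_def by (simp add: sum_distrib_left) (rule sum.swap)

lemma ms_mult_scale_right: "ms_mult f (\<lambda>m. c * g m) m = c * ms_mult f g m"
  by (simp add: ms_mult_def sum_distrib_left mult_ac)

text \<open>The coefficient of a product at \<open>m\<close> is \<open>g m\<close> plus terms at
  strictly smaller monomials, so induction on the size divides by \<open>f\<close>. The predicate
  \<open>P\<close> confines the division to monomials avoiding the index 0, where the moment
  identities will be available.\<close>

lemma ms_mult_cancel: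
  fixes f g :: "'a :: comm_ring_1 mseries"
  assumes f: "f {#} = 1"
    and eq: "\<And>m. P m \<Longrightarrow> ms_mult f g m = ms_mult f h m"
    and P: "\<And>m p. P m \<Longrightarrow> p \<subseteq># m \<Longrightarrow> P p"
  shows "P m \<Longrightarrow> g m = h m"
proof (induction "size m" arbitrary: m rule: less_induct)
  case less
  have split: "ms_mult f k m = k m + (\<Sum>p\<in>{p. p \<subseteq># m} - {{#}}. f p * k (m - p))" for k
    unfolding ms_mult_def by (subst sum.remove[of _ "{#}"]) (auto simp: f)
  have "f p * g (m - p) = f p * h (m - p)" if "p \<subseteq># m" "p \<noteq> {#}" for p
  proof -
    have "size (m - p) < size m"
      using that size_mset_mono[OF that(1)] nonempty_has_size[of p] by (auto simp: size_Diff_submset)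
    then show ?thesis using less P[of m "m - p"] by simp
  qed
  then have "(\<Sum>p\<in>{p. p \<subseteq># m} - {{#}}. f p * g (m - p)) = (\<Sum>p\<in>{p. p \<subseteq># m} - {{#}}. f p * h (m - p))"
    by (intro sum.cong) auto
  with split[of g] split[of h] eq[OF less.prems] show ?case by simp
qed

text \<open>The Euler operator \<open>a_n d/da_n\<close>. It keeps every monomial in place, so its
  Leibniz rule is just additivity of \<open>count\<close> over \<open>p\<close> and
  \<open>m - p\<close>.\<close>

definition ms_count :: "nat \<Rightarrow> 'a :: comm_ring_1 mseries \<Rightarrow> 'a mseries" where
  "ms_count n f m = of_nat (count m n) * f m"

lemma ms_count_mult:
  "ms_count n (ms_mult f g) m = ms_mult (ms_count n f) g m + ms_mult f (ms_count n g) m"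
proof -
  have "of_nat (count m n) = (of_nat (count p n) + of_nat (count (m - p) n) :: 'a)" if "p \<subseteq># m" for p
    using that by (metis count_union of_nat_add subset_mset.add_diff_inverse)
  then show ?thesis
    by (auto simp: ms_count_def ms_mult_def sum_distrib_left algebra_simps simp flip: sum.distrib
             intro!: sum.cong)
qed

lemma ms_count_power:
  "ms_count n (ms_power f (Suc k)) = (\<lambda>m. of_nat (Suc k) * ms_mult (ms_power f k) (ms_count n f) m)"
proof (induction k)
  case 0
  have "ms_mult f ms_one = f" for f :: "'a mseries"
    by (metis ms_mult_commute ms_mult_one_left)
  then show ?case by auto
next
  case (Suc k)
  show ?case
  proof
    fix m
    have "ms_count n (ms_power f (Suc (Suc k))) m =
        ms_mult (ms_count n f) (ms_power f (Suc k)) m + ms_mult f (ms_count n (ms_power f (Suc k))) m"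
      by (simp only: ms_power.simps(2)[of f "Suc k"] ms_count_mult)
    also have "ms_mult f (ms_count n (ms_power f (Suc k))) m =
        of_nat (Suc k) * ms_mult f (ms_mult (ms_power f k) (ms_count n f)) m"
      by (simp only: Suc.IH ms_mult_scale_right)
    also have "ms_mult f (ms_mult (ms_power f k) (ms_count n f)) = ms_mult (ms_power f (Suc k)) (ms_count n f)"
      by (simp add: ms_mult_assoc)
    finally show "ms_count n (ms_power f (Suc (Suc k))) m =
        of_nat (Suc (Suc k)) * ms_mult (ms_power f (Suc k)) (ms_count n f) m"
      by (simp add: ms_mult_commute[of "ms_count n f"] algebra_simps)
  qed
qed

lemma ms_power_eq_0:
  assumes "f {#} = 0" "size m < k"
  shows "ms_power f k m = 0"
  using assms(2)
proof (induction k arbitrary: m)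
  case (Suc k)
  have "f p * ms_power f k (m - p) = 0" if "p \<subseteq># m" for p
  proof (cases "p = {#}")
    case False
    then have "size (m - p) < k"
      using that Suc.prems size_mset_mono[OF that(1)] nonempty_has_size[of p]
      by (auto simp: size_Diff_submset)
    then show ?thesis using Suc.IH by simp
  qed (use assms in simp)
  then show ?case by (simp add: ms_mult_def)
qed simp

text \<open>With h = f - 1 and D the Euler operator, D log f is the alternating sum of h^k D h, and
  multiplication by f = 1 + h telescopes it to D f.\<close>

lemma ms_log_count:
  fixes f :: "'a :: field_char_0 mseries"
  assumes f: "f {#} = 1"
  shows "ms_count n f = ms_mult f (ms_count n (ms_log f))"
proof
  fix m :: "nat multiset"
  define h where "h = (\<lambda>p. f p - ms_one p)"
  have h0: "h {#} = 0" by (simp add: h_def f ms_one_def)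
  \<comment> \<open>The truncation in \<open>ms_log\<close> depends on the monomial; a common
    \<open>K\<close> for all submultisets of \<open>m\<close> allows the sums to be multiplied and
    telescoped.\<close>
  define K where "K = Suc (size m)"
  define T where "T k = ms_mult (ms_power h k) (ms_count n h)" for k
  have log: "ms_log f p = (\<Sum>k<K. (- 1) ^ k / of_nat (Suc k) * ms_power h (Suc k) p)" if "p \<subseteq># m" for p
  proof -
    have "ms_log f p = (\<Sum>k=1..size p. (- 1) ^ Suc k / of_nat k * ms_power h k p)"
      by (simp add: ms_log_def h_def)
    also have "\<dots> = (\<Sum>k=1..K. (- 1) ^ Suc k / of_nat k * ms_power h k p)"
      using size_mset_mono[OF that] ms_power_eq_0[of h p, OF h0]
      by (intro sum.mono_neutral_left) (auto simp: K_def)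
    also have "\<dots> = (\<Sum>k<K. (- 1) ^ k / of_nat (Suc k) * ms_power h (Suc k) p)"
      by (rule sum.reindex_bij_witness[where i = Suc and j = "\<lambda>k. k - 1"])
         (auto simp del: ms_power.simps simp: Suc_le_eq gr0_conv_Suc)
    finally show ?thesis .
  qed
  have countlog: "ms_count n (ms_log f) p = (\<Sum>k<K. (- 1) ^ k * T k p)" if "p \<subseteq># m" for p
  proof -
    have "ms_count n (ms_log f) p =
        (\<Sum>k<K. (- 1) ^ k / of_nat (Suc k) * ms_count n (ms_power h (Suc k)) p)"
      unfolding ms_count_def log[OF that] by (simp add: sum_distrib_left mult_ac del: ms_power.simps)
    also have "\<dots> = (\<Sum>k<K. (- 1) ^ k * T k p)"
      by (intro sum.cong) (auto simp: ms_count_power T_def simp del: of_nat_Suc ms_power.simps)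
    finally show ?thesis .
  qed
  have "ms_mult f (ms_count n (ms_log f)) m = ms_mult f (\<lambda>p. \<Sum>k<K. (- 1) ^ k * T k p) m"
    unfolding ms_mult_def by (intro sum.cong) (auto simp: countlog)
  also have "\<dots> = (\<Sum>k<K. (- 1) ^ k * ms_mult f (T k) m)"
    by (simp add: ms_mult_sum_right ms_mult_scale_right)
  also have "\<dots> = (\<Sum>k<K. (- 1) ^ k * (T k m + T (Suc k) m))"
  proof (intro sum.cong refl arg_cong2[where f = "(*)"])
    fix k
    have "f = (\<lambda>p. ms_one p + h p)" by (simp add: h_def)
    then have "ms_mult f (T k) m = T k m + ms_mult h (T k) m"
      by (metis ms_mult_add_left ms_mult_one_left)
    then show "ms_mult f (T k) m = T k m + T (Suc k) m"
      by (simp add: T_def ms_mult_assoc)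
  qed
  also have "\<dots> = T 0 m - (- 1) ^ K * T K m"
    by (induction K) (auto simp: algebra_simps)
  also have "T 0 m = ms_count n f m"
    by (auto simp: T_def ms_count_def h_def ms_one_def)
  \<comment> \<open>A \<open>K\<close>-th power of a series without constant term has no monomials
    of size below \<open>K\<close>, so the end of the telescope is invisible at
    \<open>m\<close>.\<close>
  also have "T K m = 0"
    unfolding T_def ms_mult_def
  proof (intro sum.neutral ballI)
    fix p assume "p \<in> {p. p \<subseteq># m}"
    then have "size p < K" using size_mset_mono[of p m] by (auto simp: K_def)
    then show "ms_power h K p * ms_count n h (m - p) = 0"
      using ms_power_eq_0[of h p K] h0 by simp
  qed
  finally show "ms_count n f m = ms_mult f (ms_count n (ms_log f)) m" by simp
qed

lemma ms_log_empty [simp]: "ms_log f {#} = 0"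
  by (simp add: ms_log_def)

text \<open>The partial derivative \<open>d/da_n\<close>: the Euler operator read at
  \<open>add_mset n m\<close>, from which its rules are inherited.\<close>

definition ms_deriv :: "nat \<Rightarrow> 'a :: comm_ring_1 mseries \<Rightarrow> 'a mseries" where
  "ms_deriv n f m = of_nat (Suc (count m n)) * f (add_mset n m)"

lemma ms_count_add_mset: "ms_count n f (add_mset n m) = ms_deriv n f m"
  by (simp add: ms_count_def ms_deriv_def)

text \<open>A submultiset \<open>p\<close> that uses up every \<open>n\<close> leaves none for
  \<open>g\<close>, and the Euler operator kills such terms.\<close>

lemma ms_mult_count_add_mset: "ms_mult f (ms_count n g) (add_mset n m) = ms_mult f (ms_deriv n g) m"
proof -
  have "ms_mult f (ms_count n g) (add_mset n m) =
      (\<Sum>p | p \<subseteq># m. f p * ms_count n g (add_mset n m - p))"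
    unfolding ms_mult_def
  proof (intro sum.mono_neutral_right ballI)
    show "{p. p \<subseteq># m} \<subseteq> {p. p \<subseteq># add_mset n m}"
      by (auto intro: subset_mset.order_trans)
    fix p assume "p \<in> {p. p \<subseteq># add_mset n m} - {p. p \<subseteq># m}"
    then have p: "p \<subseteq># add_mset n m" "\<not> p \<subseteq># m" by auto
    have "count (add_mset n m) n \<le> count p n"
    proof (rule ccontr)
      assume *: "\<not> count (add_mset n m) n \<le> count p n"
      have "count p k \<le> count m k" for k
        using mset_subset_eq_count[OF p(1), of k] * by (cases "k = n") auto
      with p show False by (simp add: subseteq_mset_def)
    qed
    then show "f p * ms_count n g (add_mset n m - p) = 0" by (simp add: ms_count_def)
  qed simp
  also have "\<dots> = ms_mult f (ms_deriv n g) m"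
    unfolding ms_mult_def
  proof (intro sum.cong refl)
    fix p assume "p \<in> {p. p \<subseteq># m}"
    then have "add_mset n m - p = add_mset n (m - p)"
      by (auto simp: multiset_eq_iff subseteq_mset_def Suc_diff_le)
    then show "f p * ms_count n g (add_mset n m - p) = f p * ms_deriv n g (m - p)"
      by (simp add: ms_count_add_mset)
  qed
  finally show ?thesis .
qed

lemma ms_deriv_mult:
  "ms_deriv n (ms_mult f g) m = ms_mult (ms_deriv n f) g m + ms_mult f (ms_deriv n g) m"
  using ms_count_mult[of n f g "add_mset n m"]
  by (simp add: ms_count_add_mset ms_mult_count_add_mset ms_mult_commute[of _ g])

lemma ms_log_deriv:
  fixes f :: "'a :: field_char_0 mseries"
  assumes "f {#} = 1"
  shows "ms_deriv n f = ms_mult f (ms_deriv n (ms_log f))"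
proof
  fix m
  show "ms_deriv n f m = ms_mult f (ms_deriv n (ms_log f)) m"
    using fun_cong[OF ms_log_count[where f = f and n = n, OF assms], of "add_mset n m"]
    by (simp add: ms_count_add_mset ms_mult_count_add_mset)
qed

text \<open>The inner function is the series \<open>a_q * g q\<close> summed over \<open>q\<close>,
  so this says that multiplication by \<open>f\<close> commutes with multiplication by
  variables.\<close>

lemma ms_mult_sum_variables:
  "ms_mult f (\<lambda>m. \<Sum>q\<in>set_mset m. g q (m - {#q#})) m =
     (\<Sum>q\<in>set_mset m. ms_mult f (g q) (m - {#q#}))"
proof -
  have "ms_mult f (\<lambda>m. \<Sum>q\<in>set_mset m. g q (m - {#q#})) m =
      (\<Sum>(p, q)\<in>(SIGMA p:{p. p \<subseteq># m}. set_mset (m - p)). f p * g q (m - p - {#q#}))"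
    by (simp add: ms_mult_def sum_distrib_left sum.Sigma)
  also have "\<dots> = (\<Sum>(q, p)\<in>(SIGMA q:set_mset m. {p. p \<subseteq># m - {#q#}}). f p * g q (m - {#q#} - p))"
  proof -
    have 1: "p \<subseteq># m - {#q#}" if "p \<subseteq># m" "q \<in># m - p" for p q
      using that by (auto simp: subseteq_mset_def in_diff_count)
    have 2: "p \<subseteq># m" "q \<in># m - p" if "q \<in># m" "p \<subseteq># m - {#q#}" for p q
    proof -
      have *: "count p k \<le> count m k - (if k = q then 1 else 0)" for k
        using mset_subset_eq_count[OF that(2), of k] by auto
      show "p \<subseteq># m" unfolding subseteq_mset_def using * diff_le_self le_trans by blast
      show "q \<in># m - p"
        using *[of q] that(1) by (simp add: in_diff_count Suc_le_eq flip: count_greater_zero_iff)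
    qed
    show ?thesis
      by (rule sum.reindex_bij_witness[where j = "\<lambda>(p, q). (q, p)" and i = "\<lambda>(q, p). (p, q)"])
         (auto simp: diff_right_commute 1 dest: 2 in_diffD)
  qed
  also have "\<dots> = (\<Sum>q\<in>set_mset m. ms_mult f (g q) (m - {#q#}))"
    by (simp add: ms_mult_def sum.Sigma)
  finally show ?thesis .
qed

section \<open>Gaussian integration by parts\<close>

definition gauss_moment :: "real \<Rightarrow> nat \<Rightarrow> real" where
  "gauss_moment b k = (\<integral>x. x ^ k * exp (- (b * x\<^sup>2 / 2)) \<partial>lborel)"

lemma gauss_moment_density:
  fixes b :: real
  assumes "b > 0"
  shows "exp (- (b * x\<^sup>2 / 2)) = sqrt (2 * pi / b) * normal_density 0 (1 / sqrt b) x"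
  using assms by (simp add: normal_density_def field_simps real_sqrt_divide)

lemma
  fixes b :: real
  assumes b: "b > 0"
  shows gauss_moment_even:
      "has_bochner_integral lborel (\<lambda>x. x ^ (2 * k) * exp (- (b * x\<^sup>2 / 2)))
         (sqrt (2 * pi / b) * (fact (2 * k) / ((2 * b) ^ k * fact k)))"
    and gauss_moment_odd:
      "has_bochner_integral lborel (\<lambda>x. x ^ (2 * k + 1) * exp (- (b * x\<^sup>2 / 2))) 0"
proof -
  have s: "1 / sqrt b > 0" and s2: "2 / (1 / sqrt b)\<^sup>2 = 2 * b" using b by (auto simp: field_simps)
  have eq: "x ^ k * exp (- (b * x\<^sup>2 / 2)) = sqrt (2 * pi / b) * (normal_density 0 (1 / sqrt b) x * (x - 0) ^ k)" for x k
    using gauss_moment_density[OF b] by simp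
  show "has_bochner_integral lborel (\<lambda>x. x ^ (2 * k) * exp (- (b * x\<^sup>2 / 2)))
         (sqrt (2 * pi / b) * (fact (2 * k) / ((2 * b) ^ k * fact k)))"
    unfolding eq using normal_moment_even[OF s, of 0 k] unfolding s2
    by (intro has_bochner_integral_mult_right) auto
  show "has_bochner_integral lborel (\<lambda>x. x ^ (2 * k + 1) * exp (- (b * x\<^sup>2 / 2))) 0"
  proof -
    have "has_bochner_integral lborel (\<lambda>x. sqrt (2 * pi / b) *
        (normal_density 0 (1 / sqrt b) x * (x - 0) ^ (2 * k + 1))) (sqrt (2 * pi / b) * 0)"
      using normal_moment_odd[OF s, of 0 k] by (intro has_bochner_integral_mult_right)
    then show ?thesis unfolding eq by simp
  qed
qed

lemma integrable_gauss_moment: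
  fixes b :: real
  assumes "b > 0"
  shows "integrable lborel (\<lambda>x. x ^ k * exp (- (b * x\<^sup>2 / 2)))"
proof (cases "even k")
  case True
  then show ?thesis using gauss_moment_even[OF assms] by (auto elim!: evenE simp: has_bochner_integral_iff)
next
  case False
  then show ?thesis using gauss_moment_odd[OF assms] by (auto elim!: oddE simp: has_bochner_integral_iff)
qed

lemma gauss_moment_0_pos: "b > 0 \<Longrightarrow> gauss_moment b 0 > 0"
  using gauss_moment_even[of b 0] by (auto simp: gauss_moment_def has_bochner_integral_iff)

text \<open>Integration by parts in one variable, read off the closed form of the moments. At
  \<open>k = 0\<close> the truncated \<open>k - 1\<close> is harmless because its factor
  vanishes.\<close>

lemma gauss_moment_rec:
  assumes b: "b > 0"
  shows "b * gauss_moment b (Suc k) = k * gauss_moment b (k - 1)"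
proof (cases "even k")
  case True
  then obtain l where k: "k = 2 * l" by (auto elim!: evenE)
  have *: "gauss_moment b (2 * j + 1) = 0" for j
    using gauss_moment_odd[OF b, of j] unfolding gauss_moment_def by (rule has_bochner_integral_integral_eq)
  show ?thesis
    using *[of l] *[of "l - 1"] k by (cases l) auto
next
  case False
  then obtain l where k: "k = 2 * l + 1" by (auto elim!: oddE)
  have *: "gauss_moment b (2 * j) = sqrt (2 * pi / b) * (fact (2 * j) / ((2 * b) ^ j * fact j))" for j
    using gauss_moment_even[OF b, of j] unfolding gauss_moment_def by (rule has_bochner_integral_integral_eq)
  have "fact (2 * Suc l) = (2 * (real l + 1) * (2 * real l + 1)) * (fact (2 * l) :: real)"
    by (simp add: algebra_simps)
  then have "b * gauss_moment b (2 * Suc l) = (2 * l + 1) * gauss_moment b (2 * l)"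
    unfolding * using b by (simp add: divide_simps del: fact_Suc mult_Suc_right) (simp add: algebra_simps)
  then show ?thesis using k by simp
qed

section \<open>Polynomials in real coordinates and their directional derivatives\<close>

definition coord_monom :: "'i set \<Rightarrow> ('i \<Rightarrow> nat) \<Rightarrow> ('i \<Rightarrow> real) \<Rightarrow> complex" where
  "coord_monom I k x = (\<Prod>p\<in>I. of_real (x p) ^ k p)"

definition coord_monom_deriv ::
    "'i set \<Rightarrow> ('i \<Rightarrow> complex) \<Rightarrow> ('i \<Rightarrow> nat) \<Rightarrow> ('i \<Rightarrow> real) \<Rightarrow> complex" where
  "coord_monom_deriv I v k x =
     (\<Sum>p\<in>I. v p * of_nat (k p) * coord_monom I (k(p := k p - 1)) x)"

lemma coord_monom_add: "coord_monom I (\<lambda>p. k p + l p) x = coord_monom I k x * coord_monom I l x"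
  by (simp add: coord_monom_def power_add prod.distrib)

lemma coord_monom_deriv_add:
  fixes k l :: "'i \<Rightarrow> nat"
  shows "coord_monom_deriv I v (\<lambda>p. k p + l p) x =
     coord_monom_deriv I v k x * coord_monom I l x + coord_monom I k x * coord_monom_deriv I v l x"
proof -
  have *: "v p * of_nat (k p) * (coord_monom I (k(p := k p - 1)) x * coord_monom I l x) =
      v p * of_nat (k p) * coord_monom I ((\<lambda>p. k p + l p)(p := k p + l p - 1)) x"
    for k l :: "'i \<Rightarrow> nat" and p
    by (cases "k p") (auto simp flip: coord_monom_add intro!: arg_cong[where f = "\<lambda>k. coord_monom I k x"])
  have **: "(\<lambda>p. l p + k p)(p := l p + k p - 1) = (\<lambda>p. k p + l p)(p := k p + l p - 1)" for p
    by (auto simp: add.commute)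
  have "coord_monom_deriv I v (\<lambda>p. k p + l p) x =
      (\<Sum>p\<in>I. v p * of_nat (k p) * coord_monom I ((\<lambda>p. k p + l p)(p := k p + l p - 1)) x +
        v p * of_nat (l p) * coord_monom I ((\<lambda>p. k p + l p)(p := k p + l p - 1)) x)"
    unfolding coord_monom_deriv_def by (intro sum.cong) (auto simp: algebra_simps)
  also have "\<dots> = (\<Sum>p\<in>I. v p * of_nat (k p) * (coord_monom I (k(p := k p - 1)) x * coord_monom I l x) +
        v p * of_nat (l p) * (coord_monom I (l(p := l p - 1)) x * coord_monom I k x))"
    by (simp only: *[of _ k l] *[of _ l k] **)
  also have "\<dots> = coord_monom_deriv I v k x * coord_monom I l x +
      coord_monom I k x * coord_monom_deriv I v l x"
    by (simp only: coord_monom_deriv_def sum_distrib_left sum_distrib_right sum.distrib mult_ac)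
  finally show ?thesis .
qed

text \<open>A polynomial \<open>f\<close> together with its derivative \<open>g\<close> in the complex direction \<open>v\<close>.  Generating these
  pairs by adding monomials makes integration by parts, which is not compatible with products,
  a plain induction.\<close>

inductive poly_deriv ::
    "'i set \<Rightarrow> ('i \<Rightarrow> complex) \<Rightarrow> (('i \<Rightarrow> real) \<Rightarrow> complex) \<Rightarrow> (('i \<Rightarrow> real) \<Rightarrow> complex) \<Rightarrow> bool"
  for I v where
  zero: "poly_deriv I v (\<lambda>_. 0) (\<lambda>_. 0)"
| step: "poly_deriv I v f g \<Longrightarrow>
    poly_deriv I v (\<lambda>x. f x + c * coord_monom I k x) (\<lambda>x. g x + c * coord_monom_deriv I v k x)"

lemma poly_deriv_monom: "poly_deriv I v (\<lambda>x. c * coord_monom I k x) (\<lambda>x. c * coord_monom_deriv I v k x)"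
  using poly_deriv.step[OF poly_deriv.zero, of I v c k] by simp

lemma poly_deriv_const: "poly_deriv I v (\<lambda>_. c) (\<lambda>_. 0)"
  using poly_deriv_monom[of I v c "\<lambda>_. 0"] by (simp add: coord_monom_def coord_monom_deriv_def)

lemma poly_deriv_coord:
  assumes "finite I" "q \<in> I"
  shows "poly_deriv I v (\<lambda>x. of_real (x q)) (\<lambda>_. v q)"
proof -
  let ?k = "\<lambda>p. if p = q then 1 else 0 :: nat"
  have "coord_monom I ?k x = of_real (x q)" for x
  proof -
    have "coord_monom I ?k x = (\<Prod>p\<in>I. if p = q then of_real (x p) else 1)"
      unfolding coord_monom_def by (intro prod.cong) auto
    with assms show ?thesis by simp
  qed
  moreover have "coord_monom_deriv I v ?k x = v q" for x
  proof -
    have "coord_monom_deriv I v ?k x = (\<Sum>p\<in>I. if p = q then v p else 0)"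
      unfolding coord_monom_deriv_def
      by (intro sum.cong) (auto simp: coord_monom_def intro!: prod.neutral)
    with assms show ?thesis by simp
  qed
  ultimately show ?thesis using poly_deriv_monom[of I v 1 ?k] by simp
qed

lemma poly_deriv_add:
  assumes "poly_deriv I v f f'" "poly_deriv I v g g'"
  shows "poly_deriv I v (\<lambda>x. f x + g x) (\<lambda>x. f' x + g' x)"
  using assms(2)
proof induction
  case zero
  then show ?case using assms by simp
next
  case (step g g' c k)
  from poly_deriv.step[OF step.IH, of c k] show ?case by (simp add: add.assoc)
qed

lemma poly_deriv_sum:
  "(\<And>i. i \<in> A \<Longrightarrow> poly_deriv I v (f i) (g i)) \<Longrightarrow>
     poly_deriv I v (\<lambda>x. \<Sum>i\<in>A. f i x) (\<lambda>x. \<Sum>i\<in>A. g i x)"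
  by (induction A rule: infinite_finite_induct) (auto intro: poly_deriv_const poly_deriv_add)

lemma poly_deriv_mult:
  assumes "poly_deriv I v f f'" "poly_deriv I v g g'"
  shows "poly_deriv I v (\<lambda>x. f x * g x) (\<lambda>x. f' x * g x + f x * g' x)"
  using assms(1)
proof induction
  case zero
  then show ?case using poly_deriv.zero by simp
next
  case (step f f' c k)
  have "poly_deriv I v (\<lambda>x. c * coord_monom I k x * g x)
      (\<lambda>x. c * coord_monom_deriv I v k x * g x + c * coord_monom I k x * g' x)"
    using assms(2)
  proof induction
    case zero
    then show ?case using poly_deriv.zero by simp
  next
    case (step g g' d l)
    from poly_deriv.step[OF step.IH, of "c * d" "\<lambda>p. k p + l p"] show ?case
      by (simp add: coord_monom_add coord_monom_deriv_add algebra_simps)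
  qed
  from poly_deriv_add[OF step.IH this] show ?case by (simp add: algebra_simps)
qed

lemma poly_deriv_cong:
  "poly_deriv I v f g \<Longrightarrow> (\<And>x. f x = f' x) \<Longrightarrow> (\<And>x. g x = g' x) \<Longrightarrow> poly_deriv I v f' g'"
  by (metis ext)

text \<open>Every direction generates the same first components, so the zero direction serves as a
  placeholder.\<close>

definition coord_poly :: "'i set \<Rightarrow> (('i \<Rightarrow> real) \<Rightarrow> complex) \<Rightarrow> bool" where
  "coord_poly I f \<longleftrightarrow> (\<exists>g. poly_deriv I (\<lambda>_. 0) f g)"

lemma coord_poly_const: "coord_poly I (\<lambda>_. c)"
  unfolding coord_poly_def by (rule exI, rule poly_deriv_const)

lemma coord_poly_coord: "finite I \<Longrightarrow> q \<in> I \<Longrightarrow> coord_poly I (\<lambda>x. of_real (x q))"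
  unfolding coord_poly_def by (rule exI, rule poly_deriv_coord)

lemma coord_poly_add: "coord_poly I f \<Longrightarrow> coord_poly I g \<Longrightarrow> coord_poly I (\<lambda>x. f x + g x)"
  unfolding coord_poly_def by (elim exE) (rule exI, rule poly_deriv_add)

lemma coord_poly_mult: "coord_poly I f \<Longrightarrow> coord_poly I g \<Longrightarrow> coord_poly I (\<lambda>x. f x * g x)"
  unfolding coord_poly_def by (elim exE) (rule exI, rule poly_deriv_mult)

lemma coord_poly_monom: "coord_poly I (coord_monom I k)"
  unfolding coord_poly_def using poly_deriv_monom[of I "\<lambda>_. 0" 1 k] by auto

lemma coord_poly_sum: "(\<And>i. i \<in> A \<Longrightarrow> coord_poly I (f i)) \<Longrightarrow> coord_poly I (\<lambda>x. \<Sum>i\<in>A. f i x)"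
  by (induction A rule: infinite_finite_induct) (auto intro: coord_poly_const coord_poly_add)

lemma poly_deriv_coord_poly:
  assumes "poly_deriv I v f g"
  shows "coord_poly I f" "coord_poly I g"
proof -
  have "coord_poly I (coord_monom_deriv I v k)" for k
    unfolding coord_monom_deriv_def
    by (intro coord_poly_sum coord_poly_mult coord_poly_const coord_poly_monom)
  with assms have "coord_poly I f \<and> coord_poly I g"
    by (induction) (auto intro!: coord_poly_const coord_poly_add coord_poly_mult coord_poly_monom)
  then show "coord_poly I f" "coord_poly I g" by auto
qed

section \<open>Means under a product of centred Gaussians\<close>

locale gaussian_product =
  fixes I :: "'i set" and b :: "'i \<Rightarrow> real"
  assumes finite_I: "finite I" and b_pos: "p \<in> I \<Longrightarrow> b p > 0"
begin

definition weight :: "('i \<Rightarrow> real) \<Rightarrow> complex" where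
  "weight x = (\<Prod>p\<in>I. of_real (exp (- (b p * (x p)\<^sup>2 / 2))))"

definition mean :: "(('i \<Rightarrow> real) \<Rightarrow> complex) \<Rightarrow> complex" where
  "mean f = (\<integral>x. f x * weight x \<partial>(\<Pi>\<^sub>M _\<in>I. lborel)) / (\<integral>x. weight x \<partial>(\<Pi>\<^sub>M _\<in>I. lborel))"

lemma monom_weight:
  "coord_monom I k x * weight x = (\<Prod>p\<in>I. of_real (x p ^ k p * exp (- (b p * (x p)\<^sup>2 / 2))))"
  by (simp add: coord_monom_def weight_def prod.distrib)

sublocale lborel_prod: product_sigma_finite "\<lambda>_ :: 'i. lborel :: real measure"
  by standard

lemma integrable_monom: "integrable (\<Pi>\<^sub>M _\<in>I. lborel) (\<lambda>x. coord_monom I k x * weight x)"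
  unfolding monom_weight using finite_I b_pos
  by (intro lborel_prod.product_integrable_prod integrable_of_real integrable_gauss_moment) auto

lemma integral_monom:
  "(\<integral>x. coord_monom I k x * weight x \<partial>(\<Pi>\<^sub>M _\<in>I. lborel)) = of_real (\<Prod>p\<in>I. gauss_moment (b p) (k p))"
  unfolding monom_weight using finite_I b_pos
  by (subst lborel_prod.product_integral_prod)
     (auto simp: integral_complex_of_real gauss_moment_def simp del: of_real_mult
       intro!: integrable_of_real integrable_gauss_moment)

lemma integral_weight_nz: "(\<integral>x. weight x \<partial>(\<Pi>\<^sub>M _\<in>I. lborel)) \<noteq> 0"
proof -
  have "(\<integral>x. weight x \<partial>(\<Pi>\<^sub>M _\<in>I. lborel)) = of_real (\<Prod>p\<in>I. gauss_moment (b p) 0)"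
    using integral_monom[of "\<lambda>_. 0"] by (simp add: coord_monom_def)
  also have "\<dots> \<noteq> 0"
    using finite_I b_pos gauss_moment_0_pos by (auto simp: less_imp_neq[symmetric])
  finally show ?thesis .
qed

lemma integrable_coord_poly:
  assumes "coord_poly I f"
  shows "integrable (\<Pi>\<^sub>M _\<in>I. lborel) (\<lambda>x. f x * weight x)"
proof -
  from assms obtain g where "poly_deriv I (\<lambda>_. 0) f g" by (auto simp: coord_poly_def)
  then show ?thesis
    by induction (auto simp: distrib_right mult.assoc intro!: Bochner_Integration.integrable_add integrable_mult_right integrable_monom)
qed

lemma mean_add:
  "coord_poly I f \<Longrightarrow> coord_poly I g \<Longrightarrow> mean (\<lambda>x. f x + g x) = mean f + mean g"
  by (simp add: mean_def distrib_right integrable_coord_poly add_divide_distrib)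

lemma mean_scale: "mean (\<lambda>x. c * f x) = c * mean f"
  by (simp add: mean_def mult.assoc)

lemma mean_const: "mean (\<lambda>_. c) = c"
  using integral_weight_nz by (simp add: mean_def)

lemma mean_sum:
  "(\<And>i. i \<in> A \<Longrightarrow> coord_poly I (f i)) \<Longrightarrow> mean (\<lambda>x. \<Sum>i\<in>A. f i x) = (\<Sum>i\<in>A. mean (f i))"
  by (induction A rule: infinite_finite_induct)
     (auto simp: mean_const mean_add coord_poly_sum)

lemma mean_sum2:
  assumes "\<And>i j. i \<in> A \<Longrightarrow> j \<in> B \<Longrightarrow> coord_poly I (f i j)"
  shows "mean (\<lambda>x. \<Sum>i\<in>A. \<Sum>j\<in>B. f i j x) = (\<Sum>i\<in>A. \<Sum>j\<in>B. mean (f i j))"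
proof -
  have "mean (\<lambda>x. \<Sum>i\<in>A. \<Sum>j\<in>B. f i j x) = (\<Sum>i\<in>A. mean (\<lambda>x. \<Sum>j\<in>B. f i j x))"
    using assms by (intro mean_sum coord_poly_sum)
  also have "\<dots> = (\<Sum>i\<in>A. \<Sum>j\<in>B. mean (f i j))"
    using assms by (intro sum.cong refl mean_sum)
  finally show ?thesis .
qed

text \<open>By Fubini only the factor of the coordinate \<open>p\<close> changes, and there the
  one-dimensional recursion applies.\<close>

lemma mean_monom_Suc:
  assumes "p \<in> I"
  shows "of_real (b p) * mean (\<lambda>x. of_real (x p) * coord_monom I k x) =
         of_nat (k p) * mean (coord_monom I (k(p := k p - 1)))"
proof -
  let ?Z = "(\<integral>x. weight x \<partial>(\<Pi>\<^sub>M _\<in>I. lborel))"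
  have split: "(\<Prod>q\<in>I. gauss_moment (b q) ((k(p := j)) q)) =
      gauss_moment (b p) j * (\<Prod>q\<in>I - {p}. gauss_moment (b q) (k q))" for j
    using finite_I assms by (subst prod.remove[of _ p]) (auto intro!: prod.cong)
  have up: "of_real (x p) * coord_monom I k x = coord_monom I (k(p := Suc (k p))) x" for x
    unfolding coord_monom_def using finite_I assms
    by (subst (1 2) prod.remove[of _ p]) (auto intro!: prod.cong)
  have "of_real (b p) * mean (\<lambda>x. of_real (x p) * coord_monom I k x) =
      of_real (b p * gauss_moment (b p) (Suc (k p)) * (\<Prod>q\<in>I - {p}. gauss_moment (b q) (k q))) / ?Z"
    unfolding up mean_def integral_monom split by simp
  also have "\<dots> = of_real (k p * gauss_moment (b p) (k p - 1) * (\<Prod>q\<in>I - {p}. gauss_moment (b q) (k q))) / ?Z"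
    using gauss_moment_rec[OF b_pos[OF assms], of "k p"] by simp
  also have "\<dots> = of_nat (k p) * mean (coord_monom I (k(p := k p - 1)))"
    unfolding mean_def integral_monom split by simp
  finally show ?thesis .
qed

text \<open>The linear form is minus the derivative along \<open>v\<close> of the exponent of the
  weight. Both sides are linear in the pair, so the induction leaves a single monomial, where each
  coordinate contributes its moment recursion.\<close>

lemma integration_by_parts:
  assumes "poly_deriv I v f g"
  shows "mean (\<lambda>x. (\<Sum>p\<in>I. of_real (b p) * v p * of_real (x p)) * f x) = mean g"
  using assms
proof induction
  case zero
  then show ?case by (simp add: mean_const)
next
  case (step f g c k)
  let ?l = "\<lambda>x. \<Sum>p\<in>I. of_real (b p) * v p * of_real (x p) :: complex"
  have l: "coord_poly I ?l"
    using finite_I by (intro coord_poly_sum coord_poly_mult coord_poly_const coord_poly_coord)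
  note poly = poly_deriv_coord_poly[OF step.hyps]
  have "mean (\<lambda>x. ?l x * coord_monom I k x) =
      mean (\<lambda>x. \<Sum>p\<in>I. v p * of_real (b p) * (of_real (x p) * coord_monom I k x))"
    by (simp add: sum_distrib_left sum_distrib_right mult_ac)
  also have "\<dots> = (\<Sum>p\<in>I. v p * (of_real (b p) * mean (\<lambda>x. of_real (x p) * coord_monom I k x)))"
    using finite_I
    by (subst mean_sum)
       (auto simp: mean_scale mult.assoc intro!: coord_poly_mult coord_poly_const coord_poly_coord coord_poly_monom)
  also have "\<dots> = (\<Sum>p\<in>I. v p * of_nat (k p) * mean (coord_monom I (k(p := k p - 1))))"
    by (intro sum.cong) (auto simp: mean_monom_Suc)
  also have "\<dots> = mean (coord_monom_deriv I v k)"
    unfolding coord_monom_deriv_def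
    by (subst mean_sum)
       (auto simp: mean_scale intro!: coord_poly_mult coord_poly_const coord_poly_monom)
  finally have monom: "mean (\<lambda>x. ?l x * coord_monom I k x) = mean (coord_monom_deriv I v k)" .
  have "mean (\<lambda>x. ?l x * (f x + c * coord_monom I k x)) =
      mean (\<lambda>x. ?l x * f x + c * (?l x * coord_monom I k x))"
    by (simp add: algebra_simps)
  also have "\<dots> = mean (\<lambda>x. ?l x * f x) + c * mean (\<lambda>x. ?l x * coord_monom I k x)"
    using l poly by (subst mean_add) (auto simp: mean_scale intro!: coord_poly_mult coord_poly_const coord_poly_monom)
  also have "\<dots> = mean g + c * mean (coord_monom_deriv I v k)"
    by (simp add: step.IH monom)
  also have "\<dots> = mean (\<lambda>x. g x + c * coord_monom_deriv I v k x)"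
    using poly poly_deriv_coord_poly(2)[OF poly_deriv_monom[of I v c k]]
    by (subst mean_add) (auto simp: mean_scale)
  finally show ?case .
qed

end

section \<open>Loop equations for Hermitian matrices\<close>

definition herm_index :: "nat \<Rightarrow> (nat \<times> nat) set" where
  "herm_index N = {..<N} \<times> {..<N}"

text \<open>\<open>N Tr (M\<^sup>2) / 2\<close> contains the squared modulus of each off-diagonal
  entry twice, so its real and imaginary parts have twice the rate of a diagonal coordinate.\<close>

definition herm_rate :: "nat \<Rightarrow> nat \<times> nat \<Rightarrow> real" where
  "herm_rate N p = (if fst p = snd p then real N else 2 * real N)"

locale hermitian_gaussian =
  fixes N :: nat
  assumes N_pos: "N \<ge> 1"

sublocale hermitian_gaussian \<subseteq> gaussian_product "herm_index N" "herm_rate N"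
  using N_pos by unfold_locales (auto simp: herm_index_def herm_rate_def)

context hermitian_gaussian
begin

definition pow :: "nat \<Rightarrow> nat \<Rightarrow> nat \<Rightarrow> (nat \<times> nat \<Rightarrow> real) \<Rightarrow> complex" where
  "pow n k l x = (herm_mat N x ^\<^sub>m n) $$ (k, l)"

definition tr :: "nat \<Rightarrow> (nat \<times> nat \<Rightarrow> real) \<Rightarrow> complex" where
  "tr n x = mat_trace (herm_mat N x ^\<^sub>m n)"

definition trs :: "nat multiset \<Rightarrow> (nat \<times> nat \<Rightarrow> real) \<Rightarrow> complex" where
  "trs m x = (\<Prod>n\<in>#m. tr n x)"

definition moment :: "nat multiset \<Rightarrow> complex" where
  "moment m = mean (trs m)"

lemma herm_carrier: "herm_mat N x \<in> carrier_mat N N"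
  by (simp add: herm_mat_def)

lemma herm_dim [simp]: "dim_row (herm_mat N x) = N" "dim_col (herm_mat N x) = N"
  by (simp_all add: herm_mat_def)

lemma pow_dim [simp]: "dim_row (herm_mat N x ^\<^sub>m n) = N" "dim_col (herm_mat N x ^\<^sub>m n) = N"
  using pow_carrier_mat[OF herm_carrier] by auto

lemma tr_eq: "tr n x = (\<Sum>i<N. pow n i i x)"
  by (simp add: tr_def mat_trace_def pow_def)

lemma pow_0: "k < N \<Longrightarrow> l < N \<Longrightarrow> pow 0 k l x = (if k = l then 1 else 0)"
  by (simp add: pow_def)

lemma tr_0: "tr 0 x = of_nat N"
  by (simp add: tr_eq pow_0)

lemma pow_1: "k < N \<Longrightarrow> l < N \<Longrightarrow> pow (Suc 0) k l x = herm_mat N x $$ (k, l)"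
  by (simp add: pow_def)

lemma pow_Suc:
  "k < N \<Longrightarrow> l < N \<Longrightarrow> pow (Suc n) k l x = (\<Sum>r<N. pow n k r x * pow (Suc 0) r l x)"
  by (simp add: pow_def scalar_prod_def lessThan_atLeast0)

lemma pow_add:
  assumes "k < N" "l < N"
  shows "pow (a + b) k l x = (\<Sum>r<N. pow a k r x * pow b r l x)"
  using assms(2)
proof (induction b arbitrary: l)
  case 0
  have "(\<Sum>r<N. pow a k r x * pow 0 r l x) = (\<Sum>r<N. if r = l then pow a k r x else 0)"
    using 0 by (intro sum.cong) (auto simp: pow_0)
  then show ?case using 0 by simp
next
  case (Suc b)
  have "pow (a + Suc b) k l x = (\<Sum>s<N. (\<Sum>r<N. pow a k r x * pow b r s x) * pow (Suc 0) s l x)"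
    using Suc assms by (simp add: pow_Suc)
  also have "\<dots> = (\<Sum>r<N. pow a k r x * (\<Sum>s<N. pow b r s x * pow (Suc 0) s l x))"
    unfolding sum_distrib_left sum_distrib_right by (subst sum.swap) (simp add: mult.assoc)
  also have "\<dots> = (\<Sum>r<N. pow a k r x * pow (Suc b) r l x)"
    using Suc.prems by (intro sum.cong) (auto simp: pow_Suc)
  finally show ?case .
qed

lemma pow_Suc':
  assumes "k < N" "l < N"
  shows "pow (Suc n) k l x = (\<Sum>r<N. pow (Suc 0) k r x * pow n r l x)"
  using pow_add[OF assms, of 1 n] by simp

text \<open>\<open>herm_dir i j\<close> is the direction whose derivative is dual, under the Gaussian, to
  multiplication by the matrix entry \<open>(i, j)\<close>; it plays the role of \<open>\<partial>/\<partial>M\<^sub>j\<^sub>i\<close>.\<close>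

definition herm_dir :: "nat \<Rightarrow> nat \<Rightarrow> nat \<times> nat \<Rightarrow> complex" where
  "herm_dir i j p =
     (if i = j then (if p = (i, j) then 1 else 0)
      else if i < j then (if p = (i, j) then 1 / 2 else if p = (j, i) then \<i> / 2 else 0)
      else (if p = (j, i) then 1 / 2 else if p = (i, j) then - \<i> / 2 else 0))"

text \<open>The rate \<open>2 * N\<close> of the off-diagonal coordinates cancels the 1/2 in
  \<open>herm_dir\<close>; integration by parts along this direction therefore trades a factor
  \<open>N\<close> times the entry for a derivative.\<close>

lemma herm_dir_entry:
  assumes "i < N" "j < N"
  shows "(\<Sum>p\<in>herm_index N. of_real (herm_rate N p) * herm_dir i j p * of_real (x p)) =
         of_nat N * pow (Suc 0) i j x"
proof -
  let ?f = "\<lambda>p. of_real (herm_rate N p) * herm_dir i j p * of_real (x p)"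
  have "(\<Sum>p\<in>herm_index N. ?f p) = (\<Sum>p\<in>{(i, j), (j, i)}. ?f p)"
    using assms finite_I
    by (intro sum.mono_neutral_right) (auto simp: herm_index_def herm_dir_def)
  also have "\<dots> = of_nat N * pow (Suc 0) i j x"
    using assms by (cases "i = j"; cases "i < j")
      (auto simp: pow_1 herm_dir_def herm_rate_def herm_mat_def Complex_eq algebra_simps)
  finally show ?thesis .
qed

text \<open>This is the propagator: the Gaussian pairs the entry \<open>(i, j)\<close> with the
  entry \<open>(j, i)\<close> only. For complex directions these two entries vary
  independently.\<close>

lemma poly_deriv_entry:
  assumes "i < N" "j < N" "k < N" "l < N"
  shows "poly_deriv (herm_index N) (herm_dir i j) (pow (Suc 0) k l)
           (\<lambda>_. if k = j \<and> l = i then 1 else 0)"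
proof -
  have coord: "poly_deriv (herm_index N) v (\<lambda>x. of_real (x (a, b))) (\<lambda>_. v (a, b))"
    if "a < N" "b < N" for a b v
    using that finite_I by (intro poly_deriv_coord) (auto simp: herm_index_def)
  let ?P = "poly_deriv (herm_index N) (herm_dir i j)"
  consider "k = l" | "k < l" | "l < k" by linarith
  then show ?thesis
  proof cases
    case 1
    then show ?thesis
      using assms by (intro poly_deriv_cong[OF coord[of k k]])
        (auto simp: pow_1 herm_mat_def Complex_eq herm_dir_def)
  next
    case 2
    have "?P (\<lambda>x. of_real (x (k, l)) + \<i> * of_real (x (l, k)))
        (\<lambda>x. herm_dir i j (k, l) + (0 * of_real (x (l, k)) + \<i> * herm_dir i j (l, k)))"
      using assms by (intro poly_deriv_add poly_deriv_mult poly_deriv_const coord)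
    then show ?thesis
      by (rule poly_deriv_cong) (use 2 assms in \<open>auto simp: pow_1 herm_mat_def Complex_eq herm_dir_def\<close>)
  next
    case 3
    have "?P (\<lambda>x. of_real (x (l, k)) + (- \<i>) * of_real (x (k, l)))
        (\<lambda>x. herm_dir i j (l, k) + (0 * of_real (x (k, l)) + (- \<i>) * herm_dir i j (k, l)))"
      using assms by (intro poly_deriv_add poly_deriv_mult poly_deriv_const coord)
    then show ?thesis
      by (rule poly_deriv_cong) (use 3 assms in \<open>auto simp: pow_1 herm_mat_def Complex_eq herm_dir_def\<close>)
  qed
qed

text \<open>Leibniz rule: the differentiated factor cuts the product into the \<open>a\<close>
  factors before it and the \<open>n - 1 - a\<close> factors after it.\<close>

lemma poly_deriv_pow:
  assumes "i < N" "j < N" "k < N" "l < N"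
  shows "poly_deriv (herm_index N) (herm_dir i j) (pow n k l)
           (\<lambda>x. \<Sum>a<n. pow a k j x * pow (n - 1 - a) i l x)"
  using assms(4)
proof (induction n arbitrary: l)
  case 0
  show ?case
    by (rule poly_deriv_cong[OF poly_deriv_const[of _ _ "if k = l then 1 else 0"]])
       (use 0 assms in \<open>auto simp: pow_0\<close>)
next
  case (Suc n)
  have "poly_deriv (herm_index N) (herm_dir i j)
      (\<lambda>x. \<Sum>r<N. pow n k r x * pow (Suc 0) r l x)
      (\<lambda>x. \<Sum>r<N. (\<Sum>a<n. pow a k j x * pow (n - 1 - a) i r x) * pow (Suc 0) r l x +
         pow n k r x * (if r = j \<and> l = i then 1 else 0))"
    using assms Suc by (intro poly_deriv_sum poly_deriv_mult poly_deriv_entry) auto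
  then show ?case
  proof (rule poly_deriv_cong)
    fix x
    show "(\<Sum>r<N. pow n k r x * pow (Suc 0) r l x) = pow (Suc n) k l x"
      using assms Suc.prems by (simp add: pow_Suc)
    have "(\<Sum>r<N. (\<Sum>a<n. pow a k j x * pow (n - 1 - a) i r x) * pow (Suc 0) r l x) =
        (\<Sum>a<n. pow a k j x * (\<Sum>r<N. pow (n - 1 - a) i r x * pow (Suc 0) r l x))"
      unfolding sum_distrib_left sum_distrib_right by (subst sum.swap) (simp add: mult.assoc)
    also have "\<dots> = (\<Sum>a<n. pow a k j x * pow (n - a) i l x)"
    proof (intro sum.cong refl)
      fix a assume "a \<in> {..<n}"
      then have "n - a = Suc (n - 1 - a)" by auto
      with assms Suc.prems show "pow a k j x * (\<Sum>r<N. pow (n - 1 - a) i r x * pow (Suc 0) r l x) =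
          pow a k j x * pow (n - a) i l x"
        by (simp add: pow_Suc)
    qed
    finally have 1: "(\<Sum>r<N. (\<Sum>a<n. pow a k j x * pow (n - 1 - a) i r x) * pow (Suc 0) r l x) =
        (\<Sum>a<n. pow a k j x * pow (n - a) i l x)" .
    have "(\<Sum>r<N. pow n k r x * (if r = j \<and> l = i then 1 else 0)) =
        (\<Sum>r<N. if r = j then pow n k r x * pow 0 i l x else 0)"
      using assms Suc.prems by (intro sum.cong) (auto simp: pow_0)
    then have 2: "(\<Sum>r<N. pow n k r x * (if r = j \<and> l = i then 1 else 0)) = pow n k j x * pow 0 i l x"
      using assms by simp
    show "(\<Sum>r<N. (\<Sum>a<n. pow a k j x * pow (n - 1 - a) i r x) * pow (Suc 0) r l x +
         pow n k r x * (if r = j \<and> l = i then 1 else 0)) =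
         (\<Sum>a<Suc n. pow a k j x * pow (Suc n - 1 - a) i l x)"
      unfolding sum.distrib 1 2 by simp
  qed
qed

text \<open>Closing up the trace glues the two pieces back together, so all \<open>n\<close> cuts
  give the same power.\<close>

lemma poly_deriv_tr:
  assumes "i < N" "j < N"
  shows "poly_deriv (herm_index N) (herm_dir i j) (tr n) (\<lambda>x. of_nat n * pow (n - 1) i j x)"
proof -
  have "poly_deriv (herm_index N) (herm_dir i j) (\<lambda>x. \<Sum>k<N. pow n k k x)
      (\<lambda>x. \<Sum>k<N. \<Sum>a<n. pow a k j x * pow (n - 1 - a) i k x)"
    using assms by (intro poly_deriv_sum poly_deriv_pow) auto
  then show ?thesis
  proof (rule poly_deriv_cong)
    fix x
    show "(\<Sum>k<N. pow n k k x) = tr n x" by (simp add: tr_eq)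
    have "(\<Sum>k<N. \<Sum>a<n. pow a k j x * pow (n - 1 - a) i k x) =
        (\<Sum>a<n. \<Sum>k<N. pow (n - 1 - a) i k x * pow a k j x)"
      by (subst sum.swap) (simp add: mult.commute)
    also have "\<dots> = (\<Sum>a<n. pow (n - 1) i j x)"
      using assms by (intro sum.cong refl) (auto simp flip: pow_add)
    finally show "(\<Sum>k<N. \<Sum>a<n. pow a k j x * pow (n - 1 - a) i k x) = of_nat n * pow (n - 1) i j x"
      by simp
  qed
qed

lemma poly_deriv_trs:
  assumes "i < N" "j < N"
  shows "poly_deriv (herm_index N) (herm_dir i j) (trs m)
           (\<lambda>x. \<Sum>q\<in>#m. of_nat q * pow (q - 1) i j x * trs (m - {#q#}) x)"
proof (induction m)
  case empty
  show ?case by (rule poly_deriv_cong[OF poly_deriv_const[of _ _ 1]]) (auto simp: trs_def)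
next
  case (add n m)
  from poly_deriv_mult[OF poly_deriv_tr[OF assms, of n] add.IH] show ?case
  proof (rule poly_deriv_cong)
    fix x
    show "tr n x * trs m x = trs (add_mset n m) x" by (simp add: trs_def)
    have "(\<Sum>q\<in>#m. of_nat q * pow (q - 1) i j x * trs (add_mset n m - {#q#}) x) =
        (\<Sum>q\<in>#m. tr n x * (of_nat q * pow (q - 1) i j x * trs (m - {#q#}) x))"
    proof (intro arg_cong[where f = sum_mset] image_mset_cong)
      fix q assume "q \<in># m"
      then have "add_mset n m - {#q#} = add_mset n (m - {#q#})" by simp
      then show "of_nat q * pow (q - 1) i j x * trs (add_mset n m - {#q#}) x =
          tr n x * (of_nat q * pow (q - 1) i j x * trs (m - {#q#}) x)"
        by (simp add: trs_def mult_ac)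
    qed
    then show "of_nat n * pow (n - 1) i j x * trs m x +
        tr n x * (\<Sum>q\<in>#m. of_nat q * pow (q - 1) i j x * trs (m - {#q#}) x) =
        (\<Sum>q\<in>#add_mset n m. of_nat q * pow (q - 1) i j x * trs (add_mset n m - {#q#}) x)"
      by (simp add: sum_mset_distrib_left image_mset.compositionality o_def)
  qed
qed

lemma coord_poly_pow: "k < N \<Longrightarrow> l < N \<Longrightarrow> coord_poly (herm_index N) (pow n k l)"
  using poly_deriv_coord_poly(1)[OF poly_deriv_pow] by blast

lemma coord_poly_trs: "coord_poly (herm_index N) (trs m)"
  using poly_deriv_coord_poly(1)[OF poly_deriv_trs[of 0 0]] N_pos by simp

lemma coord_poly_sum_mset:
  "(\<And>q. q \<in># m \<Longrightarrow> coord_poly (herm_index N) (f q)) \<Longrightarrow>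
     coord_poly (herm_index N) (\<lambda>x. \<Sum>q\<in>#m. f q x)"
  by (induction m) (auto intro: coord_poly_const coord_poly_add)

lemma mean_sum_mset:
  "(\<And>q. q \<in># m \<Longrightarrow> coord_poly (herm_index N) (f q)) \<Longrightarrow>
     mean (\<lambda>x. \<Sum>q\<in>#m. f q x) = (\<Sum>q\<in>#m. mean (f q))"
  by (induction m) (auto simp: mean_const mean_add coord_poly_sum_mset)

text \<open>Peel one matrix off the new trace, as the sum of \<open>M_ij\<close> times the entry
  \<open>(j, i)\<close> of \<open>M^n\<close>, and integrate it by parts. Where the derivative hits
  \<open>M^n\<close> the trace splits into two; where it hits another trace, the two merge.\<close>

lemma loop_equation:
  "of_nat N * moment (add_mset (Suc n) m) =
     (\<Sum>a<n. moment (add_mset a (add_mset (n - 1 - a) m))) +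
     (\<Sum>q\<in>#m. of_nat q * moment (add_mset (n + q - 1) (m - {#q#})))"
proof -
  define D where "D i j x = (\<Sum>a<n. pow a j j x * pow (n - 1 - a) i i x) * trs m x +
      pow n j i x * (\<Sum>q\<in>#m. of_nat q * pow (q - 1) i j x * trs (m - {#q#}) x)" for i j x
  have D: "poly_deriv (herm_index N) (herm_dir i j) (\<lambda>x. pow n j i x * trs m x) (D i j)"
    if "i < N" "j < N" for i j
    unfolding D_def using that by (intro poly_deriv_mult poly_deriv_pow poly_deriv_trs)
  have polyD: "coord_poly (herm_index N) (D i j)" if "i < N" "j < N" for i j
    using poly_deriv_coord_poly(2)[OF D[OF that]] .
  have "of_nat N * moment (add_mset (Suc n) m) =
      of_nat N * mean (\<lambda>x. \<Sum>i<N. \<Sum>j<N. pow (Suc 0) i j x * (pow n j i x * trs m x))"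
  proof -
    have "trs (add_mset (Suc n) m) = (\<lambda>x. \<Sum>i<N. \<Sum>j<N. pow (Suc 0) i j x * (pow n j i x * trs m x))"
    proof
      fix x
      have "tr (Suc n) x = (\<Sum>i<N. \<Sum>j<N. pow (Suc 0) i j x * pow n j i x)"
        unfolding tr_eq by (intro sum.cong refl pow_Suc') auto
      then show "trs (add_mset (Suc n) m) x = (\<Sum>i<N. \<Sum>j<N. pow (Suc 0) i j x * (pow n j i x * trs m x))"
        by (simp add: trs_def sum_distrib_right mult.assoc)
    qed
    then show ?thesis by (simp add: moment_def)
  qed
  also have "\<dots> = (\<Sum>i<N. \<Sum>j<N. of_nat N * mean (\<lambda>x. pow (Suc 0) i j x * (pow n j i x * trs m x)))"
  proof -
    define T where "T = (\<lambda>i j x. pow (Suc 0) i j x * (pow n j i x * trs m x))"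
    have "coord_poly (herm_index N) (T i j)" if "i < N" "j < N" for i j
      unfolding T_def using that by (intro coord_poly_mult coord_poly_pow coord_poly_trs)
    then have "of_nat N * mean (\<lambda>x. \<Sum>i<N. \<Sum>j<N. T i j x) = (\<Sum>i<N. \<Sum>j<N. of_nat N * mean (T i j))"
      by (subst mean_sum2) (auto simp: sum_distrib_left)
    then show ?thesis by (simp only: T_def)
  qed
  also have "\<dots> = (\<Sum>i<N. \<Sum>j<N. mean (D i j))"
  proof (intro sum.cong refl)
    fix i j assume ij: "i \<in> {..<N}" "j \<in> {..<N}"
    then have "mean (D i j) = mean (\<lambda>x. of_nat N * pow (Suc 0) i j x * (pow n j i x * trs m x))"
      using integration_by_parts[OF D[of i j]] by (simp add: herm_dir_entry)
    then show "of_nat N * mean (\<lambda>x. pow (Suc 0) i j x * (pow n j i x * trs m x)) = mean (D i j)"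
      by (simp add: mean_scale mult.assoc)
  qed
  also have "\<dots> = mean (\<lambda>x. \<Sum>i<N. \<Sum>j<N. D i j x)"
    using polyD by (subst mean_sum2) auto
  also have "(\<lambda>x. \<Sum>i<N. \<Sum>j<N. D i j x) =
      (\<lambda>x. (\<Sum>a<n. trs (add_mset a (add_mset (n - 1 - a) m)) x) +
        (\<Sum>q\<in>#m. of_nat q * trs (add_mset (n + q - 1) (m - {#q#})) x))"
  proof
    fix x
    have 1: "(\<Sum>i<N. \<Sum>j<N. (\<Sum>a<n. pow a j j x * pow (n - 1 - a) i i x) * trs m x) =
        (\<Sum>a<n. trs (add_mset a (add_mset (n - 1 - a) m)) x)"
    proof -
      have "(\<Sum>i<N. \<Sum>j<N. (\<Sum>a<n. pow a j j x * pow (n - 1 - a) i i x) * trs m x) =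
          (\<Sum>i<N. \<Sum>a<n. \<Sum>j<N. pow a j j x * pow (n - 1 - a) i i x * trs m x)"
        unfolding sum_distrib_right by (intro sum.cong refl sum.swap)
      also have "\<dots> = (\<Sum>a<n. \<Sum>i<N. \<Sum>j<N. pow a j j x * pow (n - 1 - a) i i x * trs m x)"
        by (rule sum.swap)
      also have "\<dots> = (\<Sum>a<n. trs (add_mset a (add_mset (n - 1 - a) m)) x)"
        by (simp add: trs_def tr_eq sum_distrib_left sum_distrib_right mult_ac)
      finally show ?thesis .
    qed
    \<comment> \<open>The summation range is a separate \<open>m'\<close>, so that the induction
      leaves the \<open>m\<close> inside the summand fixed.\<close>
    have 2: "(\<Sum>i<N. \<Sum>j<N. pow n j i x * (\<Sum>q\<in>#m'. of_nat q * pow (q - 1) i j x * trs (m - {#q#}) x)) =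
        (\<Sum>q\<in>#m'. of_nat q * trs (add_mset (n + q - 1) (m - {#q#})) x)" for m'
    proof (induction m')
      case (add q m')
      have "(\<Sum>i<N. \<Sum>j<N. pow n j i x * (of_nat q * pow (q - 1) i j x * trs (m - {#q#}) x)) =
          of_nat q * trs (m - {#q#}) x * (\<Sum>j<N. \<Sum>i<N. pow n j i x * pow (q - 1) i j x)"
        by (subst sum.swap) (simp add: sum_distrib_left mult_ac)
      also have "(\<Sum>j<N. \<Sum>i<N. pow n j i x * pow (q - 1) i j x) = tr (n + (q - 1)) x"
        by (simp add: tr_eq pow_add)
      also have "of_nat q * trs (m - {#q#}) x * tr (n + (q - 1)) x =
          of_nat q * trs (add_mset (n + q - 1) (m - {#q#})) x"
        by (cases q) (auto simp: trs_def)
      finally show ?case using add.IH by (simp add: distrib_left sum.distrib)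
    qed simp
    show "(\<Sum>i<N. \<Sum>j<N. D i j x) = (\<Sum>a<n. trs (add_mset a (add_mset (n - 1 - a) m)) x) +
        (\<Sum>q\<in>#m. of_nat q * trs (add_mset (n + q - 1) (m - {#q#})) x)"
      unfolding D_def sum.distrib 1 2 ..
  qed
  also have "mean \<dots> = (\<Sum>a<n. moment (add_mset a (add_mset (n - 1 - a) m))) +
     (\<Sum>q\<in>#m. of_nat q * moment (add_mset (n + q - 1) (m - {#q#})))"
  proof -
    have c: "coord_poly (herm_index N) (\<lambda>x. of_nat q * trs (add_mset (n + q - 1) (m - {#q#})) x)" for q
      by (intro coord_poly_mult coord_poly_const coord_poly_trs)
    have "mean (\<lambda>x. (\<Sum>a<n. trs (add_mset a (add_mset (n - 1 - a) m)) x) +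
        (\<Sum>q\<in>#m. of_nat q * trs (add_mset (n + q - 1) (m - {#q#})) x)) =
      mean (\<lambda>x. \<Sum>a<n. trs (add_mset a (add_mset (n - 1 - a) m)) x) +
      mean (\<lambda>x. \<Sum>q\<in>#m. of_nat q * trs (add_mset (n + q - 1) (m - {#q#})) x)"
      by (intro mean_add coord_poly_sum coord_poly_sum_mset c coord_poly_trs)
    also have "mean (\<lambda>x. \<Sum>a<n. trs (add_mset a (add_mset (n - 1 - a) m)) x) =
        (\<Sum>a<n. moment (add_mset a (add_mset (n - 1 - a) m)))"
      unfolding moment_def by (intro mean_sum coord_poly_trs)
    also have "mean (\<lambda>x. \<Sum>q\<in>#m. of_nat q * trs (add_mset (n + q - 1) (m - {#q#})) x) =
        (\<Sum>q\<in>#m. mean (\<lambda>x. of_nat q * trs (add_mset (n + q - 1) (m - {#q#})) x))"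
      by (intro mean_sum_mset c)
    also have "\<dots> = (\<Sum>q\<in>#m. of_nat q * moment (add_mset (n + q - 1) (m - {#q#})))"
      by (simp only: mean_scale moment_def)
    finally show ?thesis .
  qed
  finally show ?thesis .
qed

lemma moment_empty: "moment {#} = 1"
proof -
  have "trs {#} = (\<lambda>_. 1)" by (simp add: fun_eq_iff trs_def)
  then show ?thesis by (simp add: moment_def mean_const)
qed

lemma moment_0: "moment (add_mset 0 m) = of_nat N * moment m"
proof -
  have "trs (add_mset 0 m) = (\<lambda>x. of_nat N * trs m x)" by (simp add: fun_eq_iff trs_def tr_0)
  then show ?thesis by (simp add: moment_def mean_scale)
qed

lemma weight_eq: "exp (- of_nat N * mat_trace (herm_mat N x ^\<^sub>m 2) / 2) = weight x"
proof -
  have "mat_trace (herm_mat N x ^\<^sub>m 2) = (\<Sum>i<N. \<Sum>j<N. herm_mat N x $$ (i, j) * herm_mat N x $$ (j, i))"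
    by (simp add: numeral_2_eq_2 mat_trace_def scalar_prod_def lessThan_atLeast0)
  also have "\<dots> = (\<Sum>i<N. \<Sum>j<N. of_real (if i = j then (x (i, j))\<^sup>2 else (x (i, j))\<^sup>2 + (x (j, i))\<^sup>2))"
    by (intro sum.cong refl) (auto simp: herm_mat_def complex_eq_iff power2_eq_square)
  also have "\<dots> = (\<Sum>i<N. \<Sum>j<N. of_real ((x (i, j))\<^sup>2) + of_real (if i = j then 0 else (x (j, i))\<^sup>2))"
    by (intro sum.cong refl) auto
  also have "\<dots> = (\<Sum>i<N. \<Sum>j<N. of_real ((x (i, j))\<^sup>2)) + (\<Sum>j<N. \<Sum>i<N. of_real (if i = j then 0 else (x (i, j))\<^sup>2))"
    by (simp only: sum.distrib eq_commute)
  also have "(\<Sum>j<N. \<Sum>i<N. of_real (if i = j then 0 else (x (i, j))\<^sup>2)) =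
      (\<Sum>i<N. \<Sum>j<N. of_real (if i = j then 0 else (x (i, j))\<^sup>2) :: complex)"
    by (rule sum.swap)
  also have "(\<Sum>i<N. \<Sum>j<N. of_real ((x (i, j))\<^sup>2)) + \<dots> =
      (\<Sum>i<N. \<Sum>j<N. of_real ((if i = j then 1 else 2) * (x (i, j))\<^sup>2))"
    unfolding sum.distrib[symmetric] by (intro sum.cong refl) auto
  finally have "mat_trace (herm_mat N x ^\<^sub>m 2) =
      (\<Sum>p\<in>herm_index N. of_real ((if fst p = snd p then 1 else 2) * (x p)\<^sup>2))"
    by (simp add: herm_index_def sum.cartesian_product case_prod_unfold)
  then have "- of_nat N * mat_trace (herm_mat N x ^\<^sub>m 2) / 2 =
      (\<Sum>p\<in>herm_index N. of_real (- (herm_rate N p * (x p)\<^sup>2 / 2)))"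
    by (auto simp: sum_distrib_left sum_divide_distrib herm_rate_def sum_negf intro!: sum.cong simp flip: sum_negf)
  then show ?thesis
    using finite_I by (simp add: weight_def exp_sum flip: exp_of_real)
qed

lemma gauss_integral_mean:
  "gauss_integral N f / gauss_integral N (\<lambda>_. 1) = mean (\<lambda>x. f (herm_mat N x))"
  unfolding gauss_integral_def weight_eq mean_def by (simp flip: herm_index_def)

definition label_weight :: "nat multiset \<Rightarrow> complex" where
  "label_weight m = (\<Prod>n\<in>set_mset m. (of_nat N / of_nat n) ^ count m n / fact (count m n))"

lemma partition_series_moment:
  assumes "0 \<notin># m"
  shows "partition_series N m = label_weight m * moment m"
proof -
  have "partition_series N m =
      mean (\<lambda>x. \<Prod>n\<in>set_mset m. (of_nat N * tr n x / of_nat n) ^ count m n / fact (count m n))"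
    using assms by (simp add: partition_series_def gauss_integral_mean tr_def)
  also have "(\<lambda>x. \<Prod>n\<in>set_mset m. (of_nat N * tr n x / of_nat n) ^ count m n / fact (count m n)) =
      (\<lambda>x. label_weight m * trs m x)"
    by (auto simp: label_weight_def trs_def image_prod_mset_multiplicity power_mult_distrib power_divide
          divide_simps simp flip: prod.distrib intro!: prod.cong)
  finally show ?thesis by (simp add: mean_scale moment_def)
qed

text \<open>The factor on the left is what \<open>ms_deriv\<close> and the denominator in
  \<open>N Tr (M^n) / n\<close> produce together; label weights thus turn derivatives of Z into
  insertions of traces.\<close>

lemma label_weight_add_mset:
  assumes "n > 0"
  shows "of_nat (n * Suc (count m n)) * label_weight (add_mset n m) = of_nat N * label_weight m"
proof -
  let ?f = "\<lambda>m n. (of_nat N / of_nat n) ^ count m n / fact (count m n) :: complex"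
  have "label_weight m' = (\<Prod>k\<in>insert n (set_mset m). ?f m' k)" if "m' = m \<or> m' = add_mset n m" for m'
    unfolding label_weight_def using that
    by (intro prod.mono_neutral_left) (auto simp: not_in_iff)
  then have *: "label_weight m' = ?f m' n * (\<Prod>k\<in>set_mset m - {n}. ?f m k)" if "m' = m \<or> m' = add_mset n m" for m'
    using that by (auto simp: prod.insert_remove intro!: prod.cong)
  have f: "of_nat (n * Suc (count m n)) * ?f (add_mset n m) n = of_nat N * ?f m n"
    using assms by (simp add: divide_simps del: of_nat_Suc) (simp add: algebra_simps)
  let ?R = "\<Prod>k\<in>set_mset m - {n}. ?f m k"
  have "label_weight m = ?f m n * ?R" "label_weight (add_mset n m) = ?f (add_mset n m) n * ?R"
    using * by blast+
  then show ?thesis using f by (simp only: mult.assoc[symmetric])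
qed

end

section \<open>The genus expansion\<close>

lemma sum_mset_count:
  fixes f :: "'a \<Rightarrow> 'b :: comm_semiring_1"
  shows "(\<Sum>q\<in>#m. f q) = (\<Sum>q\<in>set_mset m. of_nat (count m q) * f q)"
proof (induction m)
  case (add x m)
  have "(\<Sum>q\<in>set_mset (add_mset x m). of_nat (count (add_mset x m) q) * f q) =
      (\<Sum>q\<in>insert x (set_mset m). of_nat (count m q) * f q + (if q = x then f q else 0))"
    by (intro sum.cong) (auto simp: algebra_simps)
  also have "\<dots> = (\<Sum>q\<in>insert x (set_mset m). of_nat (count m q) * f q) + f x"
    by (simp add: sum.distrib)
  also have "(\<Sum>q\<in>insert x (set_mset m). of_nat (count m q) * f q) = (\<Sum>q\<in>set_mset m. of_nat (count m q) * f q)"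
    by (intro sum.mono_neutral_right) (auto simp: not_in_iff)
  finally show ?case using add.IH by (simp add: add.commute)
qed simp

lemma sum_mset_split:
  fixes m :: "nat multiset"
  assumes "p \<subseteq># m"
  shows "\<Sum>\<^sub># p + \<Sum>\<^sub># (m - p) = \<Sum>\<^sub># m"
  using assms by (metis subset_mset.add_diff_inverse sum_mset.union)

text \<open>The coefficients of \<open>genus_poly n m\<close> are the connected Gaussian correlators of
  \<open>Tr (M\<^sup>n)\<close> and the \<open>Tr (M\<^sup>k)\<close> with \<open>k \<in># m\<close>, up to symmetry factors; the variable stands for \<open>1 / N\<^sup>2\<close>.\<close>

function genus_poly :: "nat \<Rightarrow> nat multiset \<Rightarrow> 'a :: comm_semiring_1 poly" where
  "genus_poly 0 m = (if m = {#} then 1 else 0)"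
| "genus_poly (Suc n) m =
     (\<Sum>a<n. (\<Sum>p | p \<subseteq># m. genus_poly a p * genus_poly (n - 1 - a) (m - p)) +
        monom (of_nat (a * Suc (count m a))) 1 * genus_poly (n - 1 - a) (add_mset a m)) +
     (\<Sum>q\<in>set_mset m. genus_poly (n + q - 1) (m - {#q#}))"
  by pat_completeness auto
termination
\<comment> \<open>Each step of the recursion removes the root edge, so the number of half-edges,
  root degree plus the other degrees, decreases.\<close>
proof (relation "Wellfounded.measure (\<lambda>(n, m). n + \<Sum>\<^sub># m)")
  fix n a :: nat and m p :: "nat multiset"
  assume "a \<in> {..<n}" and p: "p \<in> {p. p \<subseteq># m}"
  then show "((a, p), (Suc n, m)) \<in> Wellfounded.measure (\<lambda>(n, m). n + \<Sum>\<^sub># m)"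
    and "((n - 1 - a, m - p), (Suc n, m)) \<in> Wellfounded.measure (\<lambda>(n, m). n + \<Sum>\<^sub># m)"
    using sum_mset_split[of p m] by auto
next
  fix n q :: nat and m :: "nat multiset"
  assume "q \<in># m"
  then show "((n + q - 1, m - {#q#}), (Suc n, m)) \<in> Wellfounded.measure (\<lambda>(n, m). n + \<Sum>\<^sub># m)"
    using sum_mset_split[of "{#q#}" m] by auto
qed auto

section \<open>Connected correlators for a fixed matrix size\<close>

context hermitian_gaussian
begin

definition free_energy :: "complex mseries" where
  "free_energy = ms_log (partition_series N)"

text \<open>The variable \<open>a_n\<close> multiplies \<open>N Tr (M^n) / n\<close> in the
  exponent, hence the rescaling of the derivative by \<open>n / N\<close>. For \<open>n = 0\<close>
  there is no variable, and the trace is the constant \<open>N\<close>.\<close>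

definition corr :: "nat \<Rightarrow> complex mseries" where
  "corr n = (if n = 0 then (\<lambda>m. of_nat N * ms_one m)
             else (\<lambda>m. of_nat n / of_nat N * ms_deriv n free_energy m))"

lemma N_nz: "(of_nat N :: complex) \<noteq> 0"
  using N_pos by simp

lemma label_weight_empty: "label_weight {#} = 1"
  by (simp add: label_weight_def)

lemma partition_series_empty: "partition_series N {#} = 1"
  by (simp add: partition_series_moment label_weight_empty moment_empty)

lemma deriv_partition_series:
  "ms_deriv n (partition_series N) = ms_mult (partition_series N) (ms_deriv n free_energy)"
  unfolding free_energy_def by (rule ms_log_deriv) (rule partition_series_empty)

lemma corr_pos_eq:
  assumes "n > 0"
  shows "ms_mult (partition_series N) (corr n) m = of_nat n / of_nat N * ms_deriv n (partition_series N) m"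
proof -
  have "corr n = (\<lambda>m. of_nat n / of_nat N * ms_deriv n free_energy m)"
    using assms by (simp add: corr_def)
  then show ?thesis by (simp only: ms_mult_scale_right deriv_partition_series)
qed

lemma ms_mult_corr_0: "ms_mult f (corr 0) m = of_nat N * f m"
  by (simp only: corr_def if_True simp_thms ms_mult_scale_right ms_mult_commute[of f ms_one] ms_mult_one_left)

lemma label_weight_deriv:
  assumes "n > 0"
  shows "of_nat n / of_nat N * (of_nat (Suc (count m n)) * (label_weight (add_mset n m) * c)) = label_weight m * c"
proof -
  have "of_nat n / of_nat N * (of_nat (Suc (count m n)) * (label_weight (add_mset n m) * c)) =
      of_nat (n * Suc (count m n)) * label_weight (add_mset n m) * c / of_nat N"
    by (simp add: algebra_simps add_divide_distrib)
  also have "\<dots> = label_weight m * c"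
    unfolding label_weight_add_mset[OF assms] using N_nz by simp
  finally show ?thesis .
qed

text \<open>Inserting a trace into all moments is the rescaled derivative of Z, and the derivative
  of Z is Z times that of its logarithm.\<close>

lemma moment_corr:
  assumes m: "0 \<notin># m"
  shows "label_weight m * moment (add_mset n m) = ms_mult (partition_series N) (corr n) m"
proof (cases "n = 0")
  case True
  then show ?thesis using m by (simp add: ms_mult_corr_0 moment_0 partition_series_moment)
next
  case False
  then have "0 \<notin># add_mset n m" using m by auto
  then show ?thesis
    using False label_weight_deriv[of n m "moment (add_mset n m)"]
    by (simp add: corr_pos_eq ms_deriv_def partition_series_moment)
qed

text \<open>The second insertion differentiates Z times \<open>corr n\<close>: the derivative of Z
  gives the disconnected product, that of \<open>corr n\<close> the connected correlator of two
  traces.\<close>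

lemma moment_corr2:
  assumes m: "0 \<notin># m"
  shows "label_weight m * moment (add_mset a (add_mset n m)) =
    ms_mult (partition_series N) (\<lambda>m. ms_mult (corr a) (corr n) m + of_nat a / of_nat N * ms_deriv a (corr n) m) m"
proof (cases "a = 0")
  case True
  have "ms_mult (corr 0) (corr n) = (\<lambda>m. of_nat N * corr n m)"
    by (rule ext) (simp add: ms_mult_commute[of "corr 0"] ms_mult_corr_0)
  with True show ?thesis
    using moment_corr[OF m, of n] by (simp add: moment_0 ms_mult_scale_right)
next
  case False
  let ?Z = "partition_series N"
  have am: "0 \<notin># add_mset a m" using m False by auto
  have "label_weight m * moment (add_mset a (add_mset n m)) =
      of_nat a / of_nat N * ms_deriv a (ms_mult ?Z (corr n)) m"
    using False label_weight_deriv[of a m "moment (add_mset n (add_mset a m))"] moment_corr[OF am, of n]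
    by (simp add: ms_deriv_def add_mset_commute)
  also have "\<dots> = of_nat a / of_nat N * ms_mult (ms_deriv a ?Z) (corr n) m +
      of_nat a / of_nat N * ms_mult ?Z (ms_deriv a (corr n)) m"
    by (simp only: ms_deriv_mult distrib_left)
  also have "of_nat a / of_nat N * ms_mult (ms_deriv a ?Z) (corr n) m =
      ms_mult (\<lambda>m. of_nat a / of_nat N * ms_deriv a ?Z m) (corr n) m"
    by (simp only: ms_mult_commute[of _ "corr n"] ms_mult_scale_right)
  also have "(\<lambda>m. of_nat a / of_nat N * ms_deriv a ?Z m) = ms_mult ?Z (corr a)"
    using False by (simp add: corr_pos_eq fun_eq_iff)
  also have "of_nat a / of_nat N * ms_mult ?Z (ms_deriv a (corr n)) m =
      ms_mult ?Z (\<lambda>m. of_nat a / of_nat N * ms_deriv a (corr n) m) m"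
    by (simp only: ms_mult_scale_right)
  finally show ?thesis by (simp only: ms_mult_add_right ms_mult_assoc)
qed

text \<open>Weighted by \<open>label_weight m\<close>, every term of the loop equation becomes a
  product with Z, which then cancels. In the merging term the factor \<open>count m q * q\<close> is
  absorbed by the label weights, so that removing \<open>q\<close> amounts to multiplying a series
  by \<open>a_q\<close>.\<close>

lemma corr_loop_equation:
  assumes m: "0 \<notin># m"
  shows "of_nat N * corr (Suc n) m =
    (\<Sum>a<n. ms_mult (corr a) (corr (n - 1 - a)) m + of_nat a / of_nat N * ms_deriv a (corr (n - 1 - a)) m) +
    of_nat N * (\<Sum>q\<in>set_mset m. corr (n + q - 1) (m - {#q#}))"
  (is "_ = (\<Sum>a<n. ?S a m) + _")
proof (rule ms_mult_cancel[where f = "partition_series N" and P = "\<lambda>m. 0 \<notin># m"])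
  let ?Z = "partition_series N"
  fix m :: "nat multiset" assume m: "0 \<notin># m"
  have "ms_mult ?Z (\<lambda>m. of_nat N * corr (Suc n) m) m = label_weight m * (of_nat N * moment (add_mset (Suc n) m))"
    using moment_corr[OF m, of "Suc n"] by (simp add: ms_mult_scale_right mult_ac)
  also have "\<dots> = (\<Sum>a<n. label_weight m * moment (add_mset a (add_mset (n - 1 - a) m))) +
      (\<Sum>q\<in>set_mset m. of_nat (count m q * q) * label_weight m * moment (add_mset (n + q - 1) (m - {#q#})))"
    unfolding loop_equation sum_mset_count
    by (simp add: sum_distrib_left distrib_left mult_ac)
  also have "(\<Sum>a<n. label_weight m * moment (add_mset a (add_mset (n - 1 - a) m))) =
      (\<Sum>a<n. ms_mult ?Z (?S a) m)"
    by (simp only: moment_corr2[OF m])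
  also have "(\<Sum>q\<in>set_mset m. of_nat (count m q * q) * label_weight m * moment (add_mset (n + q - 1) (m - {#q#}))) =
      (\<Sum>q\<in>set_mset m. of_nat N * ms_mult ?Z (corr (n + q - 1)) (m - {#q#}))"
  proof (intro sum.cong refl)
    fix q assume q: "q \<in># m"
    then have "q > 0" "add_mset q (m - {#q#}) = m" "Suc (count (m - {#q#}) q) = count m q"
      using m by (auto intro: gr0I simp: count_greater_zero_iff)
    then have "of_nat (count m q * q) * label_weight m = of_nat N * label_weight (m - {#q#})"
      using label_weight_add_mset[of q "m - {#q#}"] by (simp add: mult.commute)
    moreover have "0 \<notin># m - {#q#}" using m by (meson in_diffD)
    ultimately show "of_nat (count m q * q) * label_weight m * moment (add_mset (n + q - 1) (m - {#q#})) =
        of_nat N * ms_mult ?Z (corr (n + q - 1)) (m - {#q#})"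
      using moment_corr[of "m - {#q#}" "n + q - 1"] by (simp only: mult.assoc simp_thms)
  qed
  also have "\<dots> = of_nat N * ms_mult ?Z (\<lambda>m. \<Sum>q\<in>set_mset m. corr (n + q - 1) (m - {#q#})) m"
    by (simp only: sum_distrib_left ms_mult_sum_variables[of ?Z "\<lambda>q. corr (n + q - 1)"])
  finally show "ms_mult ?Z (\<lambda>m. of_nat N * corr (Suc n) m) m =
      ms_mult ?Z (\<lambda>m. (\<Sum>a<n. ?S a m) + of_nat N * (\<Sum>q\<in>set_mset m. corr (n + q - 1) (m - {#q#}))) m"
    by (simp only: ms_mult_add_right ms_mult_sum_right ms_mult_scale_right)
qed (use m partition_series_empty in \<open>auto dest: mset_subset_eqD\<close>)

text \<open>If correlators have order \<open>N\<close>, then the product and merging terms of the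
  loop equation keep this order, while the derivative term is smaller by \<open>1 / N^2\<close>. It
  adds a handle, hence the \<open>monom\<close> of degree 1 in \<open>genus_poly\<close>.\<close>

lemma corr_genus_poly: "0 \<notin># m \<Longrightarrow> corr n m = of_nat N * poly (genus_poly n m) (1 / of_nat N ^ 2)"
proof (induction n m rule: genus_poly.induct)
  case (1 m)
  then show ?case by (simp add: corr_def ms_one_def)
next
  case (2 n m)
  let ?x = "1 / of_nat N ^ 2 :: complex" and ?M = "of_nat N :: complex"
  have sub: "0 \<notin># p" if "p \<subseteq># m" for p using 2(5) that by (auto dest: mset_subset_eqD)
  have "ms_mult (corr a) (corr (n - 1 - a)) m =
      ?M ^ 2 * poly (\<Sum>p | p \<subseteq># m. genus_poly a p * genus_poly (n - 1 - a) (m - p)) ?x" if "a < n" for a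
    unfolding ms_mult_def poly_sum sum_distrib_left using that 2(1,2) sub
    by (intro sum.cong) (auto simp: power2_eq_square)
  moreover have "?M * (of_nat a / of_nat N * ms_deriv a (corr (n - 1 - a)) m) =
      ?M * poly (monom (of_nat (a * Suc (count m a))) 1 * genus_poly (n - 1 - a) (add_mset a m)) ?x * ?M ^ 2" if "a < n" for a
  proof (cases "a = 0")
    case False
    then show ?thesis using that 2(3)[of a] 2(5) N_nz
      by (simp add: ms_deriv_def poly_monom power2_eq_square field_simps)
  qed simp
  moreover have "corr (n + q - 1) (m - {#q#}) = ?M * poly (genus_poly (n + q - 1) (m - {#q#})) ?x" if "q \<in># m" for q
    using that 2(4,5) by (meson in_diffD)
  ultimately have "?M * corr (Suc n) m = ?M * (?M * poly (genus_poly (Suc n) m) ?x)"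
    using N_nz unfolding corr_loop_equation[OF 2(5)]
    by (simp add: poly_sum sum_distrib_left distrib_left sum.distrib power2_eq_square mult_ac)
  then show ?case using N_nz by simp
qed

lemma free_energy_genus_poly:
  assumes "0 \<notin># m" "n \<in># m"
  shows "of_nat (n * count m n) * free_energy m = of_nat N ^ 2 * poly (genus_poly n (m - {#n#})) (1 / of_nat N ^ 2)"
proof -
  have n: "n > 0" "add_mset n (m - {#n#}) = m" "Suc (count (m - {#n#}) n) = count m n"
    using assms by (auto intro: gr0I simp: count_greater_zero_iff)
  have "of_nat (n * count m n) * free_energy m = of_nat N * corr n (m - {#n#})"
    using n N_nz by (simp add: corr_def ms_deriv_def del: of_nat_Suc)
  also have "corr n (m - {#n#}) = of_nat N * poly (genus_poly n (m - {#n#})) (1 / of_nat N ^ 2)"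
    using assms by (intro corr_genus_poly) (meson in_diffD)
  finally show ?thesis by (simp add: power2_eq_square)
qed

text \<open>No monomial of Z contains the index 0, so the Euler operator at 0 kills Z and, after
  cancelling Z, also log Z.\<close>

lemma free_energy_0:
  assumes "0 \<in># m"
  shows "free_energy m = 0"
proof -
  have "ms_count 0 free_energy m = 0"
  proof (rule ms_mult_cancel[where f = "partition_series N" and P = "\<lambda>_. True"])
    fix m :: "nat multiset"
    have "ms_count 0 (partition_series N) = (\<lambda>_. 0)"
      by (auto simp: ms_count_def partition_series_def fun_eq_iff not_in_iff)
    then show "ms_mult (partition_series N) (ms_count 0 free_energy) m = ms_mult (partition_series N) (\<lambda>_. 0) m"
      using ms_log_count[where f = "partition_series N" and n = 0, OF partition_series_empty] by (simp add: free_energy_def ms_mult_def)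
  qed (auto simp: partition_series_empty)
  with assms show ?thesis by (auto simp: ms_count_def count_eq_zero_iff)
qed

end

section \<open>Rationality, positivity and uniqueness of the genus coefficients\<close>

lemma genus_poly_of_rat:
  "coeff (genus_poly n m :: complex poly) g = of_rat (coeff (genus_poly n m) g)"
proof (induction n m arbitrary: g rule: genus_poly.induct)
  case (2 n m)
  then show ?case
    by (simp add: coeff_sum coeff_mult of_rat_sum of_rat_add of_rat_mult if_distrib[of of_rat] cong: if_cong)
qed auto

lemma genus_poly_nonneg: "coeff (genus_poly n m :: rat poly) g \<ge> 0"
proof (induction n m arbitrary: g rule: genus_poly.induct)
  case (2 n m)
  then show ?case
    by (auto simp: coeff_sum coeff_mult intro!: sum_nonneg add_nonneg_nonneg mult_nonneg_nonneg)
qed auto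

lemma genus_powi:
  assumes "N \<ge> 1"
  shows "of_nat N powi (2 - 2 * int g) = (of_nat N :: complex) ^ 2 * (1 / of_nat N ^ 2) ^ g"
proof -
  have "of_nat N powi (2 - 2 * int g) = (of_nat N :: complex) powi int 2 / of_nat N powi int (2 * g)"
    using assms by (subst power_int_diff[symmetric]) auto
  also have "\<dots> = of_nat N ^ 2 / (of_nat N ^ 2) ^ g"
    by (simp only: power_int_of_nat power_mult)
  finally show ?thesis by (simp add: power_one_over)
qed

text \<open>Up to the factor \<open>N^2\<close> the difference is a polynomial in
  \<open>1 / N^2\<close>, and it vanishes at infinitely many points.\<close>

lemma laurent_coeff_unique:
  fixes f h :: "nat \<Rightarrow> rat"
  assumes fin: "finite {g. f g \<noteq> 0}" "finite {g. h g \<noteq> 0}"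
    and eq: "\<And>N. N \<ge> 1 \<Longrightarrow>
      (\<Sum>g | f g \<noteq> 0. of_nat N powi (2 - 2 * int g) * of_rat (f g) :: complex) =
      (\<Sum>g | h g \<noteq> 0. of_nat N powi (2 - 2 * int g) * of_rat (h g))"
  shows "f = h"
proof -
  define P where "P k = (\<Sum>g | k g \<noteq> 0. monom (of_rat (k g)) g :: complex poly)" for k :: "nat \<Rightarrow> rat"
  have P: "(\<Sum>g | k g \<noteq> 0. of_nat N powi (2 - 2 * int g) * of_rat (k g)) =
      of_nat N ^ 2 * poly (P k) (1 / of_nat N ^ 2)" if "N \<ge> 1" for N k
  proof -
    show ?thesis using genus_powi[OF that] by (simp add: P_def poly_sum poly_monom sum_distrib_left mult_ac)
  qed
  have coeff: "coeff (P k) g = of_rat (k g)" if "finite {g. k g \<noteq> 0}" for k g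
    using that by (simp add: P_def coeff_sum)
  have root: "poly (P f - P h) (1 / of_nat N ^ 2) = 0" if "N \<ge> 1" for N
    using eq[OF that] that unfolding P[OF that] by simp
  have "infinite ((\<lambda>N. 1 / of_nat N ^ 2 :: complex) ` {1..})"
  proof -
    have inj: "inj_on (\<lambda>N. 1 / of_nat N ^ 2 :: complex) {1..}"
    proof (rule inj_onI)
      fix M N :: nat assume "1 / of_nat M ^ 2 = (1 / of_nat N ^ 2 :: complex)"
      then have "of_nat (M ^ 2) = (of_nat (N ^ 2) :: complex)" by simp
      then have "M ^ 2 = N ^ 2" by (rule of_nat_eq_iff[THEN iffD1])
      then show "M = N" by simp
    qed
    show ?thesis using finite_imageD[OF _ inj] infinite_Ici by blast
  qed
  moreover have "(\<lambda>N. 1 / of_nat N ^ 2 :: complex) ` {1..} \<subseteq> {x. poly (P f - P h) x = 0}"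
    using root by auto
  ultimately have "P f - P h = 0" using poly_roots_finite finite_subset by blast
  then have "of_rat (f g) = (of_rat (h g) :: complex)" for g
    using coeff[OF fin(1), of g] coeff[OF fin(2), of g] by simp
  then show "f = h" by (auto simp: fun_eq_iff)
qed

lemma genus_expansion_unique:
  assumes "genus_expansion F" "genus_expansion F'"
  shows "F = F'"
proof -
  have "(\<lambda>g. F g m) = (\<lambda>g. F' g m)" for m
    using assms unfolding genus_expansion_def by (intro laurent_coeff_unique) auto
  then show ?thesis by (metis ext)
qed

text \<open>Dividing by \<open>n * count m n\<close> undoes the rooting. The root \<open>n\<close>
  stays arbitrary, so that different roots can be compared later.\<close>

lemma free_energy_expansion:
  assumes "N \<ge> 1" "0 \<notin># m" "n \<in># m"
  defines "c \<equiv> \<lambda>g. coeff (genus_poly n (m - {#n#})) g / of_nat (n * count m n) :: rat"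
  shows "finite {g. c g \<noteq> 0}"
    and "ms_log (partition_series N) m = (\<Sum>g | c g \<noteq> 0. of_nat N powi (2 - 2 * int g) * of_rat (c g))"
proof -
  interpret hermitian_gaussian N by unfold_locales fact
  let ?P = "genus_poly n (m - {#n#}) :: complex poly"
  have nz: "n * count m n \<noteq> 0" using assms by (auto intro: gr0I)
  have sub: "{g. c g \<noteq> 0} \<subseteq> {..degree ?P}"
  proof
    fix g assume "g \<in> {g. c g \<noteq> 0}"
    then have "coeff ?P g \<noteq> 0" by (auto simp: c_def genus_poly_of_rat)
    then show "g \<in> {..degree ?P}" by (simp add: le_degree)
  qed
  then show "finite {g. c g \<noteq> 0}" using finite_subset by blast
  note pow = genus_powi[OF \<open>N \<ge> 1\<close>]
  have "of_nat (n * count m n) * free_energy m = of_nat N ^ 2 * poly ?P (1 / of_nat N ^ 2)"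
    by (rule free_energy_genus_poly) fact+
  also have "\<dots> = (\<Sum>g\<le>degree ?P. of_nat N powi (2 - 2 * int g) * coeff ?P g)"
    by (simp only: poly_altdef sum_distrib_left pow) (simp only: mult_ac)
  also have "\<dots> = (\<Sum>g\<le>degree ?P. of_nat N powi (2 - 2 * int g) * (of_nat (n * count m n) * of_rat (c g)))"
  proof (intro sum.cong refl arg_cong2[where f = "(*)"])
    fix g
    have "coeff ?P g = of_rat (of_nat (n * count m n) * c g)"
      using nz by (simp only: genus_poly_of_rat c_def) simp
    then show "coeff ?P g = of_nat (n * count m n) * of_rat (c g)"
      by (simp only: of_rat_mult of_rat_of_nat_eq)
  qed
  also have "\<dots> = of_nat (n * count m n) * (\<Sum>g\<le>degree ?P. of_nat N powi (2 - 2 * int g) * of_rat (c g))"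
    by (simp add: sum_distrib_left mult_ac)
  also have "(\<Sum>g\<le>degree ?P. of_nat N powi (2 - 2 * int g) * of_rat (c g)) =
      (\<Sum>g | c g \<noteq> 0. of_nat N powi (2 - 2 * int g) * of_rat (c g) :: complex)"
    using sub by (intro sum.mono_neutral_right) auto
  finally show "ms_log (partition_series N) m = (\<Sum>g | c g \<noteq> 0. of_nat N powi (2 - 2 * int g) * of_rat (c g))"
    unfolding free_energy_def using nz by (simp only: mult_cancel_left of_nat_eq_0_iff) simp
qed

text \<open>The largest index is merely a definite choice of root.\<close>

definition genus_coeff :: "nat \<Rightarrow> rat mseries" where
  "genus_coeff g m = (if m = {#} \<or> 0 \<in># m then 0
     else coeff (genus_poly (Max_mset m) (m - {#Max_mset m#})) g / of_nat (Max_mset m * count m (Max_mset m)))"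

lemma genus_expansion_genus_coeff: "genus_expansion genus_coeff"
  unfolding genus_expansion_def
proof (intro allI conjI impI)
  fix m :: "nat multiset"
  show fin: "finite {g. genus_coeff g m \<noteq> 0}"
    using free_energy_expansion(1)[of 1 m "Max_mset m"]
    by (cases "m = {#} \<or> 0 \<in># m") (auto simp: genus_coeff_def)
  fix N :: nat assume N: "N \<ge> 1"
  then interpret hermitian_gaussian N by unfold_locales
  show "ms_log (partition_series N) m =
      (\<Sum>g | genus_coeff g m \<noteq> 0. of_nat N powi (2 - 2 * int g) * of_rat (genus_coeff g m))"
    using free_energy_expansion(2)[OF N, of m "Max_mset m"] free_energy_0[of m]
    by (cases "m = {#} \<or> 0 \<in># m") (auto simp: genus_coeff_def free_energy_def)
qed

lemma formal_planar_limit_eq: "formal_planar_limit = genus_coeff 0"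
proof -
  have "(THE F. genus_expansion F) = genus_coeff"
    using genus_expansion_genus_coeff genus_expansion_unique by blast
  then show ?thesis by (simp add: formal_planar_limit_def)
qed

lemma formal_planar_limit_nonneg: "formal_planar_limit m \<ge> 0"
  unfolding formal_planar_limit_eq genus_coeff_def using genus_poly_nonneg by auto

text \<open>For the largest index this is the definition. Any other root expands the same logarithm,
  and Laurent coefficients are unique.\<close>

lemma formal_planar_limit_root:
  assumes "0 \<notin># m" "n \<in># m"
  shows "of_nat (n * count m n) * formal_planar_limit m = coeff (genus_poly n (m - {#n#})) 0"
proof -
  define c where "c = (\<lambda>g. coeff (genus_poly n (m - {#n#})) g / of_nat (n * count m n) :: rat)"
  have nz: "n * count m n \<noteq> 0" using assms by (auto intro: gr0I)
  have "(\<lambda>g. genus_coeff g m) = c"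
  proof (rule laurent_coeff_unique)
    show "finite {g. genus_coeff g m \<noteq> 0}"
      using genus_expansion_genus_coeff by (auto simp: genus_expansion_def)
    show "finite {g. c g \<noteq> 0}"
      unfolding c_def by (rule free_energy_expansion(1)[OF _ assms, of 1]) simp
    fix N :: nat assume N: "N \<ge> 1"
    then have "ms_log (partition_series N) m =
        (\<Sum>g | genus_coeff g m \<noteq> 0. of_nat N powi (2 - 2 * int g) * of_rat (genus_coeff g m))"
      using genus_expansion_genus_coeff by (auto simp: genus_expansion_def)
    then show "(\<Sum>g | genus_coeff g m \<noteq> 0. of_nat N powi (2 - 2 * int g) * of_rat (genus_coeff g m) :: complex) =
        (\<Sum>g | c g \<noteq> 0. of_nat N powi (2 - 2 * int g) * of_rat (c g))"
      using free_energy_expansion(2)[OF N assms] unfolding c_def by simp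
  qed
  then have "formal_planar_limit m = c 0" by (metis formal_planar_limit_eq)
  then show ?thesis using nz by (simp add: c_def)
qed

section \<open>The quadratic method\<close>

text \<open>Zeros of a nonzero power series are isolated, so vanishing on a one-sided interval at 0
  suffices.\<close>

lemma fps_eq_0_if_eval_0:
  fixes F :: "real fps"
  assumes d: "d > 0" "ereal d \<le> fps_conv_radius F"
    and eval: "\<And>t. 0 < t \<Longrightarrow> t < d \<Longrightarrow> eval_fps F t = 0"
  shows "F = 0"
proof (rule ccontr)
  assume F: "F \<noteq> 0"
  \<comment> \<open>The factor X provides the zero at the centre that the theorem on isolated zeros
    presupposes.\<close>
  define G where "G = fps_X * F"
  from F have G: "fps_nth G (Suc (subdegree F)) \<noteq> 0" by (simp add: G_def)
  have rG: "ereal d \<le> fps_conv_radius G"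
    unfolding G_def using d fps_conv_radius_mult[of fps_X F] by simp
  obtain s where s: "s > 0" "\<And>z. z \<in> cball 0 s - {0} \<Longrightarrow> eval_fps G z \<noteq> 0"
  proof (rule powser_0_nonzero[where a = "fps_nth G" and \<xi> = 0 and r = d and f = "eval_fps G" and m = "Suc (subdegree F)"])
    fix x :: real assume "norm (x - 0) < d"
    then have "ereal (norm x) < fps_conv_radius G" using rG by (simp add: less_le_trans[of _ "ereal d"])
    then show "(\<lambda>n. fps_nth G n * (x - 0) ^ n) sums eval_fps G x"
      by (simp add: sums_eval_fps)
  next
    show "eval_fps G 0 = 0" by (simp add: eval_fps_at_0 G_def)
  qed (use d G in auto)
  define z where "z = min s (d / 2)"
  have z: "0 < z" "z < d" "z \<le> s" using s d by (auto simp: z_def)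
  have "ereal (norm z) < fps_conv_radius F"
    using z d by (intro less_le_trans[OF _ d(2)]) auto
  then have "eval_fps G z = z * eval_fps F z" unfolding G_def by (subst eval_fps_mult) auto
  then show False using s(2)[of z] eval[of z] z by auto
qed

text \<open>The square root of \<open>(1 - c x)\<^sup>3\<close> is the binomial series with exponent \<open>3/2\<close>.\<close>

lemma conv_radius_sqrt_cube:
  fixes G :: "real fps"
  assumes c: "c > 0" and G: "G ^ 2 = (1 - fps_const c * fps_X) ^ 3" "fps_nth G 0 = 1"
  shows "fps_conv_radius G = 1 / ereal c"
proof -
  define B where "B = fps_compose (fps_binomial (3 / 2)) (fps_const (- c) * fps_X :: real fps)"
  have "B ^ 2 = fps_compose (fps_binomial (of_nat 3)) (fps_const (- c) * fps_X)"
    unfolding B_def using fps_binomial_power[of "3 / 2 :: real" 2]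
    by (simp add: fps_compose_power)
  also have "\<dots> = (1 - fps_const c * fps_X) ^ 3"
    using one_minus_const_fps_X_power[of c 3] c by simp
  finally have "(G - B) * (G + B) = 0"
    using G by (simp add: algebra_simps power2_eq_square)
  moreover have "fps_nth (G + B) 0 \<noteq> 0"
    using G by (simp add: B_def)
  then have "G + B \<noteq> 0" by (metis fps_zero_nth)
  ultimately have "G = Abs_fps (\<lambda>n. (- c) ^ n * ((3 / 2) gchoose n))"
    by (simp add: B_def fps_compose_linear)
  \<comment> \<open>A natural exponent would terminate the binomial series and make the radius
    infinite.\<close>
  moreover have "(3 / 2 :: real) \<notin> \<nat>"
  proof
    assume "(3 / 2 :: real) \<in> \<nat>"
    then obtain n where "3 / 2 = real n" by (auto simp: Nats_def)
    then have "3 = 2 * n" by linarith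
    then show False by presburger
  qed
  ultimately show ?thesis
    unfolding fps_conv_radius_def using c by (simp add: conv_radius_mult_power conv_radius_gchoose)
qed

text \<open>Subtracting the entire series \<open>P\<close> and shifting by two recover
  \<open>F\<close>, and neither operation shrinks the disc.\<close>

lemma fps_conv_radius_polynomial_part:
  fixes F P :: "real fps"
  assumes "k \<noteq> 0" "fps_conv_radius P = \<infinity>"
  shows "fps_conv_radius (fps_const k * fps_X ^ 2 * F + P) = fps_conv_radius F"
proof (rule antisym)
  let ?G = "fps_const k * fps_X ^ 2 * F + P"
  have "fps_conv_radius (?G - P) \<ge> fps_conv_radius ?G"
    using fps_conv_radius_diff[of ?G P] assms by simp
  also have "?G - P = fps_const k * (fps_X ^ 2 * F)" by (simp add: mult.assoc)
  also have "fps_conv_radius \<dots> = fps_conv_radius (fps_shift 2 (fps_X ^ 2 * F))"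
    using assms by (simp add: fps_conv_radius_cmult_left)
  also have "fps_shift 2 (fps_X ^ 2 * F) = F" by (simp add: fps_eq_iff fps_X_power_mult_nth)
  finally show "fps_conv_radius ?G \<le> fps_conv_radius F" .
  have "fps_conv_radius F \<le> fps_conv_radius (fps_const k * (fps_X ^ 2 * F))"
    using assms fps_conv_radius_mult[of "fps_X ^ 2" F] by (simp add: fps_conv_radius_cmult_left)
  also have "\<dots> \<le> fps_conv_radius ?G"
    using fps_conv_radius_add[of "fps_const k * (fps_X ^ 2 * F)" P] assms by (simp add: mult.assoc)
  finally show "fps_conv_radius F \<le> fps_conv_radius ?G" .
qed

text \<open>The quadratic method: where the square root \<open>h\<close> of the discriminant \<open>D\<close> vanishes, \<open>D\<close> has a minimum.\<close>

lemma square_double_root: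
  fixes h :: "real \<Rightarrow> real"
  assumes cont: "continuous_on {a..b} h" and ab: "a < b" "h a > 0" "h b < 0"
    and sq: "\<And>x. x \<in> {a..b} \<Longrightarrow> D x = h x ^ 2"
    and deriv: "\<And>x. (D has_real_derivative D' x) (at x)"
  obtains x where "a < x" "x < b" "D x = 0" "D' x = 0"
proof -
  obtain x where x: "a \<le> x" "x \<le> b" "h x = 0"
    using IVT2'[of h b 0 a] cont ab by auto
  then have ax: "a < x" "x < b" using ab by (auto simp: less_le)
  have Dx: "D x = 0" using x sq by auto
  have "D' x = 0"
  proof (rule DERIV_local_min[OF deriv])
    show "min (x - a) (b - x) > 0" using ax by auto
    show "\<forall>y. \<bar>x - y\<bar> < min (x - a) (b - x) \<longrightarrow> D x \<le> D y"
      using Dx sq by (auto simp: abs_less_iff)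
  qed
  with ax Dx that show thesis by blast
qed

text \<open>Eliminating \<open>M\<close> from the double root conditions leaves a product whose first factor is nonzero;
  the other one parametrises \<open>t\<close> and \<open>M\<close> rationally by \<open>u = 1 - x\<close>.\<close>

lemma general_elimination:
  fixes t x M :: real
  assumes t: "t > 0" "x > 1"
    and D: "(1 - x + t * x ^ 2) ^ 2 - 4 * t * x ^ 2 * (1 - x) * (1 - x + t * x * M) = 0" (is "?d = 0")
    and D': "2 * (1 - x + t * x ^ 2) * (2 * t * x - 1)
        - 4 * t * ((2 * x - 3 * x ^ 2) * (1 - x + t * x * M) + x ^ 2 * (1 - x) * (t * M - 1)) = 0" (is "?d' = 0")
  shows "(54 * t ^ 2 * M + 1 - 18 * t) ^ 2 = (1 - 12 * t) ^ 3"
proof -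
  define u v where "u = 1 - x" and "v = t * x ^ 2"
  have x: "x = 1 - u" by (simp add: u_def)
  \<comment> \<open>\<open>M\<close> enters \<open>?d\<close> only with the coefficient x^3 (1 - x),
    up to a constant. As x (1 - x) times the logarithmic derivative of that is 4 (1 - x) - 1, this
    combination is free of \<open>M\<close>.\<close>
  have "(v - u) * (v + u + 2 * u ^ 2) = x * (1 - x) * ?d' - (4 * (1 - x) - 1) * ?d"
    unfolding u_def v_def by (simp add: algebra_simps power2_eq_square)
  then have "(v - u) * (v + u + 2 * u ^ 2) = 0" unfolding D D' by simp
  moreover have \<open>v > 0\<close> \<open>u < 0\<close> using t by (auto simp: u_def v_def)
  ultimately have "v + u + 2 * u ^ 2 = 0" by simp
  then have v: "v = - u * (1 + 2 * u)" by (simp add: algebra_simps power2_eq_square)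
  have tv: "t * (1 - u) ^ 2 = - u * (1 + 2 * u)" using v by (simp add: v_def x)
  have "u ^ 2 * ((1 + 2 * u) ^ 2 * M - (1 - u) * (1 + 3 * u)) = 0"
  proof -
    have uv: "(u + v) ^ 2 = 4 * u ^ 4" unfolding v by (simp add: algebra_simps eval_nat_numeral)
    have "x * (4 * u ^ 4) - 4 * v * u * (u * x + v * M) = x * ((u + v) ^ 2 - 4 * v * u * (u + t * x * M))"
      unfolding uv by (simp add: v_def algebra_simps power2_eq_square)
    also have "(u + v) ^ 2 - 4 * v * u * (u + t * x * M) = ?d"
      by (simp add: u_def v_def mult_ac)
    also have "x * (4 * u ^ 4) - 4 * v * u * (u * x + v * M) = 4 * u * (x * u ^ 3 - v * u * x - v ^ 2 * M)"
      by (simp add: algebra_simps eval_nat_numeral)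
    finally have "x * u ^ 3 - v * u * x - v ^ 2 * M = 0" unfolding D using \<open>u < 0\<close> by simp
    moreover have "u ^ 2 * ((1 + 2 * u) ^ 2 * M - (1 - u) * (1 + 3 * u)) = - (x * u ^ 3 - v * u * x - v ^ 2 * M)"
      unfolding x v by (simp add: algebra_simps eval_nat_numeral)
    ultimately show ?thesis by simp
  qed
  then have M: "(1 + 2 * u) ^ 2 * M = (1 - u) * (1 + 3 * u)" using \<open>u < 0\<close> by simp
  \<comment> \<open>The two sides of the goal become the sixth power of the same quotient (1 + 5 u)
    / (1 - u). Its zero u = -1/5 corresponds to t = 1/12.\<close>
  have s: "(1 - u) ^ 3 * (54 * t ^ 2 * M + 1 - 18 * t) = (1 + 5 * u) ^ 3"
  proof -
    have "(1 - u) * ((1 - u) ^ 3 * t ^ 2 * M) = (t * (1 - u) ^ 2) ^ 2 * M"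
      by (simp add: algebra_simps eval_nat_numeral)
    also have "\<dots> = u ^ 2 * ((1 + 2 * u) ^ 2 * M)"
      unfolding tv by (simp add: algebra_simps eval_nat_numeral)
    also have "\<dots> = (1 - u) * (u ^ 2 * (1 + 3 * u))"
      unfolding M by simp
    finally have "(1 - u) ^ 3 * t ^ 2 * M = u ^ 2 * (1 + 3 * u)" using \<open>u < 0\<close> by simp
    moreover have "(1 - u) ^ 3 * (54 * t ^ 2 * M + 1 - 18 * t) =
        54 * ((1 - u) ^ 3 * t ^ 2 * M) + (1 - u) ^ 3 - 18 * (1 - u) * (t * (1 - u) ^ 2)"
      by (simp add: algebra_simps eval_nat_numeral)
    ultimately show ?thesis unfolding tv by (simp add: algebra_simps eval_nat_numeral)
  qed
  have r: "(1 - u) ^ 2 * (1 - 12 * t) = (1 + 5 * u) ^ 2"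
  proof -
    have "(1 - u) ^ 2 * (1 - 12 * t) = (1 - u) ^ 2 - 12 * (t * (1 - u) ^ 2)" by (simp add: algebra_simps eval_nat_numeral)
    then show ?thesis unfolding tv by (simp add: algebra_simps eval_nat_numeral)
  qed
  have "((1 - u) ^ 3) ^ 2 * (54 * t ^ 2 * M + 1 - 18 * t) ^ 2 = ((1 - u) ^ 2) ^ 3 * (1 - 12 * t) ^ 3"
    unfolding power_mult_distrib[symmetric] s r by (simp flip: power_mult)
  then show ?thesis using \<open>u < 0\<close> by (simp flip: power_mult)
qed

lemma even_elimination:
  fixes t y M :: real
  assumes t: "t > 0" "y > 1"
    and D: "(1 - y + t * y) ^ 2 - 4 * t * y * (1 - y) * (1 - y + t * y * M) = 0" (is "?d = 0")
    and D': "2 * (1 - y + t * y) * (t - 1)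
        - 4 * t * ((1 - 2 * y) * (1 - y + t * y * M) + y * (1 - y) * (t * M - 1)) = 0" (is "?d' = 0")
  shows "(32 * t ^ 2 * M + 1 - 12 * t - 8 * t ^ 2) ^ 2 = (1 - 8 * t) ^ 3"
proof -
  define u v where "u = 1 - y" and "v = t * y"
  have y: "y = 1 - u" by (simp add: u_def)
  \<comment> \<open>The same elimination: the coefficient of \<open>M\<close> is now y^2 (1 - y),
    which gives the multiplier 3 (1 - y) - 1.\<close>
  have "(v - u) * ((1 - u) * v + u * (1 + u)) = y * (1 - y) * ?d' - (3 * (1 - y) - 1) * ?d"
    unfolding u_def v_def by (simp add: algebra_simps power2_eq_square)
  then have "(v - u) * ((1 - u) * v + u * (1 + u)) = 0" unfolding D D' by simp
  moreover have \<open>v > 0\<close> \<open>u < 0\<close> using t by (auto simp: u_def v_def)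
  ultimately have "(1 - u) * v + u * (1 + u) = 0" by simp
  then have v: "(1 - u) * v = - u * (1 + u)" by (simp add: algebra_simps)
  have tv: "t * (1 - u) ^ 2 = - u * (1 + u)" using v by (simp add: v_def y power2_eq_square mult_ac)
  have M: "(1 + u) ^ 2 * M = 1 + u - u ^ 2"
  proof -
    have "(u + v) ^ 2 - 4 * v * u * (u + v * M) = 0" (is "?e = 0")
      using D by (simp add: u_def v_def mult_ac)
    have a: "(1 - u) * (u + v) = - 2 * u ^ 2" using v by (simp add: algebra_simps power2_eq_square)
    have "4 * u ^ 3 * (u + (1 + u) * (1 - u - (1 + u) * M)) =
        (- 2 * u ^ 2) ^ 2 - 4 * (- u * (1 + u)) * u * ((1 - u) * u + (- u * (1 + u)) * M)"
      by (simp add: algebra_simps eval_nat_numeral)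
    also have "\<dots> = (1 - u) ^ 2 * ((u + v) ^ 2 - 4 * v * u * (u + v * M))"
      unfolding a[symmetric] v[symmetric] by (simp add: algebra_simps eval_nat_numeral)
    finally have "4 * u ^ 3 * (u + (1 + u) * (1 - u - (1 + u) * M)) = 0" using \<open>?e = 0\<close> by simp
    then have "u + (1 + u) * (1 - u - (1 + u) * M) = 0" using \<open>u < 0\<close> by simp
    moreover have "(1 + u) ^ 2 * M - (1 + u - u ^ 2) = - (u + (1 + u) * (1 - u - (1 + u) * M))"
      by (simp add: algebra_simps eval_nat_numeral)
    ultimately show ?thesis by simp
  qed
  \<comment> \<open>Here the common quotient is (1 + 3 u) / (1 - u); its zero u = -1/3 corresponds
    to t = 1/8.\<close>
  have s: "(1 - u) ^ 3 * (32 * t ^ 2 * M + 1 - 12 * t - 8 * t ^ 2) = (1 + 3 * u) ^ 3"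
  proof -
    have "(t * (1 - u) ^ 2) ^ 2 * M = u ^ 2 * ((1 + u) ^ 2 * M)"
      unfolding tv by (simp add: algebra_simps eval_nat_numeral)
    then have T: "(t * (1 - u) ^ 2) ^ 2 * M = u ^ 2 * (1 + u - u ^ 2)"
      unfolding M .
    have "(1 - u) * ((1 - u) ^ 3 * (32 * t ^ 2 * M + 1 - 12 * t - 8 * t ^ 2)) =
        32 * ((t * (1 - u) ^ 2) ^ 2 * M) + (1 - u) ^ 4 - 12 * (1 - u) ^ 2 * (t * (1 - u) ^ 2)
        - 8 * (t * (1 - u) ^ 2) ^ 2"
      by (simp add: algebra_simps eval_nat_numeral)
    also have "\<dots> = (1 - u) * (1 + 3 * u) ^ 3"
      unfolding T unfolding tv by (simp add: algebra_simps eval_nat_numeral)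
    finally show ?thesis using \<open>u < 0\<close> by simp
  qed
  have r: "(1 - u) ^ 2 * (1 - 8 * t) = (1 + 3 * u) ^ 2"
  proof -
    have "(1 - u) ^ 2 * (1 - 8 * t) = (1 - u) ^ 2 - 8 * (t * (1 - u) ^ 2)" by (simp add: algebra_simps eval_nat_numeral)
    then show ?thesis unfolding tv by (simp add: algebra_simps eval_nat_numeral)
  qed
  have "((1 - u) ^ 3) ^ 2 * (32 * t ^ 2 * M + 1 - 12 * t - 8 * t ^ 2) ^ 2 = ((1 - u) ^ 2) ^ 3 * (1 - 8 * t) ^ 3"
    unfolding power_mult_distrib[symmetric] s r by (simp flip: power_mult)
  then show ?thesis using \<open>u < 0\<close> by (simp flip: power_mult)
qed

section \<open>Tutte's recursion by number of edges and root degree, with the other vertex degrees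
  in \<open>A\<close>\<close>

locale planar_recursion =
  fixes A :: "nat set" and u :: "nat \<Rightarrow> nat \<Rightarrow> real"
  assumes A_pos: "0 \<notin> A"
    and u_0: "u 0 n = (if n = 0 then 1 else 0)"
    and u_Suc_0: "u (Suc e) 0 = 0"
    and u_Suc_Suc: "u (Suc e) (Suc n) =
      (\<Sum>a<n. \<Sum>i\<le>e. u i a * u (e - i) (n - 1 - a)) + (\<Sum>q\<in>A \<inter> {..2 * e + 1}. u e (n + q - 1))"
begin

lemma u_nonneg: "u e n \<ge> 0"
proof (induction e arbitrary: n rule: less_induct)
  case (less e)
  show ?case
  proof (cases e)
    case (Suc e')
    with less show ?thesis
      by (cases n) (auto simp: u_Suc_0 u_Suc_Suc intro!: add_nonneg_nonneg sum_nonneg)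
  qed (simp add: u_0)
qed

text \<open>The root uses \<open>n\<close> of the \<open>2 * e\<close> half-edges. This is also why
  the recursion may stop at \<open>q = 2 * e + 1\<close>: the summands beyond it vanish.\<close>

lemma u_eq_0: "n > 2 * e \<Longrightarrow> u e n = 0"
proof (induction e arbitrary: n rule: less_induct)
  case (less e)
  show ?case
  proof (cases e)
    case 0
    with less show ?thesis by (simp add: u_0)
  next
    case (Suc e')
    then obtain n' where n: "n = Suc n'" using less.prems by (cases n) auto
    have "u i a * u (e' - i) (n' - 1 - a) = 0" if "a < n'" "i \<le> e'" for a i
    proof (cases "a > 2 * i")
      case False
      then have "u (e' - i) (n' - 1 - a) = 0" using that less.prems Suc n by (intro less.IH) auto
      then show ?thesis by simp
    qed (use that less.IH Suc in auto)
    then have "(\<Sum>a<n'. \<Sum>i\<le>e'. u i a * u (e' - i) (n' - 1 - a)) = 0"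
      by (intro sum.neutral ballI) (simp del: mult_eq_0_iff)
    moreover have "u e' (n' + q - 1) = 0" if "q \<in> A" for q
      using that A_pos less.prems Suc n by (intro less.IH) (cases q; auto)+
    then have "(\<Sum>q\<in>A \<inter> {..2 * e' + 1}. u e' (n' + q - 1)) = 0"
      by (intro sum.neutral) auto
    ultimately show ?thesis unfolding Suc n u_Suc_Suc by simp
  qed
qed

definition row :: "nat \<Rightarrow> real \<Rightarrow> real" where
  "row e x = (\<Sum>n\<le>2 * e. u e n * x ^ n)"

text \<open>A new root edge splits a root of degree \<open>k\<close> into a root of degree
  \<open>n + 1\<close>, marked by \<open>x\<close>, and a vertex of degree \<open>k + 1 - n\<close>,
  which has to lie in \<open>A\<close>.\<close>

definition kernel :: "nat \<Rightarrow> real \<Rightarrow> real" where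
  "kernel k x = (\<Sum>n | n \<le> k \<and> k + 1 - n \<in> A. x ^ (n + 1))"

definition corner :: "nat \<Rightarrow> real \<Rightarrow> real" where
  "corner e x = (\<Sum>k\<le>2 * e. u e k * kernel k x)"

lemma row_0: "row 0 x = 1"
  by (simp add: row_def u_0)

lemma row_extend: "K \<ge> 2 * e \<Longrightarrow> row e x = (\<Sum>n\<le>K. u e n * x ^ n)"
  unfolding row_def by (intro sum.mono_neutral_left) (auto simp: u_eq_0)

lemma row_mult:
  assumes "i \<le> e"
  shows "row i x * row (e - i) x = (\<Sum>s\<le>2 * e. \<Sum>a\<le>s. u i a * u (e - i) (s - a) * x ^ s)"
proof -
  have "row i x * row (e - i) x = (\<Sum>(a, b)\<in>{..2 * e} \<times> {..2 * e}. u i a * u (e - i) b * x ^ (a + b))"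
    using assms by (simp add: row_extend[of i "2 * e"] row_extend[of "e - i" "2 * e"] sum_product
        sum.cartesian_product power_add mult_ac)
  also have "\<dots> = (\<Sum>(a, b)\<in>{(a, b). a + b \<le> 2 * e}. u i a * u (e - i) b * x ^ (a + b))"
  proof (intro sum.mono_neutral_right ballI)
    fix p assume "p \<in> {..2 * e} \<times> {..2 * e} - {(a, b). a + b \<le> 2 * e}"
    then obtain a b where p: "p = (a, b)" "a + b > 2 * e" by auto
    then have "a > 2 * i \<or> b > 2 * (e - i)" using assms by linarith
    then show "(case p of (a, b) \<Rightarrow> u i a * u (e - i) b * x ^ (a + b)) = 0"
      using p by (auto simp: u_eq_0)
  qed auto
  also have "\<dots> = (\<Sum>(s, a)\<in>(SIGMA s:{..2 * e}. {..s}). u i a * u (e - i) (s - a) * x ^ s)"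
    by (rule sum.reindex_bij_witness[where j = "\<lambda>(a, b). (a + b, a)" and i = "\<lambda>(s, a). (a, s - a)"]) auto
  also have "\<dots> = (\<Sum>s\<le>2 * e. \<Sum>a\<le>s. u i a * u (e - i) (s - a) * x ^ s)"
    by (simp add: sum.Sigma)
  finally show ?thesis .
qed

text \<open>Tutte's equation order by order: the root edge is a loop separating two maps, or it
  leads to another vertex, which gives the \<open>corner\<close> term.\<close>

lemma row_Suc: "row (Suc e) x = x ^ 2 * (\<Sum>i\<le>e. row i x * row (e - i) x) + corner e x"
proof -
  have "row (Suc e) x = (\<Sum>n\<le>2 * e + 1. u (Suc e) (Suc n) * x ^ Suc n)"
    unfolding row_def by (simp add: sum.atMost_Suc_shift u_Suc_0 del: sum.atMost_Suc)
  also have "\<dots> = (\<Sum>n\<le>2 * e + 1. (\<Sum>a<n. \<Sum>i\<le>e. u i a * u (e - i) (n - 1 - a)) * x ^ Suc n) +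
      (\<Sum>n\<le>2 * e + 1. (\<Sum>q\<in>A \<inter> {..2 * e + 1}. u e (n + q - 1)) * x ^ Suc n)"
    by (simp only: u_Suc_Suc distrib_right sum.distrib)
  also have "(\<Sum>n\<le>2 * e + 1. (\<Sum>a<n. \<Sum>i\<le>e. u i a * u (e - i) (n - 1 - a)) * x ^ Suc n) =
      (\<Sum>s\<le>2 * e. (\<Sum>a\<le>s. \<Sum>i\<le>e. u i a * u (e - i) (s - a)) * x ^ Suc (Suc s))"
    by (simp add: sum.atMost_Suc_shift lessThan_Suc_atMost del: sum.atMost_Suc)
  also have "\<dots> = (\<Sum>s\<le>2 * e. \<Sum>i\<le>e. \<Sum>a\<le>s. x ^ 2 * (u i a * u (e - i) (s - a) * x ^ s))"
    unfolding sum_distrib_right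
    by (rule sum.cong[OF refl], subst sum.swap) (simp add: power2_eq_square mult_ac)
  also have "\<dots> = x ^ 2 * (\<Sum>i\<le>e. row i x * row (e - i) x)"
    by (subst sum.swap) (simp add: row_mult sum_distrib_left)
  also have "(\<Sum>n\<le>2 * e + 1. (\<Sum>q\<in>A \<inter> {..2 * e + 1}. u e (n + q - 1)) * x ^ Suc n) = corner e x"
  proof -
    have A1: "Suc (n + q - Suc 0) - n = q" and A2: "n \<le> n + q - Suc 0" if "q \<in> A" for n q
      using that A_pos by (cases q; auto)+
    have "(\<Sum>n\<le>2 * e + 1. (\<Sum>q\<in>A \<inter> {..2 * e + 1}. u e (n + q - 1)) * x ^ Suc n) =
        (\<Sum>(n, q)\<in>{..2 * e + 1} \<times> (A \<inter> {..2 * e + 1}). u e (n + q - 1) * x ^ Suc n)"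
      by (simp add: sum_distrib_right sum.cartesian_product)
    also have "\<dots> = (\<Sum>(n, q)\<in>{(n, q). q \<in> A \<and> n + q \<le> 2 * e + 1}. u e (n + q - 1) * x ^ Suc n)"
      by (intro sum.mono_neutral_right) (auto intro!: u_eq_0)
    also have "\<dots> = (\<Sum>(k, n)\<in>(SIGMA k:{..2 * e}. {n. n \<le> k \<and> k + 1 - n \<in> A}). u e k * x ^ (n + 1))"
      by (intro sum.reindex_bij_witness[where j = "\<lambda>(n, q). (n + q - 1, n)" and i = "\<lambda>(k, n). (n, k + 1 - n)"])
         (auto simp: A1 A2)
    also have "\<dots> = corner e x"
      by (simp add: sum.Sigma corner_def kernel_def sum_distrib_left)
    finally show ?thesis .
  qed
  finally show ?thesis .
qed

lemma row_nonneg: "x \<ge> 0 \<Longrightarrow> row e x \<ge> 0"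
  unfolding row_def by (intro sum_nonneg mult_nonneg_nonneg u_nonneg) auto

lemma row_mono: "0 \<le> x \<Longrightarrow> x \<le> y \<Longrightarrow> row e x \<le> row e y"
  unfolding row_def by (intro sum_mono mult_left_mono power_mono u_nonneg) auto

section \<open>Convergence for small \<open>t\<close> and for \<open>x\<close> up to 2\<close>

lemma kernel_2_le: "kernel k 2 \<le> 4 * 2 ^ k"
proof -
  have "kernel k 2 \<le> (\<Sum>n\<le>k. 2 ^ (n + 1))"
    unfolding kernel_def by (intro sum_mono2) auto
  also have "\<dots> \<le> 4 * 2 ^ k" by (induction k) auto
  finally show ?thesis .
qed

lemma corner_2_le: "corner e 2 \<le> 4 * row e 2"
  unfolding corner_def row_def sum_distrib_left
proof (intro sum_mono)
  fix k
  have "u e k * kernel k 2 \<le> u e k * (4 * 2 ^ k)"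
    by (intro mult_left_mono kernel_2_le u_nonneg)
  then show "u e k * kernel k 2 \<le> 4 * (u e k * 2 ^ k)" by simp
qed

text \<open>The constants make the induction close: at x = 2 the bound 2 reproduces itself as 1 + (4
  * 2^2 + 4 * 2) / 24 = 2. Working at x = 2 leaves room to the right of x = 1, where the double root
  will be found.\<close>

lemma partial_sum_le: "(\<Sum>e\<le>E. row e 2 * (1 / 24) ^ e) \<le> 2"
proof (induction E)
  case (Suc E)
  let ?r = "\<lambda>e. row e 2 * (1 / 24) ^ e"
  let ?P = "\<Sum>e\<le>E. ?r e"
  have r: "?r e \<ge> 0" for e by (intro mult_nonneg_nonneg row_nonneg) auto
  have "(\<Sum>e\<le>Suc E. ?r e) = 1 + (\<Sum>e\<le>E. row (Suc e) 2 * (1 / 24) ^ Suc e)"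
    by (simp add: sum.atMost_Suc_shift row_0 del: sum.atMost_Suc)
  also have "(\<Sum>e\<le>E. row (Suc e) 2 * (1 / 24) ^ Suc e) =
      (\<Sum>e\<le>E. 4 / 24 * (\<Sum>i\<le>e. ?r i * ?r (e - i)) + 1 / 24 * (corner e 2 * (1 / 24) ^ e))"
  proof (intro sum.cong refl)
    fix e
    have "(\<Sum>i\<le>e. ?r i * ?r (e - i)) = (\<Sum>i\<le>e. row i 2 * row (e - i) 2) * (1 / 24) ^ e"
      unfolding sum_distrib_right
      by (intro sum.cong refl) (auto simp flip: power_add)
    then show "row (Suc e) 2 * (1 / 24) ^ Suc e =
        4 / 24 * (\<Sum>i\<le>e. ?r i * ?r (e - i)) + 1 / 24 * (corner e 2 * (1 / 24) ^ e)"
      by (simp add: row_Suc algebra_simps)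
  qed
  also have "\<dots> = 4 / 24 * (\<Sum>e\<le>E. \<Sum>i\<le>e. ?r i * ?r (e - i)) + 1 / 24 * (\<Sum>e\<le>E. corner e 2 * (1 / 24) ^ e)"
    by (simp add: sum.distrib sum_distrib_left)
  finally have eq: "(\<Sum>e\<le>Suc E. ?r e) = 1 + (4 / 24 * (\<Sum>e\<le>E. \<Sum>i\<le>e. ?r i * ?r (e - i)) +
      1 / 24 * (\<Sum>e\<le>E. corner e 2 * (1 / 24) ^ e))" .
  have le1: "(\<Sum>e\<le>E. \<Sum>i\<le>e. ?r i * ?r (e - i)) \<le> ?P * ?P"
  proof -
    have "(\<Sum>e\<le>E. \<Sum>i\<le>e. ?r i * ?r (e - i)) = (\<Sum>(e, i)\<in>(SIGMA e:{..E}. {..e}). ?r i * ?r (e - i))"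
      by (simp add: sum.Sigma)
    also have "\<dots> = (\<Sum>(i, j)\<in>{(i, j). i + j \<le> E}. ?r i * ?r j)"
      by (rule sum.reindex_bij_witness[where i = "\<lambda>(i, j). (i + j, i)" and j = "\<lambda>(e, i). (i, e - i)"]) auto
    also have "\<dots> \<le> (\<Sum>(i, j)\<in>{..E} \<times> {..E}. ?r i * ?r j)"
      using r by (intro sum_mono2) (auto simp del: times_divide_eq_right)
    also have "\<dots> = ?P * ?P" by (simp add: sum_product sum.cartesian_product)
    finally show ?thesis .
  qed
  have le2: "?P * ?P \<le> 2 * 2" using Suc.IH r by (intro mult_mono sum_nonneg) auto
  have "(\<Sum>e\<le>E. corner e 2 * (1 / 24) ^ e) \<le> (\<Sum>e\<le>E. 4 * ?r e)"
    using corner_2_le by (intro sum_mono) (auto simp: divide_right_mono power_one_over)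
  also have "\<dots> \<le> 4 * 2" using Suc.IH by (simp flip: sum_distrib_left)
  finally have le3: "(\<Sum>e\<le>E. corner e 2 * (1 / 24) ^ e) \<le> 4 * 2" .
  show ?case unfolding eq using le1 le2 le3 by linarith
qed (simp add: row_0)

definition gf :: "real \<Rightarrow> real \<Rightarrow> real" where
  "gf t x = (\<Sum>e. row e x * t ^ e)"

lemma summable_bound: "summable (\<lambda>e. row e 2 * (1 / 24) ^ e)"
proof (rule bounded_imp_summable)
  show "(\<Sum>e\<le>E. row e 2 * (1 / 24) ^ e) \<le> 2" for E by (rule partial_sum_le)
qed (intro mult_nonneg_nonneg row_nonneg; simp)

lemma term_bound:
  assumes "0 \<le> t" "t \<le> 1 / 24" "0 \<le> x" "x \<le> 2"
  shows "row e x * t ^ e \<le> row e 2 * (1 / 24) ^ e"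
  using assms by (intro mult_mono row_mono power_mono row_nonneg) auto

lemma term_nonneg: "0 \<le> t \<Longrightarrow> 0 \<le> x \<Longrightarrow> row e x * t ^ e \<ge> 0"
  by (intro mult_nonneg_nonneg row_nonneg) auto

lemma summable_row:
  assumes "0 \<le> t" "t \<le> 1 / 24" "0 \<le> x" "x \<le> 2"
  shows "summable (\<lambda>e. row e x * t ^ e)"
  using assms term_bound[OF assms] term_nonneg[of t x]
  by (intro summable_comparison_test'[OF summable_bound, of 0]) auto

lemma gf_le_2:
  assumes "0 \<le> t" "t \<le> 1 / 24" "0 \<le> x" "x \<le> 2"
  shows "gf t x \<le> 2"
  unfolding gf_def
proof (rule suminf_le_const[OF summable_row[OF assms]])
  fix n
  have "(\<Sum>e<n. row e x * t ^ e) \<le> (\<Sum>e\<le>n. row e 2 * (1 / 24) ^ e)"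
    using term_bound[OF assms] term_nonneg[of "1 / 24" 2]
    by (intro order.trans[OF sum_mono sum_mono2]) auto
  also have "\<dots> \<le> 2" by (rule partial_sum_le)
  finally show "(\<Sum>e<n. row e x * t ^ e) \<le> 2" .
qed

lemma continuous_gf:
  assumes "0 \<le> t" "t \<le> 1 / 24"
  shows "continuous_on {0..2} (gf t)"
proof -
  have "uniform_limit {0..2} (\<lambda>n x. \<Sum>e<n. row e x * t ^ e) (gf t) sequentially"
    unfolding gf_def
    using term_bound[OF assms] term_nonneg[OF assms(1)]
    by (intro Weierstrass_m_test[OF _ summable_bound]) auto
  then show ?thesis
    by (rule uniform_limit_theorem[rotated])
       (auto simp: row_def intro!: always_eventually continuous_intros)
qed

text \<open>\<open>row_Suc\<close> summed against powers of \<open>t\<close>, with the convolution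
  as a Cauchy product. The corner part stays a series because its closed form depends on
  \<open>A\<close>.\<close>

lemma functional_equation:
  assumes t: "0 \<le> t" "t \<le> 1 / 24" and x: "0 \<le> x" "x \<le> 2"
  shows "(\<lambda>e. corner e x * t ^ Suc e) sums (gf t x - 1 - t * x ^ 2 * gf t x ^ 2)"
proof -
  let ?r = "\<lambda>e. row e x * t ^ e"
  have s: "summable ?r" using summable_row assms by blast
  then have s': "summable (\<lambda>e. norm (?r e))" using term_nonneg[of t x] assms by simp
  have "(\<lambda>e. ?r (Suc e)) sums (gf t x - 1)"
    using sums_Suc_iff[of ?r "gf t x - 1"] summable_sums[OF s] by (simp add: gf_def row_0)
  moreover have "(\<lambda>e. t * x ^ 2 * (\<Sum>i\<le>e. ?r i * ?r (e - i))) sums (t * x ^ 2 * (gf t x * gf t x))"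
    unfolding gf_def by (intro sums_mult Cauchy_product_sums s')
  ultimately have "(\<lambda>e. ?r (Suc e) - t * x ^ 2 * (\<Sum>i\<le>e. ?r i * ?r (e - i))) sums
      (gf t x - 1 - t * x ^ 2 * (gf t x * gf t x))"
    by (rule sums_diff)
  moreover have "?r (Suc e) - t * x ^ 2 * (\<Sum>i\<le>e. ?r i * ?r (e - i)) = corner e x * t ^ Suc e" for e
  proof -
    have "(\<Sum>i\<le>e. ?r i * ?r (e - i)) = (\<Sum>i\<le>e. row i x * row (e - i) x) * t ^ e"
      unfolding sum_distrib_right
      by (intro sum.cong refl) (auto simp flip: power_add)
    then show ?thesis by (simp add: row_Suc algebra_simps)
  qed
  ultimately show ?thesis by (simp add: power2_eq_square)
qed

section \<open>From the functional equation to the exact radius\<close>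

definition total :: "real fps" where
  "total = Abs_fps (\<lambda>e. row e 1)"

lemma eval_total: "eval_fps total t = gf t 1"
  by (simp add: eval_fps_def total_def gf_def)

lemma fps_conv_radius_total_ge: "fps_conv_radius total \<ge> ereal (1 / 24)"
  unfolding fps_conv_radius_def total_def
  using conv_radius_geI[of "\<lambda>e. row e 1" "1 / 24"] summable_row[of "1 / 24" 1] by simp

text \<open>A common frame for both algebraic equations. Their validity for small positive
  \<open>t\<close> identifies the power series, and the binomial series then determines the radius
  beyond 1/24.\<close>

lemma conv_radius_total:
  assumes k: "k \<noteq> 0" and c: "c > 0"
    and eq: "\<And>t. 0 < t \<Longrightarrow> t < 1 / 24 \<Longrightarrow>
      (k * t ^ 2 * gf t 1 + 1 - a * t - b * t ^ 2) ^ 2 = (1 - c * t) ^ 3"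
  shows "fps_conv_radius total = 1 / ereal c"
proof -
  define P where "P = 1 - fps_const a * fps_X - fps_const b * fps_X ^ 2"
  define G where "G = fps_const k * fps_X ^ 2 * total + P"
  have P_poly: "P = fps_of_poly [:1, - a, - b:]"
    by (simp add: P_def fps_of_poly_pCons algebra_simps power2_eq_square flip: fps_const_neg)
  then have P: "fps_conv_radius P = \<infinity>" by simp
  have eval_P: "eval_fps P t = 1 - a * t - b * t ^ 2" for t
    by (simp add: P_poly power2_eq_square algebra_simps)
  have r: "fps_conv_radius G = fps_conv_radius total"
    unfolding G_def using k P by (rule fps_conv_radius_polynomial_part)
  have C: "(1 - fps_const c * fps_X) ^ 3 = fps_of_poly ([:1, - c:] ^ 3)"
    by (simp add: fps_of_poly_power fps_of_poly_pCons algebra_simps flip: fps_const_neg)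
  have "G ^ 2 - (1 - fps_const c * fps_X) ^ 3 = 0"
  proof (rule fps_eq_0_if_eval_0[of "1 / 24"])
    show "ereal (1 / 24) \<le> fps_conv_radius (G ^ 2 - (1 - fps_const c * fps_X) ^ 3)"
      using fps_conv_radius_diff[of "G ^ 2" "(1 - fps_const c * fps_X) ^ 3"]
        fps_conv_radius_power[of G 2] fps_conv_radius_total_ge
      unfolding C r by (simp add: min_def split: if_splits)
    fix t :: real assume t: "0 < t" "t < 1 / 24"
    have tr: "ereal (norm t) < fps_conv_radius total"
      using t by (intro less_le_trans[OF _ fps_conv_radius_total_ge]) auto
    have "ereal (norm t) < fps_conv_radius (fps_const k * fps_X ^ 2 * total)"
      using k tr fps_conv_radius_polynomial_part[of k 0 total] by simp
    then have "eval_fps G t = eval_fps (fps_const k * fps_X ^ 2 * total) t + eval_fps P t"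
      unfolding G_def using P by (intro eval_fps_add) auto
    also have "eval_fps (fps_const k * fps_X ^ 2 * total) t = k * t ^ 2 * gf t 1"
      using tr k by (simp add: eval_fps_mult fps_conv_radius_cmult_left eval_total)
    finally have G: "eval_fps G t = k * t ^ 2 * gf t 1 + 1 - a * t - b * t ^ 2"
      by (simp add: eval_P)
    have "eval_fps (G ^ 2 - (1 - fps_const c * fps_X) ^ 3) t = eval_fps (G ^ 2) t - eval_fps ((1 - fps_const c * fps_X) ^ 3) t"
      using tr fps_conv_radius_power[of G 2] unfolding C r by (intro eval_fps_diff) (auto intro: less_le_trans)
    also have "\<dots> = 0"
    proof -
      have "eval_fps ((1 - fps_const c * fps_X) ^ 3) t = (1 - c * t) ^ 3"
        unfolding C by (simp add: algebra_simps)
      then show ?thesis using eq[OF t] tr r by (simp add: eval_fps_power G)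
    qed
    finally show "eval_fps (G ^ 2 - (1 - fps_const c * fps_X) ^ 3) t = 0" .
  qed simp
  then have "G ^ 2 = (1 - fps_const c * fps_X) ^ 3" by simp
  moreover have "fps_nth G 0 = 1" by (simp add: G_def P_def)
  ultimately show ?thesis using conv_radius_sqrt_cube[OF c, of G] r by simp
qed

lemma conv_radius_total_general:
  assumes A: "A = {1..}"
  shows "fps_conv_radius total = 1 / 12"
proof -
  \<comment> \<open>All degrees are allowed, so the kernel is a geometric sum; clearing its
    denominator brings in the values of the rows at x = 1.\<close>
  have kernel: "(1 - x) * kernel k x = x * (1 - x * x ^ k)" for k x
  proof -
    have "{n. n \<le> k \<and> k + 1 - n \<in> A} = {..k}" by (auto simp: A)
    then have "kernel k x = x * (\<Sum>n\<le>k. x ^ n)" by (simp add: kernel_def sum_distrib_left)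
    then have "(1 - x) * kernel k x = x * ((1 - x) * (\<Sum>n\<le>k. x ^ n))" by (simp only: mult_ac)
    then show ?thesis by (simp add: sum_gp_basic)
  qed
  have corner: "(1 - x) * corner e x = x * (row e 1 - x * row e x)" for e x
  proof -
    have "(1 - x) * corner e x = (\<Sum>k\<le>2 * e. u e k * ((1 - x) * kernel k x))"
      by (simp only: corner_def sum_distrib_left mult_ac)
    then show ?thesis
      unfolding kernel row_def by (simp add: sum_distrib_left sum_subtractf algebra_simps)
  qed
  \<comment> \<open>The term with coefficient 0 gives the equation the shape of
    \<open>conv_radius_total\<close>, with b = 0.\<close>
  have "(54 * t ^ 2 * gf t 1 + 1 - 18 * t - 0 * t ^ 2) ^ 2 = (1 - 12 * t) ^ 3" if t: "0 < t" "t < 1 / 24" for t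
  proof -
    define M where "M = gf t 1"
    \<comment> \<open>The functional equation \<open>feq\<close> is quadratic in
      \<open>gf t x\<close>. Up to sign, \<open>?h\<close> is the derivative of this quadratic in
      the unknown, so its square is the discriminant.\<close>
    let ?h = "\<lambda>x. 1 - x + t * x ^ 2 - 2 * t * x ^ 2 * (1 - x) * gf t x"
    have feq: "(1 - x) * gf t x = (1 - x) + t * x ^ 2 * (1 - x) * gf t x ^ 2 + t * x * (M - x * gf t x)"
      if x: "0 \<le> x" "x \<le> 2" for x
    proof -
      have "(\<lambda>e. t * x * (row e 1 * t ^ e - x * (row e x * t ^ e))) sums (t * x * (M - x * gf t x))"
        unfolding M_def gf_def using t x by (intro sums_mult sums_diff summable_sums summable_row) auto
      moreover have "t * x * (row e 1 * t ^ e - x * (row e x * t ^ e)) = (1 - x) * (corner e x * t ^ Suc e)" for e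
      proof -
        have "(1 - x) * (corner e x * t ^ Suc e) = ((1 - x) * corner e x) * t ^ Suc e" by simp
        then show ?thesis unfolding corner by (simp add: algebra_simps)
      qed
      moreover have "(\<lambda>e. (1 - x) * (corner e x * t ^ Suc e)) sums ((1 - x) * (gf t x - 1 - t * x ^ 2 * gf t x ^ 2))"
        using t x by (intro sums_mult functional_equation) auto
      ultimately have "t * x * (M - x * gf t x) = (1 - x) * (gf t x - 1 - t * x ^ 2 * gf t x ^ 2)"
        by (simp add: sums_unique2)
      then show ?thesis by (simp add: algebra_simps)
    qed
    obtain x where x: "1 < x" "x < 3 / 2"
      and D: "(1 - x + t * x ^ 2) ^ 2 - 4 * t * x ^ 2 * (1 - x) * (1 - x + t * x * M) = 0"
      and D': "2 * (1 - x + t * x ^ 2) * (2 * t * x - 1)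
        - 4 * t * ((2 * x - 3 * x ^ 2) * (1 - x + t * x * M) + x ^ 2 * (1 - x) * (t * M - 1)) = 0"
    proof (rule square_double_root[where h = ?h and a = 1 and b = "3 / 2"])
      show "continuous_on {1..3 / 2} ?h"
        using t by (intro continuous_intros continuous_on_subset[OF continuous_gf]) auto
      \<comment> \<open>At x = 1 the value is \<open>t\<close>, which is positive; at 3/2 the bound
        2 on \<open>gf\<close> leaves at most 27/4 t - 1/2, negative for t < 1/24.\<close>
      show "?h (3 / 2) < 0"
      proof -
        have "t * gf t (3 / 2) \<le> t * 2" using gf_le_2[of t "3 / 2"] t by (intro mult_left_mono) auto
        moreover have "?h (3 / 2) = 9 / 4 * t + 9 / 4 * (t * gf t (3 / 2)) - 1 / 2"
          by (simp add: power2_eq_square algebra_simps)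
        ultimately show ?thesis using t by linarith
      qed
      fix x :: real
      show "(1 - x + t * x ^ 2) ^ 2 - 4 * t * x ^ 2 * (1 - x) * (1 - x + t * x * M) = ?h x ^ 2"
        if "x \<in> {1..3 / 2}"
      proof -
        have "1 - x + t * x * M = (1 - x) * gf t x + t * x ^ 2 * gf t x - t * x ^ 2 * (1 - x) * gf t x ^ 2"
          using feq[of x] that by (simp add: algebra_simps power2_eq_square)
        then show ?thesis by (simp only:) (simp add: algebra_simps power2_eq_square)
      qed
      show "((\<lambda>x. (1 - x + t * x ^ 2) ^ 2 - 4 * t * x ^ 2 * (1 - x) * (1 - x + t * x * M)) has_real_derivative
        2 * (1 - x + t * x ^ 2) * (2 * t * x - 1)
        - 4 * t * ((2 * x - 3 * x ^ 2) * (1 - x + t * x * M) + x ^ 2 * (1 - x) * (t * M - 1))) (at x)"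
        by (auto intro!: derivative_eq_intros simp: algebra_simps power2_eq_square)
    qed (use t in auto)
    from general_elimination[OF t(1) x(1) D D'] show ?thesis by (simp add: M_def)
  qed
  from conv_radius_total[of 54 12, OF _ _ this] show ?thesis by simp
qed

lemma conv_radius_total_even:
  assumes A: "A = {n. even n \<and> n > 0}"
  shows "fps_conv_radius total = 1 / 8"
proof -
  \<comment> \<open>All degrees add up to twice the number of edges, so even degrees elsewhere force
    an even root degree.\<close>
  have odd: "u e n = 0" if "odd n" for e n
    using that
  proof (induction e arbitrary: n rule: less_induct)
    case (less e)
    show ?case
    proof (cases e)
      case 0
      with less show ?thesis by (auto simp: u_0 odd_pos)
    next
      case (Suc e')
      obtain n' where n: "n = Suc n'" "even n'" using less.prems by (cases n) auto
      have "u i a * u (e' - i) (n' - 1 - a) = 0" if "a < n'" "i \<le> e'" for a i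
      proof (cases "odd a")
        case False
        then have "odd (n' - 1 - a)" using that n by auto
        then have "u (e' - i) (n' - 1 - a) = 0" using that Suc by (intro less.IH) auto
        then show ?thesis by simp
      qed (use that less.IH Suc in auto)
      then have "(\<Sum>a<n'. \<Sum>i\<le>e'. u i a * u (e' - i) (n' - 1 - a)) = 0"
      by (intro sum.neutral ballI) (simp del: mult_eq_0_iff)
    moreover have "u e' (n' + q - 1) = 0" if "q \<in> A" for q
        using that Suc n by (intro less.IH) (auto simp: A)
      then have "(\<Sum>q\<in>A \<inter> {..2 * e' + 1}. u e' (n' + q - 1)) = 0"
      by (intro sum.neutral) auto
    ultimately show ?thesis unfolding Suc n u_Suc_Suc by simp
    qed
  qed
  have kernel: "(1 - x ^ 2) * kernel k x = x ^ 2 * (1 - x ^ k)" if "even k" for k x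
  proof -
    from that obtain l where k: "k = 2 * l" by (auto elim: evenE)
    have "kernel k x = (\<Sum>j<l. x ^ 2 * (x ^ 2) ^ j)"
      unfolding kernel_def k
      by (rule sum.reindex_bij_witness[where i = "\<lambda>j. 2 * j + 1" and j = "\<lambda>n. n div 2"])
         (auto simp: A power_mult power2_eq_square elim!: oddE evenE)
    also have "\<dots> = x ^ 2 * (\<Sum>j<l. (x ^ 2) ^ j)" by (simp add: sum_distrib_left)
    finally have "(1 - x ^ 2) * kernel k x = x ^ 2 * ((1 - x ^ 2) * (\<Sum>j<l. (x ^ 2) ^ j))"
      by (simp only: mult_ac)
    also have "\<dots> = x ^ 2 * (1 - x ^ k)"
      by (simp add: one_diff_power_eq[symmetric] k power_mult)
    finally show ?thesis .
  qed
  have corner: "(1 - x ^ 2) * corner e x = x ^ 2 * (row e 1 - row e x)" for e x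
  proof -
    have "(1 - x ^ 2) * corner e x = (\<Sum>k\<le>2 * e. u e k * ((1 - x ^ 2) * kernel k x))"
      by (simp only: corner_def sum_distrib_left mult_ac)
    also have "\<dots> = (\<Sum>k\<le>2 * e. u e k * (x ^ 2 * (1 - x ^ k)))"
    proof (intro sum.cong refl)
      fix k
      show "u e k * ((1 - x ^ 2) * kernel k x) = u e k * (x ^ 2 * (1 - x ^ k))"
        using kernel[of k x] odd[of k e] by (cases "even k") auto
    qed
    finally show ?thesis
      unfolding row_def by (simp add: sum_distrib_left sum_subtractf algebra_simps)
  qed
  have "(32 * t ^ 2 * gf t 1 + 1 - 12 * t - 8 * t ^ 2) ^ 2 = (1 - 8 * t) ^ 3" if t: "0 < t" "t < 1 / 24" for t
  proof -
    define M where "M = gf t 1"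
    \<comment> \<open>Only even powers of \<open>x\<close> occur, and the denominator to clear is 1
      - x^2. In the variable y = x^2 this is again a quadratic equation with a simple factor 1 - y,
      valid for \<open>y\<close> up to 4.\<close>
    define g where "g y = gf t (sqrt y)" for y
    let ?h = "\<lambda>y. 1 - y + t * y - 2 * t * y * (1 - y) * g y"
    have feq: "(1 - y) * g y = (1 - y) + t * y * (1 - y) * g y ^ 2 + t * y * (M - g y)"
      if y: "0 \<le> y" "y \<le> 4" for y
    proof -
      define x where "x = sqrt y"
      have x: "0 \<le> x" "x \<le> 2" "x ^ 2 = y" "g y = gf t x"
        using y real_sqrt_le_mono[of y 4] by (auto simp: x_def g_def)
      have "(\<lambda>e. t * x ^ 2 * (row e 1 * t ^ e - row e x * t ^ e)) sums (t * x ^ 2 * (M - gf t x))"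
        unfolding M_def gf_def using t x by (intro sums_mult sums_diff summable_sums summable_row) auto
      moreover have "t * x ^ 2 * (row e 1 * t ^ e - row e x * t ^ e) = (1 - x ^ 2) * (corner e x * t ^ Suc e)" for e
      proof -
        have "(1 - x ^ 2) * (corner e x * t ^ Suc e) = ((1 - x ^ 2) * corner e x) * t ^ Suc e" by simp
        then show ?thesis unfolding corner by (simp add: algebra_simps)
      qed
      moreover have "(\<lambda>e. (1 - x ^ 2) * (corner e x * t ^ Suc e)) sums ((1 - x ^ 2) * (gf t x - 1 - t * x ^ 2 * gf t x ^ 2))"
        using t x by (intro sums_mult functional_equation) auto
      ultimately have "t * x ^ 2 * (M - gf t x) = (1 - x ^ 2) * (gf t x - 1 - t * x ^ 2 * gf t x ^ 2)"
        by (simp add: sums_unique2)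
      then show ?thesis unfolding x by (simp add: algebra_simps)
    qed
    obtain y where y: "1 < y" "y < 9 / 4"
      and D: "(1 - y + t * y) ^ 2 - 4 * t * y * (1 - y) * (1 - y + t * y * M) = 0"
      and D': "2 * (1 - y + t * y) * (t - 1)
        - 4 * t * ((1 - 2 * y) * (1 - y + t * y * M) + y * (1 - y) * (t * M - 1)) = 0"
    proof (rule square_double_root[where h = ?h and a = 1 and b = "9 / 4"])
      have "continuous_on {1..9 / 4} g"
        unfolding g_def using t real_sqrt_le_mono[of _ 4]
        by (intro continuous_on_compose2[OF continuous_gf] continuous_intros) auto
      then show "continuous_on {1..9 / 4} ?h" by (intro continuous_intros)
      have "sqrt (9 / 4) = 3 / 2" by (rule real_sqrt_unique) (auto simp: power2_eq_square)
      then have "g (9 / 4) \<le> 2" using gf_le_2[of t "3 / 2"] t unfolding g_def by (simp only:)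
      \<comment> \<open>The right end is the square of 3/2; the bound 2 on \<open>g\<close> leaves
        at most 27/2 t - 5/4.\<close>
      then show "?h (9 / 4) < 0"
      proof -
        have "t * g (9 / 4) \<le> t * 2" using \<open>g (9 / 4) \<le> 2\<close> t by (intro mult_left_mono) auto
        moreover have "?h (9 / 4) = 9 / 4 * t + 45 / 8 * (t * g (9 / 4)) - 5 / 4"
          by (simp add: algebra_simps)
        ultimately show ?thesis using t by linarith
      qed
      fix y :: real
      show "(1 - y + t * y) ^ 2 - 4 * t * y * (1 - y) * (1 - y + t * y * M) = ?h y ^ 2"
        if "y \<in> {1..9 / 4}"
      proof -
        have "1 - y + t * y * M = (1 - y) * g y + t * y * g y - t * y * (1 - y) * g y ^ 2"
          using feq[of y] that by (simp add: algebra_simps power2_eq_square)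
        then show ?thesis by (simp only:) (simp add: algebra_simps power2_eq_square)
      qed
      show "((\<lambda>y. (1 - y + t * y) ^ 2 - 4 * t * y * (1 - y) * (1 - y + t * y * M)) has_real_derivative
        2 * (1 - y + t * y) * (t - 1)
        - 4 * t * ((1 - 2 * y) * (1 - y + t * y * M) + y * (1 - y) * (t * M - 1))) (at y)"
        by (auto intro!: derivative_eq_intros simp: algebra_simps power2_eq_square)
    qed (use t in auto)
    from even_elimination[OF t(1) y(1) D D'] show ?thesis by (simp add: M_def)
  qed
  from conv_radius_total[of 32 8, OF _ _ this] show ?thesis by simp
qed

end

section \<open>Rooted planar maps\<close>

definition monomials :: "nat set \<Rightarrow> nat \<Rightarrow> nat multiset set" where
  "monomials A d = {m. set_mset m \<subseteq> A \<and> \<Sum>\<^sub># m = d}"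

lemma conv_radius_mono:
  assumes "eventually (\<lambda>n. norm (f n) \<le> norm (g n)) sequentially"
  shows "conv_radius g \<le> conv_radius f"
  unfolding conv_radius_altdef
proof (intro Liminf_mono eventually_mono[OF assms])
  fix n assume "norm (f n) \<le> norm (g n)"
  then show "inverse (ereal (root n (norm (g n)))) \<le> inverse (ereal (root n (norm (f n))))"
    by (intro ereal_inverse_antimono) (cases "n = 0"; simp add: real_root_ge_zero)+
qed

lemma size_le_sum_mset: "0 \<notin># m \<Longrightarrow> size m \<le> \<Sum>\<^sub># (m :: nat multiset)"
proof (induction m)
  case (add n m)
  then have "n \<ge> 1" by (cases n) auto
  with add show ?case by simp
qed simp

lemma member_le_sum_mset: "q \<in># m \<Longrightarrow> q \<le> \<Sum>\<^sub># (m :: nat multiset)"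
  by (auto dest: multi_member_split)

lemma finite_monomials [simp]:
  assumes "0 \<notin> A"
  shows "finite (monomials A d)"
proof (rule finite_subset)
  show "monomials A d \<subseteq> mset ` {xs. set xs \<subseteq> {..d} \<and> length xs \<le> d}"
  proof
    fix m assume m: "m \<in> monomials A d"
    obtain xs where xs: "m = mset xs" using ex_mset by metis
    have "size m \<le> d" using m assms size_le_sum_mset[of m] by (auto simp: monomials_def)
    moreover have "set_mset m \<subseteq> {..d}" using m member_le_sum_mset by (auto simp: monomials_def)
    ultimately show "m \<in> mset ` {xs. set xs \<subseteq> {..d} \<and> length xs \<le> d}"
      using xs by auto
  qed
  show "finite (mset ` {xs. set xs \<subseteq> {..d} \<and> length xs \<le> d})"
    by (intro finite_imageI finite_lists_length_le) simp
qed

lemma monomials_0: "0 \<notin> A \<Longrightarrow> monomials A 0 = {{#}}"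
  by (auto simp: monomials_def) (metis multiset_nonemptyE subsetD)

definition planar_corr :: "nat \<Rightarrow> nat multiset \<Rightarrow> real" where
  "planar_corr n m = of_rat (coeff (genus_poly n m) 0)"

lemma planar_corr_0: "planar_corr 0 m = (if m = {#} then 1 else 0)"
  by (simp add: planar_corr_def)

text \<open>The handle term of \<open>genus_poly\<close> carries a factor of degree 1 and drops out
  of the constant coefficient.\<close>

lemma planar_corr_Suc:
  "planar_corr (Suc n) m =
     (\<Sum>a<n. \<Sum>p | p \<subseteq># m. planar_corr a p * planar_corr (n - 1 - a) (m - p)) +
     (\<Sum>q\<in>set_mset m. planar_corr (n + q - 1) (m - {#q#}))"
  by (simp add: planar_corr_def coeff_sum coeff_mult of_rat_sum of_rat_add of_rat_mult)

text \<open>The number of half-edges is \<open>d\<close>; the root vertex has degree \<open>n\<close> and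
  the degrees of all other vertices lie in \<open>A\<close>.\<close>

definition rooted :: "nat set \<Rightarrow> nat \<Rightarrow> nat \<Rightarrow> real" where
  "rooted A d n = (if n \<le> d then \<Sum>m\<in>monomials A (d - n). planar_corr n m else 0)"

lemma rooted_0:
  assumes "0 \<notin> A"
  shows "rooted A d 0 = (if d = 0 then 1 else 0)"
proof (cases "d = 0")
  case False
  then have "planar_corr 0 m = 0" if "m \<in> monomials A d" for m
    using that by (auto simp: planar_corr_0 monomials_def)
  then show ?thesis using False by (simp add: rooted_def)
qed (use assms in \<open>simp add: rooted_def monomials_0 planar_corr_0\<close>)

lemma rooted_1:
  assumes "0 \<notin> A"
  shows "rooted A 1 n = 0"
proof (cases n)
  case (Suc k)
  then show ?thesis using assms by (cases k) (auto simp: rooted_def monomials_0 planar_corr_Suc)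
qed (use assms rooted_0 in auto)

lemma sum_monomials_split:
  fixes f g :: "nat multiset \<Rightarrow> real"
  assumes "0 \<notin> A"
  shows "(\<Sum>m\<in>monomials A e. \<Sum>p | p \<subseteq># m. f p * g (m - p)) =
         (\<Sum>i\<le>e. (\<Sum>p\<in>monomials A i. f p) * (\<Sum>r\<in>monomials A (e - i). g r))"
proof -
  have "(\<Sum>m\<in>monomials A e. \<Sum>p | p \<subseteq># m. f p * g (m - p)) =
      (\<Sum>(m, p)\<in>(SIGMA m:monomials A e. {p. p \<subseteq># m}). f p * g (m - p))"
    using assms by (simp add: sum.Sigma)
  also have "\<dots> = (\<Sum>(i, p, r)\<in>(SIGMA i:{..e}. monomials A i \<times> monomials A (e - i)). f p * g r)"
  proof -
    have 1: "\<Sum>\<^sub># p \<le> e" "p \<in> monomials A (\<Sum>\<^sub># p)" "m - p \<in> monomials A (e - \<Sum>\<^sub># p)"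
      if "m \<in> monomials A e" "p \<subseteq># m" for m p
      using that sum_mset_split[OF that(2)] by (auto simp: monomials_def dest: mset_subset_eqD in_diffD)
    have 2: "p + r \<in> monomials A e" if "i \<le> e" "p \<in> monomials A i" "r \<in> monomials A (e - i)" for i p r
      using that by (auto simp: monomials_def)
    have 3: "\<Sum>\<^sub># p = i" if "p \<in> monomials A i" for p i
      using that by (simp add: monomials_def)
    show ?thesis
      by (rule sum.reindex_bij_witness[where j = "\<lambda>(m, p). (\<Sum>\<^sub># p, p, m - p)" and i = "\<lambda>(i, p, r). (p + r, p)"])
         (auto intro: 1 2 dest: 3 simp: subset_mset.add_diff_inverse)
  qed
  also have "\<dots> = (\<Sum>i\<le>e. (\<Sum>p\<in>monomials A i. f p) * (\<Sum>r\<in>monomials A (e - i). g r))"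
    using assms by (simp add: sum_product sum.cartesian_product sum.Sigma)
  finally show ?thesis .
qed

lemma sum_monomials_remove:
  fixes f :: "nat \<Rightarrow> nat multiset \<Rightarrow> real"
  assumes "0 \<notin> A"
  shows "(\<Sum>m\<in>monomials A e. \<Sum>q\<in>set_mset m. f q (m - {#q#})) =
         (\<Sum>q\<in>A \<inter> {..e}. \<Sum>r\<in>monomials A (e - q). f q r)"
proof -
  have "(\<Sum>m\<in>monomials A e. \<Sum>q\<in>set_mset m. f q (m - {#q#})) =
      (\<Sum>(m, q)\<in>(SIGMA m:monomials A e. set_mset m). f q (m - {#q#}))"
    using assms by (simp add: sum.Sigma)
  also have "\<dots> = (\<Sum>(q, r)\<in>(SIGMA q:A \<inter> {..e}. monomials A (e - q)). f q r)"
  proof -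
    have 1: "q \<in> A" "q \<le> e" "m - {#q#} \<in> monomials A (e - q)" if "m \<in> monomials A e" "q \<in># m" for m q
      using that member_le_sum_mset[OF that(2)] sum_mset_split[of "{#q#}" m]
      by (auto simp: monomials_def dest: in_diffD)
    have 2: "add_mset q r \<in> monomials A e" if "q \<in> A" "q \<le> e" "r \<in> monomials A (e - q)" for q r
      using that by (auto simp: monomials_def)
    show ?thesis
      by (rule sum.reindex_bij_witness[where j = "\<lambda>(m, q). (q, m - {#q#})" and i = "\<lambda>(q, r). (add_mset q r, q)"])
         (auto intro: 1 2)
  qed
  also have "\<dots> = (\<Sum>q\<in>A \<inter> {..e}. \<Sum>r\<in>monomials A (e - q). f q r)"
    using assms by (simp add: sum.Sigma)
  finally show ?thesis .
qed

lemma rooted_Suc_Suc: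
  assumes A: "0 \<notin> A"
  shows "rooted A (d + 2) (Suc n) =
    (\<Sum>a<n. \<Sum>i\<le>d. rooted A i a * rooted A (d - i) (n - 1 - a)) +
    (\<Sum>q\<in>A \<inter> {..d + 1}. rooted A d (n + q - 1))"
proof (cases "n \<le> d + 1")
  case True
  define e where "e = d + 1 - n"
  have "rooted A (d + 2) (Suc n) = (\<Sum>m\<in>monomials A e. planar_corr (Suc n) m)"
    using True by (simp add: rooted_def e_def)
  also have "\<dots> = (\<Sum>a<n. \<Sum>m\<in>monomials A e. \<Sum>p | p \<subseteq># m. planar_corr a p * planar_corr (n - 1 - a) (m - p)) +
      (\<Sum>m\<in>monomials A e. \<Sum>q\<in>set_mset m. planar_corr (n + q - 1) (m - {#q#}))"
    unfolding planar_corr_Suc sum.distrib by (subst sum.swap) simp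
  also have "(\<Sum>a<n. \<Sum>m\<in>monomials A e. \<Sum>p | p \<subseteq># m. planar_corr a p * planar_corr (n - 1 - a) (m - p)) =
      (\<Sum>a<n. \<Sum>i\<le>d. rooted A i a * rooted A (d - i) (n - 1 - a))"
  proof (intro sum.cong refl)
    fix a assume "a \<in> {..<n}"
    then have a: "a < n" by simp
    have "(\<Sum>m\<in>monomials A e. \<Sum>p | p \<subseteq># m. planar_corr a p * planar_corr (n - 1 - a) (m - p)) =
        (\<Sum>i\<le>e. (\<Sum>p\<in>monomials A i. planar_corr a p) * (\<Sum>r\<in>monomials A (e - i). planar_corr (n - 1 - a) r))"
      by (rule sum_monomials_split[OF A])
    \<comment> \<open>On the left \<open>i\<close> counts the half-edges outside the root; in
      \<open>rooted\<close> the root degree \<open>a\<close> is included, hence the shift.\<close>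
    also have "\<dots> = (\<Sum>i\<in>{a..a + e}. rooted A i a * rooted A (d - i) (n - 1 - a))"
    proof (rule sum.reindex_bij_witness[where i = "\<lambda>i. i - a" and j = "\<lambda>i. i + a"])
      fix i assume "i \<in> {..e}"
      then have "d - (i + a) - (n - 1 - a) = e - i" "n - 1 - a \<le> d - (i + a)"
        using a True by (auto simp: e_def)
      then show "rooted A (i + a) a * rooted A (d - (i + a)) (n - 1 - a) =
          (\<Sum>p\<in>monomials A i. planar_corr a p) * (\<Sum>r\<in>monomials A (e - i). planar_corr (n - 1 - a) r)"
        by (simp add: rooted_def)
    qed auto
    also have "\<dots> = (\<Sum>i\<le>d. rooted A i a * rooted A (d - i) (n - 1 - a))"
    proof (intro sum.mono_neutral_left ballI)
      show "{a..a + e} \<subseteq> {..d}" using a True by (auto simp: e_def)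
      fix i assume "i \<in> {..d} - {a..a + e}"
      then have "i < a \<or> d - i < n - 1 - a" using a True by (auto simp: e_def)
      then show "rooted A i a * rooted A (d - i) (n - 1 - a) = 0" by (auto simp: rooted_def)
    qed simp
    finally show "(\<Sum>m\<in>monomials A e. \<Sum>p | p \<subseteq># m. planar_corr a p * planar_corr (n - 1 - a) (m - p)) =
        (\<Sum>i\<le>d. rooted A i a * rooted A (d - i) (n - 1 - a))" .
  qed
  also have "(\<Sum>m\<in>monomials A e. \<Sum>q\<in>set_mset m. planar_corr (n + q - 1) (m - {#q#})) =
      (\<Sum>q\<in>A \<inter> {..e}. \<Sum>r\<in>monomials A (e - q). planar_corr (n + q - 1) r)"
    by (rule sum_monomials_remove[OF A])
  also have "\<dots> = (\<Sum>q\<in>A \<inter> {..e}. rooted A d (n + q - 1))"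
  proof (intro sum.cong refl)
    fix q assume "q \<in> A \<inter> {..e}"
    then have "q > 0" "q \<le> e" using A by (auto intro: gr0I)
    then have "d - (n + q - 1) = e - q" "n + q - 1 \<le> d" using True by (auto simp: e_def)
    then show "(\<Sum>r\<in>monomials A (e - q). planar_corr (n + q - 1) r) = rooted A d (n + q - 1)"
      by (simp add: rooted_def)
  qed
  also have "\<dots> = (\<Sum>q\<in>A \<inter> {..d + 1}. rooted A d (n + q - 1))"
    by (intro sum.mono_neutral_left) (auto simp: e_def rooted_def)
  finally show ?thesis .
next
  case False
  have "(\<Sum>a<n. \<Sum>i\<le>d. rooted A i a * rooted A (d - i) (n - 1 - a)) = 0"
    using False by (intro sum.neutral ballI) (auto simp: rooted_def)
  moreover have "(\<Sum>q\<in>A \<inter> {..d + 1}. rooted A d (n + q - 1)) = 0"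
    using False by (intro sum.neutral ballI) (auto simp: rooted_def)
  ultimately show ?thesis using False by (simp add: rooted_def)
qed

text \<open>Half-edges are paired into edges. In the recursion \<open>d\<close> drops by two, and
  splitting an odd number leaves an odd part.\<close>

lemma rooted_odd:
  assumes A: "0 \<notin> A" and "odd d"
  shows "rooted A d n = 0"
  using assms(2)
proof (induction d arbitrary: n rule: less_induct)
  case (less d)
  show ?case
  proof (cases "d = 1 \<or> n = 0")
    case True
    then show ?thesis using A less.prems rooted_1[of A n] rooted_0[of A d] by (auto simp: odd_pos)
  next
    case False
    then obtain d' n' where d: "d = d' + 2" "odd d'" "n = Suc n'"
      using less.prems by (cases n; cases d; cases "d - 1") auto
    have "rooted A i a * rooted A (d' - i) b = 0" if "i \<le> d'" for i a b
    proof (cases "odd i")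
      case False
      then have "odd (d' - i)" using that d by auto
      then show ?thesis using less.IH[of "d' - i"] d by simp
    qed (use that d less.IH in auto)
    then have "(\<Sum>a<n'. \<Sum>i\<le>d'. rooted A i a * rooted A (d' - i) (n' - 1 - a)) = 0"
      by (intro sum.neutral ballI) (simp del: mult_eq_0_iff)
    then show ?thesis
      using less.IH[of d'] d rooted_Suc_Suc[OF A, of d' n'] by simp
  qed
qed

lemma planar_recursion_rooted:
  assumes A: "0 \<notin> A"
  shows "planar_recursion A (\<lambda>e n. rooted A (2 * e) n)"
proof
  show "rooted A (2 * 0) n = (if n = 0 then 1 else 0)" for n
    using rooted_0[OF A, of 0] by (auto simp: rooted_def)
  show "rooted A (2 * Suc e) 0 = 0" for e using rooted_0[OF A] by simp
  fix e n
  have "(\<Sum>i\<le>2 * e. rooted A i a * rooted A (2 * e - i) b) =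
      (\<Sum>i\<le>e. rooted A (2 * i) a * rooted A (2 * (e - i)) b)" for a b
  proof -
    have "(\<Sum>i\<le>2 * e. rooted A i a * rooted A (2 * e - i) b) =
        (\<Sum>i\<in>(\<lambda>i. 2 * i) ` {..e}. rooted A i a * rooted A (2 * e - i) b)"
    proof (intro sum.mono_neutral_right ballI)
      fix i assume "i \<in> {..2 * e} - (\<lambda>i. 2 * i) ` {..e}"
      then have "odd i" by (auto elim!: evenE)
      then show "rooted A i a * rooted A (2 * e - i) b = 0" using rooted_odd[OF A] by simp
    qed auto
    also have "\<dots> = (\<Sum>i\<le>e. rooted A (2 * i) a * rooted A (2 * (e - i)) b)"
      by (subst sum.reindex) (auto simp: inj_on_def right_diff_distrib')
    finally show ?thesis .
  qed
  then show "rooted A (2 * Suc e) (Suc n) =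
      (\<Sum>a<n. \<Sum>i\<le>e. rooted A (2 * i) a * rooted A (2 * (e - i)) (n - 1 - a)) +
      (\<Sum>q\<in>A \<inter> {..2 * e + 1}. rooted A (2 * e) (n + q - 1))"
    using rooted_Suc_Suc[OF A, of "2 * e" n] by simp
qed (rule A)

text \<open>The coefficients of the planar series for the potential with \<open>a_n = 1\<close> on
  \<open>A\<close> and 0 elsewhere.\<close>

definition planar_sum :: "nat set \<Rightarrow> nat \<Rightarrow> real" where
  "planar_sum A e = (\<Sum>m\<in>monomials A (2 * e). of_rat (formal_planar_limit m))"

lemma planar_sum_nonneg: "planar_sum A e \<ge> 0"
  unfolding planar_sum_def by (intro sum_nonneg) (simp add: formal_planar_limit_nonneg)

text \<open>Rooting at \<open>n\<close> costs the factor \<open>n * count m n\<close>, and over all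
  \<open>n\<close> these add up to the total degree \<open>2 * e\<close>.\<close>

lemma planar_sum_rooted:
  assumes A: "0 \<notin> A"
  shows "real (2 * e) * planar_sum A e = (\<Sum>n\<in>A \<inter> {..2 * e}. rooted A (2 * e) n)"
proof -
  have "real (2 * e) * planar_sum A e = (\<Sum>m\<in>monomials A (2 * e). real (\<Sum>\<^sub># m) * of_rat (formal_planar_limit m))"
    unfolding planar_sum_def sum_distrib_left by (intro sum.cong) (auto simp: monomials_def)
  also have "\<dots> = (\<Sum>m\<in>monomials A (2 * e). \<Sum>n\<in>set_mset m. planar_corr n (m - {#n#}))"
  proof (intro sum.cong refl)
    fix m assume "m \<in> monomials A (2 * e)"
    then have m: "0 \<notin># m" using A by (auto simp: monomials_def)
    have "planar_corr n (m - {#n#}) = real (n * count m n) * of_rat (formal_planar_limit m)" if "n \<in># m" for n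
      unfolding planar_corr_def formal_planar_limit_root[OF m that, symmetric]
      by (simp only: of_rat_mult of_rat_of_nat_eq)
    then have "(\<Sum>n\<in>set_mset m. planar_corr n (m - {#n#})) =
        (\<Sum>n\<in>set_mset m. real (count m n) * real n) * of_rat (formal_planar_limit m)"
      by (simp add: sum_distrib_left sum_distrib_right mult_ac)
    also have "(\<Sum>n\<in>set_mset m. real (count m n) * real n) = real (\<Sum>\<^sub># m)"
      using sum_mset_count[of real m] by (simp add: of_nat_sum_mset)
    finally show "real (\<Sum>\<^sub># m) * of_rat (formal_planar_limit m) = (\<Sum>n\<in>set_mset m. planar_corr n (m - {#n#}))" ..
  qed
  also have "\<dots> = (\<Sum>n\<in>A \<inter> {..2 * e}. \<Sum>r\<in>monomials A (2 * e - n). planar_corr n r)"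
    by (rule sum_monomials_remove[OF A])
  also have "\<dots> = (\<Sum>n\<in>A \<inter> {..2 * e}. rooted A (2 * e) n)"
    by (intro sum.cong) (auto simp: rooted_def)
  finally show ?thesis .
qed

text \<open>Rooting a map amounts to applying \<open>2 t d/dt\<close>, which does not change the radius of convergence.\<close>

lemma conv_radius_planar_sum:
  assumes A: "0 \<notin> A"
    and zero: "\<And>e n. n \<notin> A \<Longrightarrow> n > 0 \<Longrightarrow> rooted A (2 * e) n = 0"
  shows "conv_radius (planar_sum A) = fps_conv_radius (planar_recursion.total (\<lambda>e n. rooted A (2 * e) n))"
proof -
  interpret planar_recursion A "\<lambda>e n. rooted A (2 * e) n"
    by (rule planar_recursion_rooted[OF A])
  define S where "S = Abs_fps (planar_sum A)"
  have row: "row e 1 = (if e = 0 then 1 else real (2 * e) * planar_sum A e)" for e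
  proof (cases "e = 0")
    case False
    have "row e 1 = (\<Sum>n\<le>2 * e. rooted A (2 * e) n)" by (simp add: row_def)
    also have "\<dots> = (\<Sum>n\<in>A \<inter> {..2 * e}. rooted A (2 * e) n)"
    proof (intro sum.mono_neutral_right ballI)
      fix n assume "n \<in> {..2 * e} - A \<inter> {..2 * e}"
      then show "rooted A (2 * e) n = 0"
        using zero[of n e] rooted_0[OF A, of "2 * e"] False by (cases "n = 0") auto
    qed auto
    finally show ?thesis using False planar_sum_rooted[OF A] by simp
  qed (simp add: row_0)
  show ?thesis
  proof (rule antisym)
    have "total = 1 + fps_const 2 * (fps_X * fps_deriv S)"
      by (rule fps_ext) (auto simp: total_def row S_def fps_eq_iff)
    then have "fps_conv_radius total \<ge> fps_conv_radius (fps_const 2 * (fps_X * fps_deriv S))"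
      using fps_conv_radius_add[of 1 "fps_const 2 * (fps_X * fps_deriv S)"] by simp
    moreover have "fps_conv_radius (fps_const 2 * (fps_X * fps_deriv S)) \<ge> fps_conv_radius S"
      using fps_conv_radius_mult[of fps_X "fps_deriv S"] fps_conv_radius_deriv[of S]
      by (simp add: fps_conv_radius_cmult_left)
    ultimately have "fps_conv_radius total \<ge> fps_conv_radius S" by (rule order.trans[rotated])
    then show "conv_radius (planar_sum A) \<le> fps_conv_radius total"
      by (simp add: S_def fps_conv_radius_def)
    \<comment> \<open>For the converse a comparison suffices: rooting multiplies by
      \<open>2 * e\<close>, which only enlarges the coefficients.\<close>
    have "norm (planar_sum A e) \<le> norm (row e 1)" if "e \<ge> 1" for e
    proof -
      have "1 * planar_sum A e \<le> real (2 * e) * planar_sum A e"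
        using that by (intro mult_right_mono planar_sum_nonneg) auto
      then show ?thesis using that planar_sum_nonneg[of A e] by (simp add: row)
    qed
    then have "conv_radius (\<lambda>e. row e 1) \<le> conv_radius (planar_sum A)"
      by (intro conv_radius_mono eventually_sequentiallyI[of 1])
    then show "fps_conv_radius total \<le> conv_radius (planar_sum A)"
      by (simp add: fps_conv_radius_def total_def)
  qed
qed

lemma conv_radius_planar_sum_general: "conv_radius (planar_sum {1..}) = 1 / 12"
proof -
  interpret planar_recursion "{1..}" "\<lambda>e n. rooted {1..} (2 * e) n"
    by (rule planar_recursion_rooted) simp
  show ?thesis using conv_radius_planar_sum[of "{1..}"] conv_radius_total_general by simp
qed

lemma conv_radius_planar_sum_even: "conv_radius (planar_sum {n. even n \<and> n > 0}) = 1 / 8"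
proof -
  let ?A = "{n. even n \<and> n > 0} :: nat set"
  interpret planar_recursion ?A "\<lambda>e n. rooted ?A (2 * e) n"
    by (rule planar_recursion_rooted) simp
  \<comment> \<open>A positive degree outside the set is odd, and then even degrees cannot make up
    the rest of \<open>2 * e\<close>.\<close>
  have zero: "rooted ?A (2 * e) n = 0" if "n \<notin> ?A" "n > 0" for e n
  proof (cases "n \<le> 2 * e")
    case True
    have "odd (2 * e - n)" using that True by auto
    moreover have "even (\<Sum>\<^sub># m)" if "set_mset m \<subseteq> ?A" for m using that by (induction m) auto
    ultimately have "set_mset m \<subseteq> ?A \<Longrightarrow> \<Sum>\<^sub># m \<noteq> 2 * e - n" for m by metis
    then have "monomials ?A (2 * e - n) = {}" by (simp add: monomials_def)
    then show ?thesis by (simp add: rooted_def)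
  qed (simp add: rooted_def)
  show ?thesis using conv_radius_planar_sum[of ?A] conv_radius_total_even zero by simp
qed

lemma monomials_eq: "{m. 0 \<notin># m \<and> \<Sum>\<^sub># m = d} = monomials {1..} d"
  by (auto simp: monomials_def subset_iff Suc_le_eq intro: gr0I)

lemma norm_of_rat: "norm (of_rat r :: 'a :: real_normed_field) = of_rat \<bar>r\<bar>"
proof -
  have "of_rat r = (of_real (of_rat r) :: 'a)"
    by (cases r) (simp add: of_rat_rat of_real_divide)
  then show ?thesis by (metis norm_of_real abs_of_rat)
qed

text \<open>Since the planar coefficients are nonnegative, the triangle inequality replaces each
  product by \<open>c ^ (2 * e)\<close>, which is exactly its value for a_n = c^n.\<close>

lemma norm_planar_series_le:
  fixes a :: "nat \<Rightarrow> 'a :: real_normed_field"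
  assumes bound: "\<And>n. n > 0 \<Longrightarrow> norm (a n) \<le> c ^ n"
    and A: "0 \<notin> A" "\<And>n. n > 0 \<Longrightarrow> n \<notin> A \<Longrightarrow> a n = 0"
  shows "norm (fps_nth (planar_series a) e) \<le> c ^ (2 * e) * planar_sum A e"
proof -
  have prod_le: "norm (\<Prod>n\<in>#m. a n) \<le> c ^ (\<Sum>\<^sub># m)" if "0 \<notin># m" for m
    using that
  proof (induction m)
    case (add n m)
    then show ?case using bound[of n]
      by (auto simp: norm_mult power_add intro!: mult_mono order.trans[OF norm_ge_zero])
  qed simp
  have "fps_nth (planar_series a) e =
      (\<Sum>m\<in>monomials {1..} (2 * e). of_rat (formal_planar_limit m) * (\<Prod>n\<in>#m. a n))"
    unfolding planar_series_def monomials_eq by simp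
  also have "\<dots> = (\<Sum>m\<in>monomials A (2 * e). of_rat (formal_planar_limit m) * (\<Prod>n\<in>#m. a n))"
  proof (intro sum.mono_neutral_right ballI)
    show "monomials A (2 * e) \<subseteq> monomials {1..} (2 * e)"
      using A(1) by (auto simp: monomials_def subset_iff Suc_le_eq intro!: gr0I)
    fix m assume "m \<in> monomials {1..} (2 * e) - monomials A (2 * e)"
    then obtain n where "n \<in># m" "n > 0" "n \<notin> A" by (auto simp: monomials_def)
    then have "0 \<in># {#a n. n \<in># m#}" using A(2)[of n] by force
    then show "of_rat (formal_planar_limit m) * (\<Prod>n\<in>#m. a n) = 0" by simp
  qed simp
  also have "norm \<dots> \<le> (\<Sum>m\<in>monomials A (2 * e). c ^ (2 * e) * of_rat (formal_planar_limit m))"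
  proof (rule sum_norm_le)
    fix m assume m: "m \<in> monomials A (2 * e)"
    then have "0 \<notin># m" "\<Sum>\<^sub># m = 2 * e" using A(1) by (auto simp: monomials_def)
    with prod_le[of m] formal_planar_limit_nonneg[of m]
    show "norm (of_rat (formal_planar_limit m) * (\<Prod>n\<in>#m. a n)) \<le> c ^ (2 * e) * of_rat (formal_planar_limit m)"
      by (auto simp: norm_mult norm_of_rat mult.commute[of _ "of_rat _"] intro!: mult_left_mono)
  qed
  also have "\<dots> = c ^ (2 * e) * planar_sum A e"
    by (simp add: planar_sum_def sum_distrib_left)
  finally show ?thesis .
qed

text \<open>The case of equality in \<open>norm_planar_series_le\<close>, from which sharpness
  follows.\<close>

lemma planar_series_power:
  assumes A: "0 \<notin> A"
  shows "fps_nth (planar_series (\<lambda>n. if n \<in> A then of_real c ^ n else 0 :: 'a :: real_normed_field)) e =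
         of_real ((c ^ 2) ^ e * planar_sum A e)"
proof -
  let ?a = "\<lambda>n. if n \<in> A then of_real c ^ n else 0 :: 'a"
  have rat: "of_rat r = (of_real (of_rat r) :: 'a)" for r
    by (cases r) (simp add: of_rat_rat of_real_divide)
  have prod: "(\<Prod>n\<in>#m. ?a n) = (if set_mset m \<subseteq> A then of_real c ^ \<Sum>\<^sub># m else 0)" for m
    by (induction m) (auto simp: power_add)
  have "fps_nth (planar_series ?a) e =
      (\<Sum>m\<in>monomials {1..} (2 * e). of_rat (formal_planar_limit m) * (\<Prod>n\<in>#m. ?a n))"
    unfolding planar_series_def monomials_eq by simp
  also have "\<dots> = (\<Sum>m\<in>monomials A (2 * e). of_rat (formal_planar_limit m) * (\<Prod>n\<in>#m. ?a n))"
  proof (intro sum.mono_neutral_right finite_monomials ballI)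
    show "monomials A (2 * e) \<subseteq> monomials {1..} (2 * e)"
      using A by (auto simp: monomials_def subset_iff Suc_le_eq intro!: gr0I)
  qed (auto simp: prod monomials_def)
  also have "\<dots> = (\<Sum>m\<in>monomials A (2 * e). of_real ((c ^ 2) ^ e * of_rat (formal_planar_limit m)))"
    unfolding prod by (intro sum.cong) (auto simp: monomials_def rat power_mult)
  also have "\<dots> = of_real ((c ^ 2) ^ e * planar_sum A e)"
    by (simp add: planar_sum_def sum_distrib_left)
  finally show ?thesis .
qed

lemma conv_radius_planar_series_power:
  assumes A: "0 \<notin> A" and c: "c > 0"
  shows "fps_conv_radius (planar_series (\<lambda>n. if n \<in> A then of_real c ^ n else 0 :: 'a :: {banach, real_normed_field})) =
         conv_radius (planar_sum A) / ereal (c ^ 2)"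
proof -
  have "fps_conv_radius (planar_series (\<lambda>n. if n \<in> A then of_real c ^ n else 0 :: 'a)) =
      conv_radius (\<lambda>e. of_real ((c ^ 2) ^ e * planar_sum A e) :: 'a)"
    unfolding fps_conv_radius_def planar_series_power[OF A] ..
  also have "\<dots> = conv_radius (\<lambda>e. (c ^ 2) ^ e * planar_sum A e)"
    by (intro conv_radius_cong always_eventually allI) (simp only: norm_of_real real_norm_def)
  also have "\<dots> = conv_radius (planar_sum A) / ereal (c ^ 2)"
    using c by (subst conv_radius_mult_power) auto
  finally show ?thesis .
qed

lemma alpha_power:
  assumes c: "c > 0" and A: "n0 \<in> A" "n0 > 0"
  shows "alpha (\<lambda>n. if n \<in> A then of_real c ^ n else 0 :: 'a :: real_normed_field) = ereal c"
proof -
  have root: "root n (norm (if n \<in> A then of_real c ^ n else 0 :: 'a)) = (if n \<in> A then c else 0)" if "n \<ge> 1" for n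
    using c that by (simp add: norm_power real_root_power_cancel)
  show ?thesis
    unfolding alpha_def
  proof (rule antisym)
    show "(SUP n\<in>{1..}. ereal (root n (norm (if n \<in> A then of_real c ^ n else 0 :: 'a)))) \<le> ereal c"
      using c root by (intro SUP_least) auto
    show "ereal c \<le> (SUP n\<in>{1..}. ereal (root n (norm (if n \<in> A then of_real c ^ n else 0 :: 'a))))"
      using A root[of n0] by (intro SUP_upper2[of n0]) auto
  qed
qed

lemma fps_even_potential_iff:
  fixes a :: "nat \<Rightarrow> 'a :: real_normed_field"
  shows "fps_even (potential a) \<longleftrightarrow> (\<forall>n. odd n \<longrightarrow> a n = 0)"
proof -
  have nth: "fps_nth (potential a) n = (if n = 2 then 1 / 2 else 0) - (if n = 0 then 0 else a n / of_nat n)" for n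
    by (simp add: potential_def fps_X_power_nth)
  have "fps_compose V (- fps_X) = Abs_fps (\<lambda>n. (- 1) ^ n * fps_nth V n)" for V :: "'a fps"
    using fps_compose_linear[of V "- 1"] by (simp flip: fps_const_neg)
  then have "fps_even (potential a) \<longleftrightarrow> (\<forall>n. (- 1) ^ n * fps_nth (potential a) n = fps_nth (potential a) n)"
    by (simp add: fps_even_def fps_eq_iff)
  also have "\<dots> \<longleftrightarrow> (\<forall>n. odd n \<longrightarrow> fps_nth (potential a) n = 0)"
  proof (intro all_cong1)
    fix n
    have "- x = x \<longleftrightarrow> x = 0" for x :: 'a by (simp add: neg_eq_iff_add_eq_0 flip: mult_2)
    then show "((- 1) ^ n * fps_nth (potential a) n = fps_nth (potential a) n) \<longleftrightarrow> (odd n \<longrightarrow> fps_nth (potential a) n = 0)"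
      by (cases "even n") auto
  qed
  also have "\<dots> \<longleftrightarrow> (\<forall>n. odd n \<longrightarrow> a n = 0)"
    by (auto simp: nth elim: oddE)
  finally show ?thesis .
qed

text \<open>For finite positive \<open>alpha\<close> the majorant is \<open>planar_sum A\<close>
  with \<open>t\<close> rescaled by \<open>alpha\<close> squared. Extended real division covers the
  extremes: the bound is 0 for infinite \<open>alpha\<close> and infinite for
  \<open>alpha = 0\<close>.\<close>

lemma conv_radius_planar_series_ge:
  fixes a :: "nat \<Rightarrow> 'a :: {banach, real_normed_field}"
  assumes A: "0 \<notin> A" "\<And>n. n > 0 \<Longrightarrow> n \<notin> A \<Longrightarrow> a n = 0"
    and R: "conv_radius (planar_sum A) = 1 / ereal R" and "R > 0"
  shows "fps_conv_radius (planar_series a) \<ge> 1 / (ereal R * alpha a ^ 2)"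
proof -
  have upper: "ereal (root n (norm (a n))) \<le> alpha a" if "n > 0" for n
    unfolding alpha_def using that by (intro SUP_upper) auto
  have "alpha a \<ge> 0" using upper[of 1] by (rule order.trans[rotated]) auto
  then consider "alpha a = \<infinity>" | c where "alpha a = ereal c" "c \<ge> 0" by (cases "alpha a") auto
  then show ?thesis
  proof cases
    case 1
    then show ?thesis using \<open>R > 0\<close> by (simp add: fps_conv_radius_def conv_radius_nonneg)
  next
    case 2
    have bound: "norm (a n) \<le> c ^ n" if "n > 0" for n
    proof -
      have "root n (norm (a n)) \<le> c" using upper[OF that] 2 by simp
      then have "root n (norm (a n)) ^ n \<le> c ^ n" using that by (intro power_mono) auto
      then show ?thesis using that by simp
    qed
    have "conv_radius (\<lambda>e. c ^ (2 * e) * planar_sum A e) \<le> fps_conv_radius (planar_series a)"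
      unfolding fps_conv_radius_def
      using norm_planar_series_le[OF bound A] 2 planar_sum_nonneg[of A]
      by (intro conv_radius_mono always_eventually) (auto simp: abs_mult)
    moreover have "conv_radius (\<lambda>e. c ^ (2 * e) * planar_sum A e) = 1 / (ereal R * alpha a ^ 2)"
    proof (cases "c = 0")
      case True
      \<comment> \<open>Every coefficient with \<open>e \<ge> 1\<close> vanishes, and finitely many
        terms do not affect the radius.\<close>
      have "conv_radius (\<lambda>e. c ^ (2 * e) * planar_sum A e) = conv_radius (\<lambda>_. 0 :: real)"
        using True by (intro conv_radius_cong eventually_sequentiallyI[of 1]) auto
      then show ?thesis using True 2 by (simp add: power2_eq_square divide_ereal_def flip: zero_ereal_def)
    next
      case False
      then show ?thesis
        using 2 R \<open>R > 0\<close> conv_radius_mult_power[of "c ^ 2" "planar_sum A"]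
        by (simp add: power_mult divide_ereal_def)
    qed
    ultimately show ?thesis by simp
  qed
qed

theorem corollary11p1:
  shows "(\<forall>a :: nat \<Rightarrow> 'a :: {banach, real_normed_field}. fps_even (potential a) \<longrightarrow>
            fps_conv_radius (planar_series a) \<ge> 1 / (8 * alpha a ^ 2))
       \<and> (\<forall>a :: nat \<Rightarrow> 'a. fps_conv_radius (planar_series a) \<ge> 1 / (12 * alpha a ^ 2))
       \<and> (\<forall>c :: real. c > 0 \<longrightarrow> (\<exists>a :: nat \<Rightarrow> 'a. fps_even (potential a) \<and> alpha a = ereal c \<and>
            fps_conv_radius (planar_series a) = 1 / (8 * alpha a ^ 2)))
       \<and> (\<forall>c :: real. c > 0 \<longrightarrow> (\<exists>a :: nat \<Rightarrow> 'a. alpha a = ereal c \<and>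
            fps_conv_radius (planar_series a) = 1 / (12 * alpha a ^ 2)))"
proof (intro conjI allI impI)
  let ?E = "{n. even n \<and> n > 0} :: nat set"
  \<comment> \<open>The free parameter \<open>c\<close> gives a sharp example for every positive
    finite value of \<open>alpha\<close>.\<close>
  let ?a = "\<lambda>A c n. if n \<in> A then of_real c ^ n else 0 :: 'a"
  have "(8 :: ereal) = ereal 8" "(12 :: ereal) = ereal 12" by auto
  note num = this
  have ereal_div: "1 / ereal r / ereal s = 1 / ereal (r * s)" if "r > 0" "s > 0" for r s
    using that by (simp add: one_ereal_def)
  show "fps_conv_radius (planar_series a) \<ge> 1 / (8 * alpha a ^ 2)"
    if "fps_even (potential a)" for a :: "nat \<Rightarrow> 'a"
    unfolding num using that conv_radius_planar_sum_even num
    by (intro conv_radius_planar_series_ge[of ?E]) (auto simp: fps_even_potential_iff)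
  show "fps_conv_radius (planar_series a) \<ge> 1 / (12 * alpha a ^ 2)" for a :: "nat \<Rightarrow> 'a"
    unfolding num using conv_radius_planar_sum_general num
    by (intro conv_radius_planar_series_ge[of "{1..}"]) auto
  fix c :: real assume c: "c > 0"
  have "fps_even (potential (?a ?E c))" by (auto simp: fps_even_potential_iff)
  moreover have "alpha (?a ?E c) = ereal c" using c by (intro alpha_power[of _ 2]) auto
  moreover have "fps_conv_radius (planar_series (?a ?E c)) = 1 / (8 * ereal c ^ 2)"
    using c by (subst conv_radius_planar_series_power) (auto simp: conv_radius_planar_sum_even num ereal_div)
  ultimately show "\<exists>a :: nat \<Rightarrow> 'a. fps_even (potential a) \<and> alpha a = ereal c \<and>
      fps_conv_radius (planar_series a) = 1 / (8 * alpha a ^ 2)" by metis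
  have "alpha (?a {1..} c) = ereal c" using c by (intro alpha_power[of _ 1]) auto
  moreover have "fps_conv_radius (planar_series (?a {1..} c)) = 1 / (12 * ereal c ^ 2)"
  proof -
    have "fps_conv_radius (planar_series (?a {1..} c)) = conv_radius (planar_sum {1..}) / ereal (c ^ 2)"
      using c by (intro conv_radius_planar_series_power) auto
    then show ?thesis using c unfolding conv_radius_planar_sum_general by (simp add: num ereal_div)
  qed
  ultimately show "\<exists>a :: nat \<Rightarrow> 'a. alpha a = ereal c \<and>
      fps_conv_radius (planar_series a) = 1 / (12 * alpha a ^ 2)" by metis
qed

end
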